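(* Let $M=S^2$ or $M=\mathbb{R}P^2$, let $n_0=3$ if $M=S^2$ and $n_0=2$ if $M=\mathbb{R}P^2$, and let $n\geq n_0$. In $\pi_1(I_n)$, we have: $$\widehat\tau_n^{\,2}=\begin{cases}\partial_n(\widetilde\lambda_{\widetilde x_0}+\cdots+\widetilde\lambda_{\widetilde x_{n-3}}+\widetilde\lambda_{\widetilde z_0}-\widetilde\lambda_{-\widetilde z_0}) & \text{if } M=S^2,\\ \partial_n(\lambda_{x_0}+\cdots+\lambda_{x_{n-2}}+\lambda_{z_0}) & \text{if } M=\mathbb{R}P^2.\end{cases}$$
   Context: Notation. $I=[0,1]$; $c_x$ is the constant path at $x$; $S^2\subset\mathbb{R}^3$ is the unit sphere with spherical coordinates $(\theta,\phi)$, $\theta\in[0,2\pi)$ the longitude and $\phi\in[-\frac{\pi}{2},\frac{\pi}{2}]$ the latitude, the prime meridian passing through $\widetilde x_0=(1,0,0)$; $\pi\colon S^2\to\mathbb{R}P^2$ is the universal covering. $F_n(M)$ is the $n$th configuration space of $M$ (pairwise distinct $n$-tuples). Let $\widetilde z_0=(0,0,1)$, and for $j\ge 0$ let $\widetilde x_j$ be the point with $(\theta,\phi)=\bigl(0,\frac{\pi}{2}\cdot\frac{j}{j+1}\bigr)$; put $z_0=\pi(\widetilde z_0)$, $x_j=\pi(\widetilde x_j)$. Basepoint and homotopy fibre. $W_n=(w_1,\ldots,w_n)$ is $(\widetilde x_0,\ldots,\widetilde x_{n-3},\widetilde z_0,-\widetilde z_0)$ if $M=S^2$ and $(x_0,\ldots,x_{n-2},z_0)$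 if $M=\mathbb{R}P^2$. The homotopy fibre of the inclusion $\iota_n\colon F_n(M)\to\prod_1^nM$ is $I_n=\{(x,\lambda)\in F_n(M)\times(\prod_1^nM)^I : \lambda(0)=x,\ \lambda(1)=W_n\}$, with basepoint $(W_n,c_{W_n})$; its elements are written $(y_1,\ldots,y_n,l_1,\ldots,l_n)$, $l_i$ being a path in $M$ from $y_i$ to $w_i$. The boundary homomorphism $\partial_n\colon\pi_2(\prod_1^nM,W_n)=\pi_1(\prod_{i=1}^n\Omega(M,w_i),(c_{w_1},\ldots,c_{w_n}))\to\pi_1(I_n)$ of the homotopy fibration of $\iota_n$ is the one induced by the map $\prod_{i=1}^n\Omega(M,w_i)\to I_n$, $\omega\mapsto(w_1,\ldots,w_n,\omega)$. The group $\pi_2(\prod_1^n M)$ is written additively and $\pi_1(I_n)$ multiplicatively. Loops. Let $p_i\colon\mathbb{R}^3\to\mathbb{R}$ be the $i$th coordinate. Let $\Pi_0$ be the tangent plane to $S^2$ at $\widetilde x_0$, let $D\subset\Pi_0$ be the line $x=1,\ y=0$, and for $t\in I$ let $\Pi_t$ be obtained by rotating $\Pi_0$ about $D$ through the angle $t\pi$. Let $\widetilde\omega_{\widetilde x_0,t}$ be the circle $S^2\cap\Pi_t$, parametrised as a loop $s\in I\mapsto\widetilde\omega_{\widetilde x_0,t}(s)$ based at $\widetilde x_0$, continuously in $(t,s)$, so that: (Xa) for $s\in(0,1)$, $p_2(\widetilde\omega_{\widetilde x_0,t}(s))<0$ if $t\in(0,\frac12)$ and $>0$ if $t\in(\frac12,1)$;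 (Xb) for $t\in(0,1)$, $p_3(\widetilde\omega_{\widetilde x_0,t}(s))<0$ if $s\in(0,\frac12)$ and $>0$ if $s\in(\frac12,1)$; (Xc) $p_i(\widetilde\omega_{\widetilde x_0,t}(s))=p_i(\widetilde\omega_{\widetilde x_0,t}(1-s))$ for $i=1,2$ and $p_3(\widetilde\omega_{\widetilde x_0,t}(s))=-p_3(\widetilde\omega_{\widetilde x_0,t}(1-s))$; (Xd) $p_2(\widetilde\omega_{\widetilde x_0,t}(s))=-p_2(\widetilde\omega_{\widetilde x_0,1-t}(s))$ and $p_i(\widetilde\omega_{\widetilde x_0,t}(s))=p_i(\widetilde\omega_{\widetilde x_0,1-t}(s))$ for $i=1,3$; (Xe) for all $t$, $p_1(\widetilde\omega_{\widetilde x_0,t}(s))>0$ if $s\in[0,\frac14)$, and $p_1(\widetilde\omega_{\widetilde x_0,\frac12}(s))<0$ if $s\in(\frac14,\frac12]$. Thus $\widetilde\omega_{\widetilde x_0,0}=\widetilde\omega_{\widetilde x_0,1}=c_{\widetilde x_0}$ and each point of $S^2\setminus\{\widetilde x_0\}$ is $\widetilde\omega_{\widetilde x_0,t}(s)$ for unique $t,s\in(0,1)$. Let $R(x,y,z)=(z,-y,x)$, and set $\widetilde\omega_{\widetilde z_0,t}=R\circ\widetilde\omega_{\widetilde x_0,t}$ and $\widetilde\omega_{-\widetilde z_0,t}=-\widetilde\omega_{\widetilde z_0,1-t}$. Let $J_j\colon S^2\to S^2$ be the homeomorphism $J_j(\theta,\phi)=\bigl(\theta,\phi+(\frac{\pi}{2}-\phi)\frac{j}{j+1}\bigr)$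 if $\phi\ge0$ and $J_j(\theta,\phi)=\bigl(\theta,\phi+(\frac{\pi}{2}+\phi)\frac{j}{j+1}\bigr)$ if $\phi<0$; set $\widetilde\omega_{\widetilde x_j,t}=J_j\circ\widetilde\omega_{\widetilde x_0,t}$ and $h_{j,t}(r)=\widetilde\omega_{\widetilde x_j,t}\bigl(\frac{1+r}{2}\bigr)$ for $r\in I$. Classes. If $M=S^2$ and $u\in\{\widetilde x_0,\ldots,\widetilde x_{n-3},\widetilde z_0,-\widetilde z_0\}$, then $\widetilde\lambda_u=[(\widetilde\omega_{u,t})_{t\in I}]\in\pi_1(\Omega(S^2),c_u)=\pi_2(S^2,u)$ (a generator); if $M=\mathbb{R}P^2$ and $u\in\{\widetilde x_0,\ldots,\widetilde x_{n-2},\widetilde z_0\}$, then $\lambda_{\pi(u)}=[(\pi\circ\widetilde\omega_{u,t})_{t\in I}]\in\pi_2(\mathbb{R}P^2,\pi(u))$. They are viewed in $\pi_2(\prod_1^nM,W_n)$ via the inclusion of the factor whose basepoint is $u$ (resp. $\pi(u)$); together they form a basis of this free Abelian group. Finally $\widehat\tau_n\in\pi_1(I_n)$ is the class of the loop, parametrised by $t\in I$, $$\bigl(\widetilde\omega_{\widetilde x_0,t}(\tfrac12),\ldots,\widetilde\omega_{\widetilde x_{n-3},t}(\tfrac12),\widetilde z_0,-\widetilde z_0,h_{0,t},\ldots,h_{n-3,t},c_{\widetilde z_0},c_{-\widetilde z_0}\bigr)\quad\text{if } M=S^2,$$ $$\bigl(\pi(\widetilde\omega_{\widetilde x_0,t}(\tfrac12)),\ldots,\pi(\widetilde\omega_{\widetilde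 x_{n-2},t}(\tfrac12)),z_0,\pi\circ h_{0,t},\ldots,\pi\circ h_{n-2,t},c_{z_0}\bigr)\quad\text{if } M=\mathbb{R}P^2.$$ *)

theory Defs
  imports "HOL-Analysis.Analysis" "HOL-Algebra.Group"
begin

section \<open>Quotient and compact-open topologies\<close>

definition quotient_topology :: "'a topology \<Rightarrow> ('a \<Rightarrow> 'b) \<Rightarrow> 'b topology" where
  "quotient_topology X f =
     topology (\<lambda>U. U \<subseteq> f ` topspace X \<and> openin X {x \<in> topspace X. f x \<in> U})"

lemma openin_quotient_topology:
  "openin (quotient_topology X f) U \<longleftrightarrow>
     U \<subseteq> f ` topspace X \<and> openin X {x \<in> topspace X. f x \<in> U}"
proof -
  have "istopology (\<lambda>U. U \<subseteq> f ` topspace X \<and> openin X {x \<in> topspace X. f x \<in> U})"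
    unfolding istopology_def
  proof (intro conjI allI impI)
    fix S T
    assume S: "S \<subseteq> f ` topspace X \<and> openin X {x \<in> topspace X. f x \<in> S}"
      and T: "T \<subseteq> f ` topspace X \<and> openin X {x \<in> topspace X. f x \<in> T}"
    show "S \<inter> T \<subseteq> f ` topspace X" using S by blast
    have "{x \<in> topspace X. f x \<in> S \<inter> T}
        = {x \<in> topspace X. f x \<in> S} \<inter> {x \<in> topspace X. f x \<in> T}" by blast
    moreover have "openin X ({x \<in> topspace X. f x \<in> S} \<inter> {x \<in> topspace X. f x \<in> T})"
      by (rule openin_Int) (use S T in blast)+
    ultimately show "openin X {x \<in> topspace X. f x \<in> S \<inter> T}" by (simp only:)
  next
    fix K
    assume K: "\<forall>U\<in>K. U \<subseteq> f ` topspace X \<and> openin X {x \<in> topspace X. f x \<in> U}"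
    show "\<Union>K \<subseteq> f ` topspace X" using K by blast
    have "{x \<in> topspace X. f x \<in> \<Union>K} = (\<Union>U\<in>K. {x \<in> topspace X. f x \<in> U})" by blast
    moreover have "openin X (\<Union>U\<in>K. {x \<in> topspace X. f x \<in> U})"
      by (rule openin_Union) (use K in blast)
    ultimately show "openin X {x \<in> topspace X. f x \<in> \<Union>K}" by (simp only:)
  qed
  then show ?thesis
    unfolding quotient_topology_def by (simp only: topology_inverse')
qed

lemma topspace_quotient_topology [simp]:
  "topspace (quotient_topology X f) = f ` topspace X"
proof (rule subset_antisym)
  have "openin (quotient_topology X f) (topspace (quotient_topology X f))"
    by (rule openin_topspace)
  then show "topspace (quotient_topology X f) \<subseteq> f ` topspace X"
    unfolding openin_quotient_topology by (rule conjunct1)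
  have "{x \<in> topspace X. f x \<in> f ` topspace X} = topspace X" by blast
  then have "openin (quotient_topology X f) (f ` topspace X)"
    unfolding openin_quotient_topology by (metis openin_topspace order_refl)
  then show "f ` topspace X \<subseteq> topspace (quotient_topology X f)"
    by (rule openin_subset)
qed

lemma quotient_map_quotient_topology: "quotient_map X (quotient_topology X f) f"
  unfolding quotient_map_def
proof (intro conjI allI impI)
  show "f ` topspace X = topspace (quotient_topology X f)"
    by (rule topspace_quotient_topology [symmetric])
  fix U assume "U \<subseteq> topspace (quotient_topology X f)"
  then have U: "U \<subseteq> f ` topspace X" by (simp only: topspace_quotient_topology)
  show "openin X {x \<in> topspace X. f x \<in> U} \<longleftrightarrow> openin (quotient_topology X f) U"
    unfolding openin_quotient_topology using U by (simp only: simp_thms)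
qed

text \<open>A continuous map is represented by the function that is \<^term>\<open>undefined\<close> off the domain, so
  that distinct points of the mapping space are distinct maps.\<close>

definition compact_open_topology :: "'a topology \<Rightarrow> 'b topology \<Rightarrow> ('a \<Rightarrow> 'b) topology" where
  "compact_open_topology X Y =
     topology_generated_by
       {{f \<in> extensional (topspace X). continuous_map X Y f \<and> f ` K \<subseteq> U} | K U.
          compactin X K \<and> openin Y U}"

lemma topspace_compact_open_topology:
  "topspace (compact_open_topology X Y) = {f \<in> extensional (topspace X). continuous_map X Y f}"
proof -
  have "{f \<in> extensional (topspace X). continuous_map X Y f}
    \<in> {{f \<in> extensional (topspace X). continuous_map X Y f \<and> f ` K \<subseteq> U} | K U.
          compactin X K \<and> openin Y U}"
    by (rule CollectI, rule exI[of _ "{}"], rule exI[of _ "{}"]) auto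
  then show ?thesis
    unfolding compact_open_topology_def topology_generated_by_topspace by blast
qed


section \<open>The fundamental group and loop spaces\<close>

abbreviation unit_interval :: "real topology" where
  "unit_interval \<equiv> top_of_set {0..1}"

definition loop_in :: "'a topology \<Rightarrow> 'a \<Rightarrow> (real \<Rightarrow> 'a) \<Rightarrow> bool" where
  "loop_in X x p \<longleftrightarrow> pathin X p \<and> p 0 = x \<and> p 1 = x"

definition loop_class :: "'a topology \<Rightarrow> 'a \<Rightarrow> (real \<Rightarrow> 'a) \<Rightarrow> (real \<Rightarrow> 'a) set" where
  "loop_class X x p = {q. homotopic_with (\<lambda>r. r 0 = x \<and> r 1 = x) unit_interval X p q}"

definition join_loops :: "(real \<Rightarrow> 'a) \<Rightarrow> (real \<Rightarrow> 'a) \<Rightarrow> real \<Rightarrow> 'a" where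
  "join_loops p q = (\<lambda>t. if t \<le> 1/2 then p (2 * t) else q (2 * t - 1))"

definition fundamental_group :: "'a topology \<Rightarrow> 'a \<Rightarrow> (real \<Rightarrow> 'a) set monoid" where
  "fundamental_group X x =
     \<lparr>carrier = loop_class X x ` Collect (loop_in X x),
      mult = (\<lambda>c d. \<Union>p\<in>c. \<Union>q\<in>d. loop_class X x (join_loops p q)),
      one = loop_class X x (\<lambda>_. x)\<rparr>"

text \<open>The map induced on fundamental groups by a pointed map into \<open>(Y, y)\<close>.\<close>

definition induced_map ::
  "'b topology \<Rightarrow> 'b \<Rightarrow> ('a \<Rightarrow> 'b) \<Rightarrow> (real \<Rightarrow> 'a) set \<Rightarrow> (real \<Rightarrow> 'b) set" where
  "induced_map Y y f c = (\<Union>p\<in>c. loop_class Y y (f \<circ> p))"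

definition const_loop :: "'a \<Rightarrow> real \<Rightarrow> 'a" where
  "const_loop w = (\<lambda>s\<in>{0..1}. w)"

definition loop_space :: "'a topology \<Rightarrow> 'a \<Rightarrow> (real \<Rightarrow> 'a) topology" where
  "loop_space M w =
     subtopology (compact_open_topology unit_interval M) {\<gamma>. \<gamma> 0 = w \<and> \<gamma> 1 = w}"


section \<open>Configuration spaces and the homotopy fibre\<close>

definition power_space :: "nat \<Rightarrow> 'a topology \<Rightarrow> (nat \<Rightarrow> 'a) topology" where
  "power_space n M = product_topology (\<lambda>_. M) {1..n}"

definition config_space :: "nat \<Rightarrow> 'a topology \<Rightarrow> (nat \<Rightarrow> 'a) topology" where
  "config_space n M = subtopology (power_space n M) {x. inj_on x {1..n}}"

definition htpy_fibre ::
  "nat \<Rightarrow> 'a topology \<Rightarrow> (nat \<Rightarrow> 'a) \<Rightarrow> ((nat \<Rightarrow> 'a) \<times> (real \<Rightarrow> nat \<Rightarrow> 'a)) topology" where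
  "htpy_fibre n M W =
     subtopology
       (prod_topology (config_space n M) (compact_open_topology unit_interval (power_space n M)))
       {(x, l). l 0 = x \<and> l 1 = W}"

definition htpy_fibre_base :: "(nat \<Rightarrow> 'a) \<Rightarrow> (nat \<Rightarrow> 'a) \<times> (real \<Rightarrow> nat \<Rightarrow> 'a)" where
  "htpy_fibre_base W = (W, const_loop W)"

definition pi1_htpy_fibre ::
  "nat \<Rightarrow> 'a topology \<Rightarrow> (nat \<Rightarrow> 'a) \<Rightarrow> (real \<Rightarrow> (nat \<Rightarrow> 'a) \<times> (real \<Rightarrow> nat \<Rightarrow> 'a)) set monoid" where
  "pi1_htpy_fibre n M W = fundamental_group (htpy_fibre n M W) (htpy_fibre_base W)"

definition loop_space_product ::
  "nat \<Rightarrow> 'a topology \<Rightarrow> (nat \<Rightarrow> 'a) \<Rightarrow> (nat \<Rightarrow> real \<Rightarrow> 'a) topology" where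
  "loop_space_product n M W = product_topology (\<lambda>i. loop_space M (W i)) {1..n}"

definition const_loops :: "nat \<Rightarrow> (nat \<Rightarrow> 'a) \<Rightarrow> nat \<Rightarrow> real \<Rightarrow> 'a" where
  "const_loops n W = (\<lambda>i\<in>{1..n}. const_loop (W i))"

text \<open>The second homotopy group of the \<open>n\<close>-fold product, written multiplicatively.\<close>

definition pi2_power ::
  "nat \<Rightarrow> 'a topology \<Rightarrow> (nat \<Rightarrow> 'a) \<Rightarrow> (real \<Rightarrow> nat \<Rightarrow> real \<Rightarrow> 'a) set monoid" where
  "pi2_power n M W = fundamental_group (loop_space_product n M W) (const_loops n W)"

text \<open>A point of the product of loop spaces is a tuple of loops; in the homotopy fibre it becomes a
  path of tuples.\<close>

definition boundary_hom ::
  "nat \<Rightarrow> 'a topology \<Rightarrow> (nat \<Rightarrow> 'a) \<Rightarrow> (real \<Rightarrow> nat \<Rightarrow> real \<Rightarrow> 'a) set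
     \<Rightarrow> (real \<Rightarrow> (nat \<Rightarrow> 'a) \<times> (real \<Rightarrow> nat \<Rightarrow> 'a)) set" where
  "boundary_hom n M W =
     induced_map (htpy_fibre n M W) (htpy_fibre_base W)
       (\<lambda>\<omega>. (W, \<lambda>s\<in>{0..1}. \<lambda>i\<in>{1..n}. \<omega> i s))"

definition pi2_inclusion ::
  "nat \<Rightarrow> 'a topology \<Rightarrow> (nat \<Rightarrow> 'a) \<Rightarrow> nat \<Rightarrow> (real \<Rightarrow> real \<Rightarrow> 'a) set
     \<Rightarrow> (real \<Rightarrow> nat \<Rightarrow> real \<Rightarrow> 'a) set" where
  "pi2_inclusion n M W i =
     induced_map (loop_space_product n M W) (const_loops n W)
       (\<lambda>\<gamma>. (const_loops n W)(i := \<gamma>))"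

text \<open>The class in the second homotopy group of \<open>(M, w)\<close> of a family of loops \<open>g t\<close>.\<close>

definition pi2_class :: "'a topology \<Rightarrow> 'a \<Rightarrow> (real \<Rightarrow> real \<Rightarrow> 'a) \<Rightarrow> (real \<Rightarrow> real \<Rightarrow> 'a) set" where
  "pi2_class M w g = loop_class (loop_space M w) (const_loop w) (\<lambda>t. restrict (g t) {0..1})"

definition list_mult :: "('a, 'b) monoid_scheme \<Rightarrow> 'a list \<Rightarrow> 'a" where
  "list_mult G xs = foldr (\<lambda>a b. a \<otimes>\<^bsub>G\<^esub> b) xs \<one>\<^bsub>G\<^esub>"


section \<open>The sphere and the projective plane\<close>

definition S2 :: "(real^3) topology" where
  "S2 = top_of_set (sphere 0 1)"

definition RP2_proj :: "real^3 \<Rightarrow> (real^3) set" where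
  "RP2_proj x = {x, - x}"

definition RP2 :: "(real^3) set topology" where
  "RP2 = quotient_topology S2 RP2_proj"

definition spherical :: "real \<Rightarrow> real \<Rightarrow> real^3" where
  "spherical \<theta> \<phi> = vector [cos \<phi> * cos \<theta>, cos \<phi> * sin \<theta>, sin \<phi>]"

definition z0 :: "real^3" where
  "z0 = vector [0, 0, 1]"

definition x_pt :: "nat \<Rightarrow> real^3" where
  "x_pt j = spherical 0 (pi/2 * (real j / (real j + 1)))"

definition shift_latitude :: "nat \<Rightarrow> real \<Rightarrow> real" where
  "shift_latitude j \<phi> =
     (if \<phi> \<ge> 0 then \<phi> + (pi/2 - \<phi>) * (real j / (real j + 1))
      else \<phi> + (pi/2 + \<phi>) * (real j / (real j + 1)))"

definition J_map :: "nat \<Rightarrow> real^3 \<Rightarrow> real^3" where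
  "J_map j p = (THE q. \<exists>\<theta>\<in>{0..<2*pi}. \<exists>\<phi>\<in>{-pi/2..pi/2}.
     p = spherical \<theta> \<phi> \<and> q = spherical \<theta> (shift_latitude j \<phi>))"

lemma J_map_spherical:
  assumes "\<theta> \<in> {0..<2*pi}" "\<phi> \<in> {-pi/2..pi/2}"
  shows "J_map j (spherical \<theta> \<phi>) = spherical \<theta> (shift_latitude j \<phi>)"
  unfolding J_map_def
proof (rule the_equality)
  show "\<exists>\<theta>'\<in>{0..<2*pi}. \<exists>\<phi>'\<in>{-pi/2..pi/2}. spherical \<theta> \<phi> = spherical \<theta>' \<phi>' \<and>
      spherical \<theta> (shift_latitude j \<phi>) = spherical \<theta>' (shift_latitude j \<phi>')"
    using assms by blast
next
  fix q
  assume "\<exists>\<theta>'\<in>{0..<2*pi}. \<exists>\<phi>'\<in>{-pi/2..pi/2}. spherical \<theta> \<phi> = spherical \<theta>' \<phi>' \<and>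
      q = spherical \<theta>' (shift_latitude j \<phi>')"
  then obtain \<theta>' \<phi>' where *: "\<theta>' \<in> {0..<2*pi}" "\<phi>' \<in> {-pi/2..pi/2}"
    "spherical \<theta> \<phi> = spherical \<theta>' \<phi>'" "q = spherical \<theta>' (shift_latitude j \<phi>')" by blast
  have eqs: "cos \<phi> * cos \<theta> = cos \<phi>' * cos \<theta>'" "cos \<phi> * sin \<theta> = cos \<phi>' * sin \<theta>'" "sin \<phi> = sin \<phi>'"
    using *(3) by (simp_all add: spherical_def vec_eq_iff forall_3)
  have \<phi>: "\<phi> = \<phi>'"
    using sin_inj_pi[of \<phi> \<phi>'] eqs(3) assms(2) *(2) by simp
  show "q = spherical \<theta> (shift_latitude j \<phi>)"
  proof (cases "\<phi> = pi/2 \<or> \<phi> = -pi/2")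
    case True
    then have "0 \<le> \<phi> \<and> pi/2 - \<phi> = 0 \<or> \<not> 0 \<le> \<phi> \<and> pi/2 + \<phi> = 0"
      using pi_gt_zero by linarith
    then have "shift_latitude j \<phi> = \<phi>"
      by (auto simp: shift_latitude_def)
    moreover have "cos \<phi> = 0" using True by (metis cos_minus cos_pi_half minus_divide_left)
    ultimately show ?thesis using * \<phi> by (simp add: spherical_def)
  next
    case False
    then have "cos \<phi> > 0" using assms by (intro cos_gt_zero_pi) auto
    then have "cos \<theta> = cos \<theta>'" "sin \<theta> = sin \<theta>'" using eqs(1,2) unfolding \<phi> by simp_all
    then show ?thesis using * \<phi> by (simp add: spherical_def)
  qed
qed

definition R_map :: "real^3 \<Rightarrow> real^3" where
  "R_map p = vector [p$3, - (p$2), p$1]"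


section \<open>The circles through the base point\<close>

text \<open>Rotation about the line \<open>x = 1, y = 0\<close> through the angle \<open>\<alpha>\<close>, clockwise when seen from the
  positive \<open>z\<close>-axis. This is the sense of rotation for which the circles \<open>S\<^sup>2 \<inter> \<Pi>\<^sub>t\<close> with
  \<open>0 < t < 1/2\<close> lie in the half-space \<open>y \<le> 0\<close>, as the sign condition on \<open>y\<close> below demands.\<close>

definition rotate_D :: "real \<Rightarrow> real^3 \<Rightarrow> real^3" where
  "rotate_D \<alpha> p =
     vector [1 + cos \<alpha> * (p$1 - 1) + sin \<alpha> * p$2, - sin \<alpha> * (p$1 - 1) + cos \<alpha> * p$2, p$3]"

definition plane_at :: "real \<Rightarrow> (real^3) set" where
  "plane_at t = rotate_D (t * pi) ` {p. (p - x_pt 0) \<bullet> x_pt 0 = 0}"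

definition circle_family :: "(real \<Rightarrow> real \<Rightarrow> real^3) \<Rightarrow> bool" where
  "circle_family \<omega> \<longleftrightarrow>
     continuous_on ({0..1} \<times> {0..1}) (\<lambda>(t, s). \<omega> t s) \<and>
     (\<forall>t\<in>{0..1}. path_image (\<omega> t) = sphere 0 1 \<inter> plane_at t \<and>
                  pathstart (\<omega> t) = x_pt 0 \<and> pathfinish (\<omega> t) = x_pt 0) \<and>
     (\<forall>t\<in>{0<..<1}. simple_path (\<omega> t)) \<and>
     (\<forall>s\<in>{0<..<1}. (\<forall>t\<in>{0<..<1/2}. \<omega> t s $ 2 < 0) \<and> (\<forall>t\<in>{1/2<..<1}. \<omega> t s $ 2 > 0)) \<and>
     (\<forall>t\<in>{0<..<1}. (\<forall>s\<in>{0<..<1/2}. \<omega> t s $ 3 < 0) \<and> (\<forall>s\<in>{1/2<..<1}. \<omega> t s $ 3 > 0)) \<and>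
     (\<forall>t\<in>{0..1}. \<forall>s\<in>{0..1}. \<omega> t s $ 1 = \<omega> t (1 - s) $ 1 \<and> \<omega> t s $ 2 = \<omega> t (1 - s) $ 2 \<and>
                                \<omega> t s $ 3 = - (\<omega> t (1 - s) $ 3)) \<and>
     (\<forall>t\<in>{0..1}. \<forall>s\<in>{0..1}. \<omega> t s $ 2 = - (\<omega> (1 - t) s $ 2) \<and> \<omega> t s $ 1 = \<omega> (1 - t) s $ 1 \<and>
                                \<omega> t s $ 3 = \<omega> (1 - t) s $ 3) \<and>
     (\<forall>t\<in>{0..1}. \<forall>s\<in>{0..<1/4}. \<omega> t s $ 1 > 0) \<and>
     (\<forall>s\<in>{1/4<..1/2}. \<omega> (1/2) s $ 1 < 0)"

definition loop_x :: "(real \<Rightarrow> real \<Rightarrow> real^3) \<Rightarrow> nat \<Rightarrow> real \<Rightarrow> real \<Rightarrow> real^3" where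
  "loop_x \<omega> j t s = J_map j (\<omega> t s)"

definition loop_z :: "(real \<Rightarrow> real \<Rightarrow> real^3) \<Rightarrow> real \<Rightarrow> real \<Rightarrow> real^3" where
  "loop_z \<omega> t s = R_map (\<omega> t s)"

definition loop_minus_z :: "(real \<Rightarrow> real \<Rightarrow> real^3) \<Rightarrow> real \<Rightarrow> real \<Rightarrow> real^3" where
  "loop_minus_z \<omega> t s = - loop_z \<omega> (1 - t) s"

definition half_loop :: "(real \<Rightarrow> real \<Rightarrow> real^3) \<Rightarrow> nat \<Rightarrow> real \<Rightarrow> real \<Rightarrow> real^3" where
  "half_loop \<omega> j t r = loop_x \<omega> j t ((1 + r) / 2)"


section \<open>Base points, spherical classes and the full twist\<close>

text \<open>Tuples are indexed by \<open>{1..n}\<close>, so the point \<open>x\<^sub>j\<close> occupies position \<open>j + 1\<close>.\<close>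

definition base_S2 :: "nat \<Rightarrow> nat \<Rightarrow> real^3" where
  "base_S2 n = (\<lambda>i\<in>{1..n}. if i \<le> n - 2 then x_pt (i - 1) else if i = n - 1 then z0 else - z0)"

definition base_RP2 :: "nat \<Rightarrow> nat \<Rightarrow> (real^3) set" where
  "base_RP2 n = (\<lambda>i\<in>{1..n}. if i \<le> n - 1 then RP2_proj (x_pt (i - 1)) else RP2_proj z0)"

definition lambda_S2 ::
  "nat \<Rightarrow> nat \<Rightarrow> (real \<Rightarrow> real \<Rightarrow> real^3) \<Rightarrow> (real \<Rightarrow> nat \<Rightarrow> real \<Rightarrow> real^3) set" where
  "lambda_S2 n i g = pi2_inclusion n S2 (base_S2 n) i (pi2_class S2 (base_S2 n i) g)"

definition lambda_RP2 ::
  "nat \<Rightarrow> nat \<Rightarrow> (real \<Rightarrow> real \<Rightarrow> real^3) \<Rightarrow> (real \<Rightarrow> nat \<Rightarrow> real \<Rightarrow> (real^3) set) set" where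
  "lambda_RP2 n i g =
     pi2_inclusion n RP2 (base_RP2 n) i (pi2_class RP2 (base_RP2 n i) (\<lambda>t s. RP2_proj (g t s)))"

definition tau_S2 ::
  "nat \<Rightarrow> (real \<Rightarrow> real \<Rightarrow> real^3) \<Rightarrow> (real \<Rightarrow> (nat \<Rightarrow> real^3) \<times> (real \<Rightarrow> nat \<Rightarrow> real^3)) set" where
  "tau_S2 n \<omega> =
     loop_class (htpy_fibre n S2 (base_S2 n)) (htpy_fibre_base (base_S2 n))
       (\<lambda>t. (\<lambda>i\<in>{1..n}. if i \<le> n - 2 then loop_x \<omega> (i - 1) t (1/2)
                        else if i = n - 1 then z0 else - z0,
             \<lambda>r\<in>{0..1}. \<lambda>i\<in>{1..n}. if i \<le> n - 2 then half_loop \<omega> (i - 1) t r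
                        else if i = n - 1 then z0 else - z0))"

definition tau_RP2 ::
  "nat \<Rightarrow> (real \<Rightarrow> real \<Rightarrow> real^3)
     \<Rightarrow> (real \<Rightarrow> (nat \<Rightarrow> (real^3) set) \<times> (real \<Rightarrow> nat \<Rightarrow> (real^3) set)) set" where
  "tau_RP2 n \<omega> =
     loop_class (htpy_fibre n RP2 (base_RP2 n)) (htpy_fibre_base (base_RP2 n))
       (\<lambda>t. (\<lambda>i\<in>{1..n}. if i \<le> n - 1 then RP2_proj (loop_x \<omega> (i - 1) t (1/2))
                        else RP2_proj z0,
             \<lambda>r\<in>{0..1}. \<lambda>i\<in>{1..n}. if i \<le> n - 1 then RP2_proj (half_loop \<omega> (i - 1) t r)
                        else RP2_proj z0))"

end

theory Submission
  imports Defs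
begin

text \<open>
  Let \<open>A t\<close> be the rotation about the \<open>z\<close>-axis that takes \<open>x\<^sub>0\<close> to the midpoint \<open>\<omega> t (1/2)\<close> of the
  \<open>t\<close>-th circle, a point of the equator. The maps \<open>J\<^sub>j\<close> preserve longitudes, so the midpoints of all the loops at
  \<open>x\<^sub>0, x\<^sub>1, \<dots>\<close> are moved by the same rotation: the configuration underlying \<open>\<tau>\<close> at time \<open>t\<close> is
  \<open>A t W\<close>, and \<open>\<tau>\<close> joins it to \<open>W\<close> by the half loops \<open>h t\<close>. Let \<open>B u\<close> be the rotation about the
  \<open>y\<close>-axis through the angle \<open>\<pi> u\<close>. A half turn about the \<open>y\<close>-axis conjugates \<open>A t\<close> to its inverse,
  so \<open>u \<mapsto> A t \<circ> B (-u) \<circ> A t \<circ> B u\<close> leads from \<open>A t \<circ> A t\<close> to the identity. These maps are isometries,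
  hence they move \<open>W\<close> through configurations. Unwinding the double rotation in this way turns
  \<open>\<tau>\<^sup>2\<close> into a loop over the constant configuration \<open>W\<close>, in other words into the image
  under the boundary homomorphism of a family of tuples of loops; its component at the point \<open>w\<close> consists of
  the track of \<open>w\<close> under the unwinding, followed by \<open>A t (h t)\<close> and \<open>h t\<close>
  (\<open>square_of_rotation_class\<close>).

  From here on each component can be treated by itself, as a map from a square to the sphere with
  constant boundary values. Let \<open>w\<close> lie on the prime meridian at latitude \<open>\<phi>\<close>. The conjugated
  rotation \<open>B (-u) \<circ> A t \<circ> B u\<close> fixes \<open>w\<close>, whatever \<open>t\<close> may be, at the moment when \<open>B u w\<close> is the
  pole. This moment divides the track of \<open>w\<close> into two arcs. One of them is, up to homotopy, the
  inverse of \<open>A t (h t)\<close>, so that these two cancel; what remains is called the sweep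
  (\<open>unwinding_homotopic_sweep\<close>). Moving \<open>w\<close> down the meridian shows that, up to a rotation, the sweep
  does not depend on the latitude, and at latitude \<open>0\<close> it is homotopic to the given family of circles.
  Since little more than signs of coordinates is known about the circles, they are handled by one
  criterion: maps of the square to the sphere that agree on the boundary and are nowhere antipodal are homotopic
  (\<open>square_homotopic_nonantipodal\<close>). The same criterion compares \<open>J\<^sub>j \<circ> \<omega>\<close> with a rotated copy of
  \<open>\<omega>\<close>. At the pole, which is the case \<open>\<phi> = \<pi>/2\<close> with \<open>h\<close> constant, \<open>R \<circ> \<omega>\<close> differs from the rotated
  copy of \<open>\<omega>\<close> by a half turn about the \<open>x\<close>-axis, which can be undone since it fixes the base point.
  The component at the opposite pole is the negative of the one at the pole; the loop family
  chosen there runs backwards in \<open>t\<close>, whence the minus sign.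

  For the projective plane the homotopies are projected. The images stay in the configuration space
  since linear isometries map antipodal pairs to antipodal pairs.
\<close>

section \<open>Maps into compact-open topologies\<close>

text \<open>The easy half of the exponential law: compactness, in the form of the tube lemma, makes a jointly
  continuous family of maps a continuous family of points of the mapping space.\<close>

lemma continuous_map_into_compact_open:
  assumes f: "continuous_map (prod_topology Z X) Y (\<lambda>(z, x). f z x)"
  shows "continuous_map Z (compact_open_topology X Y) (\<lambda>z. restrict (f z) (topspace X))"
  unfolding compact_open_topology_def
proof (rule continuous_on_generated_topo)
  have cont: "continuous_map X Y (restrict (f z) (topspace X))" if "z \<in> topspace Z" for z
    using continuous_map_o_Pair[OF f that] by (rule continuous_map_eq) auto
  fix V
  assume "V \<in> {{g \<in> extensional (topspace X). continuous_map X Y g \<and> g ` K \<subseteq> U} | K U.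
      compactin X K \<and> openin Y U}"
  then obtain K U where KU: "compactin X K" "openin Y U"
    and V: "V = {g \<in> extensional (topspace X). continuous_map X Y g \<and> g ` K \<subseteq> U}"
    by blast
  have KX: "K \<subseteq> topspace X"
    using KU(1) by (rule compactin_subset_topspace)
  let ?N = "{p \<in> topspace (prod_topology Z X). (\<lambda>(z, x). f z x) p \<in> U}"
  have N: "openin (prod_topology Z X) ?N"
    by (rule openin_continuous_map_preimage[OF f KU(2)])
  have eq: "(\<lambda>z. restrict (f z) (topspace X)) -` V \<inter> topspace Z
      = {z \<in> topspace Z. \<forall>x\<in>K. f z x \<in> U}"
    using cont KX unfolding V by (fastforce simp: image_subset_iff)
  show "openin Z ((\<lambda>z. restrict (f z) (topspace X)) -` V \<inter> topspace Z)"
    unfolding eq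
  proof (subst openin_subopen, intro ballI)
    fix z assume z: "z \<in> {z \<in> topspace Z. \<forall>x\<in>K. f z x \<in> U}"
    then have zZ: "z \<in> topspace Z" and "{z} \<times> K \<subseteq> ?N"
      using KX by auto
    from tube_lemma_right[OF N KU(1) this] obtain A B
      where "openin Z A" "openin X B" "z \<in> A" "K \<subseteq> B" "A \<times> B \<subseteq> ?N"
      by (elim exE conjE)
    then show "\<exists>T. openin Z T \<and> z \<in> T \<and> T \<subseteq> {z \<in> topspace Z. \<forall>x\<in>K. f z x \<in> U}"
      using openin_subset[of Z A] by (intro exI[of _ A]) (auto simp: subset_iff)
  qed
next
  have cont: "continuous_map X Y (restrict (f z) (topspace X))" if "z \<in> topspace Z" for z
    using continuous_map_o_Pair[OF f that] by (rule continuous_map_eq) auto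
  then have "(\<lambda>z. restrict (f z) (topspace X)) ` topspace Z \<subseteq>
      topspace (compact_open_topology X Y)"
    by (auto simp: topspace_compact_open_topology)
  then show "(\<lambda>z. restrict (f z) (topspace X)) ` topspace Z \<subseteq>
      \<Union>{{g \<in> extensional (topspace X). continuous_map X Y g \<and> g ` K \<subseteq> U} | K U.
        compactin X K \<and> openin Y U}"
    unfolding compact_open_topology_def topology_generated_by_topspace .
qed

text \<open>The other half of the exponential law. It serves to recognise the boundary map as continuous,
  where a tuple of loops becomes a path of tuples.\<close>

lemma continuous_map_evaluation:
  assumes X: "locally_compact_space X" "Hausdorff_space X"
  shows "continuous_map (prod_topology (compact_open_topology X Y) X) Y (\<lambda>(g, x). g x)"
  unfolding continuous_map_def
proof (intro conjI allI impI)
  show "(\<lambda>(g, x). g x) \<in> topspace (prod_topology (compact_open_topology X Y) X) \<rightarrow> topspace Y"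
    by (auto simp: topspace_compact_open_topology continuous_map_def)
next
  fix U assume U: "openin Y U"
  let ?E = "{p \<in> topspace (prod_topology (compact_open_topology X Y) X). (\<lambda>(g, x). g x) p \<in> U}"
  show "openin (prod_topology (compact_open_topology X Y) X) ?E"
  proof (subst openin_subopen, intro ballI)
    fix p assume p: "p \<in> ?E"
    obtain g x where gx: "p = (g, x)" by (cases p)
    have g: "g \<in> extensional (topspace X)" "continuous_map X Y g" and x: "x \<in> topspace X" "g x \<in> U"
      using p unfolding gx by (auto simp: topspace_compact_open_topology)
    have "openin X {y \<in> topspace X. g y \<in> U}"
      by (rule openin_continuous_map_preimage[OF g(2) U])
    then obtain A K where AK: "openin X A" "compactin X K" "x \<in> A" "A \<subseteq> K" "K \<subseteq> {y \<in> topspace X. g y \<in> U}"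
      using X x locally_compact_space_neighbourhood_base[of X] unfolding neighbourhood_base_of
      by (metis (no_types, lifting) mem_Collect_eq)
    define S where "S = {h \<in> extensional (topspace X). continuous_map X Y h \<and> h ` K \<subseteq> U}"
    have "openin (compact_open_topology X Y) S"
      unfolding compact_open_topology_def
      by (rule topology_generated_by_Basis) (use AK(2) U S_def in blast)
    then have "openin (prod_topology (compact_open_topology X Y) X) (S \<times> A)"
      using AK(1) by (simp add: openin_prod_Times_iff)
    moreover have "p \<in> S \<times> A"
      using AK g unfolding gx S_def by auto
    moreover have "S \<times> A \<subseteq> ?E"
      using AK(4) compactin_subset_topspace[OF AK(2)]
      by (auto simp: S_def topspace_compact_open_topology image_subset_iff)
    ultimately show "\<exists>T. openin (prod_topology (compact_open_topology X Y) X) T \<and> p \<in> T \<and> T \<subseteq> ?E"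
      by blast
  qed
qed

lemma locally_compact_unit_interval: "locally_compact_space unit_interval"
  by (rule compact_imp_locally_compact_space) (simp add: compact_space_subtopology)

lemma Hausdorff_unit_interval: "Hausdorff_space unit_interval"
  by (simp add: Hausdorff_space_subtopology)

lemma topspace_loop_space:
  "topspace (loop_space M w) = {g \<in> extensional {0..1}. continuous_map unit_interval M g \<and> g 0 = w \<and> g 1 = w}"
  by (auto simp: loop_space_def topspace_compact_open_topology)

lemma continuous_map_into_loop_space:
  assumes "continuous_map (prod_topology Z unit_interval) M (\<lambda>(z, s). f z s)"
    and "\<And>z. z \<in> topspace Z \<Longrightarrow> f z 0 = w \<and> f z 1 = w"
  shows "continuous_map Z (loop_space M w) (\<lambda>z. restrict (f z) {0..1})"
  using continuous_map_into_compact_open[OF assms(1)] assms(2)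
  unfolding loop_space_def by (auto simp: continuous_map_in_subtopology)

lemma const_loop_in_loop_space: "w \<in> topspace M \<Longrightarrow> const_loop w \<in> topspace (loop_space M w)"
  unfolding topspace_loop_space const_loop_def by (auto intro: continuous_map_eq[of _ _ "\<lambda>_. w"])

section \<open>Fundamental groups\<close>

abbreviation loops_homotopic :: "'a topology \<Rightarrow> 'a \<Rightarrow> (real \<Rightarrow> 'a) \<Rightarrow> (real \<Rightarrow> 'a) \<Rightarrow> bool" where
  "loops_homotopic X x \<equiv> homotopic_with (\<lambda>r. r 0 = x \<and> r 1 = x) unit_interval X"

lemma loop_in_iff_homotopic_refl: "loop_in X x p \<longleftrightarrow> loops_homotopic X x p p"
  by (auto simp: loop_in_def pathin_def)

lemma loop_class_eq_iff:
  assumes "loop_in X x p"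
  shows "loop_class X x p = loop_class X x q \<longleftrightarrow> loops_homotopic X x p q"
proof
  assume "loop_class X x p = loop_class X x q"
  moreover have "p \<in> loop_class X x p"
    using assms by (simp add: loop_class_def loop_in_iff_homotopic_refl)
  ultimately show "loops_homotopic X x p q"
    by (simp add: loop_class_def homotopic_with_sym)
next
  assume "loops_homotopic X x p q"
  then show "loop_class X x p = loop_class X x q"
    unfolding loop_class_def by (auto intro: homotopic_with_trans homotopic_with_symD)
qed

lemma homotopic_imp_loop_in:
  assumes "loops_homotopic X x p q"
  shows "loop_in X x p" "loop_in X x q"
  using homotopic_with_imp_continuous_maps[OF assms] homotopic_with_imp_property[OF assms]
  by (auto simp: loop_in_def pathin_def)

lemma loops_homotopic_if_equal:
  assumes "loop_in X x p" "\<And>t. t \<in> {0..1} \<Longrightarrow> p t = q t"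
  shows "loops_homotopic X x p q"
proof (rule homotopic_with_equal)
  show "p 0 = x \<and> p 1 = x" "continuous_map unit_interval X p"
    using assms(1) by (simp_all add: loop_in_def pathin_def)
  then show "q 0 = x \<and> q 1 = x"
    using assms(2)[of 0] assms(2)[of 1] by simp
qed (simp add: assms(2))

lemma loops_homotopic_cong:
  assumes "loops_homotopic X x p q" "\<And>t. t \<in> {0..1} \<Longrightarrow> p t = p' t" "\<And>t. t \<in> {0..1} \<Longrightarrow> q t = q' t"
  shows "loops_homotopic X x p' q'"
proof -
  have "loops_homotopic X x p' p"
    by (rule homotopic_with_symD[OF loops_homotopic_if_equal[OF homotopic_imp_loop_in(1)]])
      (use assms in auto)
  moreover have "loops_homotopic X x q q'"
    by (rule loops_homotopic_if_equal[OF homotopic_imp_loop_in(2)]) (use assms in auto)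
  ultimately show ?thesis
    using assms(1) by (blast intro: homotopic_with_trans)
qed

text \<open>Nearly every homotopy of loops below is an instance of this lemma: two paths in a convex set
  of parameters are joined by straight segments.\<close>

lemma loops_homotopic_through_convex:
  fixes Z :: "'b::real_normed_vector set"
  assumes Z: "convex Z" and \<Phi>: "continuous_map (top_of_set Z) X \<Phi>"
    and f: "continuous_on {0..1} f" "f ` {0..1} \<subseteq> Z"
    and g: "continuous_on {0..1} g" "g ` {0..1} \<subseteq> Z"
    and ends: "\<And>u. u \<in> {0..1} \<Longrightarrow> \<Phi> ((1 - u) *\<^sub>R f 0 + u *\<^sub>R g 0) = x"
      "\<And>u. u \<in> {0..1} \<Longrightarrow> \<Phi> ((1 - u) *\<^sub>R f 1 + u *\<^sub>R g 1) = x"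
  shows "loops_homotopic X x (\<lambda>t. \<Phi> (f t)) (\<lambda>t. \<Phi> (g t))"
  unfolding homotopic_with_def
proof (intro exI[of _ "\<lambda>(u, t). \<Phi> ((1 - u) *\<^sub>R f t + u *\<^sub>R g t)"] conjI allI ballI)
  let ?k = "\<lambda>(u, t). (1 - u) *\<^sub>R f t + u *\<^sub>R g t"
  have c: "continuous_on ({0..1} \<times> {0..1}) ?k"
    unfolding case_prod_beta
    by (intro continuous_intros continuous_on_compose2[OF f(1)] continuous_on_compose2[OF g(1)]) auto
  have m: "?k \<in> {0..1} \<times> {0..1} \<rightarrow> Z"
    using convexD_alt[OF Z] f(2) g(2) by (fastforce simp: image_subset_iff)
  have "continuous_map (top_of_set ({0..1} \<times> {0..1})) (top_of_set Z) ?k"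
    using c m by simp
  then have "continuous_map (top_of_set ({0..1} \<times> {0..1})) X (\<Phi> \<circ> ?k)"
    by (rule continuous_map_compose[OF _ \<Phi>])
  then show "continuous_map (prod_topology unit_interval unit_interval) X
      (\<lambda>(u, t). \<Phi> ((1 - u) *\<^sub>R f t + u *\<^sub>R g t))"
    by (simp add: subtopology_Times o_def case_prod_beta')
qed (use ends in auto)

lemma continuous_on_join_loops:
  assumes p: "continuous_on {0..1} p" and q: "continuous_on {0..1} q" and "p 1 = q 0"
  shows "continuous_on {0..1} (join_loops p q)"
  using continuous_on_joinpaths[of p q] assms
  by (simp add: path_def pathfinish_def pathstart_def joinpaths_def join_loops_def[abs_def] cong: if_cong)

lemma loops_homotopic_reparametrise:
  assumes p: "loop_in X x p"
    and f: "continuous_on {0..1} f" "f ` {0..1} \<subseteq> {0..1::real}"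
    and g: "continuous_on {0..1} g" "g ` {0..1} \<subseteq> {0..1}"
    and ends: "f 0 = g 0" "f 1 = g 1" "p (g 0) = x" "p (g 1) = x"
  shows "loops_homotopic X x (\<lambda>t. p (f t)) (\<lambda>t. p (g t))"
proof (rule loops_homotopic_through_convex[OF _ _ f g])
  show "continuous_map unit_interval X p"
    using p by (simp add: loop_in_def pathin_def)
  show "p ((1 - u) *\<^sub>R f 0 + u *\<^sub>R g 0) = x" "p ((1 - u) *\<^sub>R f 1 + u *\<^sub>R g 1) = x" for u :: real
    using ends by (simp_all add: algebra_simps flip: scaleR_add_left)
qed simp

lemma continuous_map_join:
  fixes p q :: "'z \<Rightarrow> real \<Rightarrow> 'a"
  assumes p: "continuous_map (prod_topology Z unit_interval) X (\<lambda>(z, t). p z t)"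
    and q: "continuous_map (prod_topology Z unit_interval) X (\<lambda>(z, t). q z t)"
    and pq: "\<And>z. z \<in> topspace Z \<Longrightarrow> p z 1 = q z 0"
  shows "continuous_map (prod_topology Z unit_interval) X (\<lambda>(z, t). join_loops (p z) (q z) t)"
proof -
  let ?T = "prod_topology Z unit_interval"
  have s: "continuous_map ?T euclideanreal snd"
    using continuous_map_into_fulltopology[OF continuous_map_snd] by blast
  have 1: "continuous_map (subtopology ?T {y \<in> topspace ?T. snd y \<le> 1/2}) X (\<lambda>(z, t). p z (2 * t))"
  proof -
    have "continuous_map (subtopology ?T {y \<in> topspace ?T. snd y \<le> 1/2}) ?T (\<lambda>(z, t). (z, 2 * t))"
      unfolding case_prod_beta using s
      by (intro continuous_map_pairedI continuous_map_into_subtopology continuous_intros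
          continuous_map_from_subtopology continuous_map_fst continuous_map_real_mult) auto
    from continuous_map_compose[OF this p] show ?thesis
      by (simp add: o_def case_prod_beta')
  qed
  have 2: "continuous_map (subtopology ?T {y \<in> topspace ?T. 1/2 \<le> snd y}) X (\<lambda>(z, t). q z (2 * t - 1))"
  proof -
    have "continuous_map (subtopology ?T {y \<in> topspace ?T. 1/2 \<le> snd y}) ?T (\<lambda>(z, t). (z, 2 * t - 1))"
      unfolding case_prod_beta using s
      by (intro continuous_map_pairedI continuous_map_into_subtopology continuous_intros
          continuous_map_from_subtopology continuous_map_fst continuous_map_real_mult continuous_map_diff) auto
    from continuous_map_compose[OF this q] show ?thesis
      by (simp add: o_def case_prod_beta')
  qed
  have "continuous_map ?T X (\<lambda>y. if snd y \<le> 1/2 then (\<lambda>(z, t). p z (2 * t)) y else (\<lambda>(z, t). q z (2 * t - 1)) y)"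
  proof (rule continuous_map_cases_le[OF s _ 1 2])
    fix y :: "'z \<times> real" assume "y \<in> topspace ?T" "snd y = 1/2"
    then obtain z where "y = (z, 1/2)" "z \<in> topspace Z"
      by (cases y) fastforce
    then show "(\<lambda>(z, t). p z (2 * t)) y = (\<lambda>(z, t). q z (2 * t - 1)) y"
      by (simp add: pq)
  qed auto
  then show ?thesis
    by (rule continuous_map_eq) (auto simp: join_loops_def)
qed

lemma loops_homotopic_join:
  assumes "loops_homotopic X x p p'" "loops_homotopic X x q q'"
  shows "loops_homotopic X x (join_loops p q) (join_loops p' q')"
proof -
  obtain h where h: "continuous_map (prod_topology unit_interval unit_interval) X h"
    "\<And>t. h (0, t) = p t" "\<And>t. h (1, t) = p' t" "\<And>u. u \<in> {0..1} \<Longrightarrow> h (u, 0) = x \<and> h (u, 1) = x"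
    using assms(1) unfolding homotopic_with_def by blast
  obtain k where k: "continuous_map (prod_topology unit_interval unit_interval) X k"
    "\<And>t. k (0, t) = q t" "\<And>t. k (1, t) = q' t" "\<And>u. u \<in> {0..1} \<Longrightarrow> k (u, 0) = x \<and> k (u, 1) = x"
    using assms(2) unfolding homotopic_with_def by blast
  show ?thesis
    unfolding homotopic_with_def
  proof (intro exI conjI allI ballI)
    show "continuous_map (prod_topology unit_interval unit_interval) X
        (\<lambda>(u, t). join_loops (\<lambda>t. h (u, t)) (\<lambda>t. k (u, t)) t)"
      by (rule continuous_map_join) (use h k in auto)
  qed (use h k in \<open>auto simp: join_loops_def\<close>)
qed

lemma loop_in_join: "loop_in X x p \<Longrightarrow> loop_in X x q \<Longrightarrow> loop_in X x (join_loops p q)"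
  unfolding loop_in_iff_homotopic_refl by (rule loops_homotopic_join)

lemma loop_in_const: "x \<in> topspace X \<Longrightarrow> loop_in X x (\<lambda>_. x)"
  by (simp add: loop_in_def)

lemma mult_loop_class:
  assumes "loop_in X x p" "loop_in X x q"
  shows "loop_class X x p \<otimes>\<^bsub>fundamental_group X x\<^esub> loop_class X x q = loop_class X x (join_loops p q)"
proof -
  have eq: "loop_class X x (join_loops p' q') = loop_class X x (join_loops p q)"
    if "p' \<in> loop_class X x p" "q' \<in> loop_class X x q" for p' q'
  proof -
    have "loops_homotopic X x (join_loops p q) (join_loops p' q')"
      by (rule loops_homotopic_join) (use that in \<open>simp_all only: loop_class_def mem_Collect_eq\<close>)
    then show ?thesis
      by (rule iffD2[OF loop_class_eq_iff[OF loop_in_join[OF assms]], symmetric])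
  qed
  have "p \<in> loop_class X x p" "q \<in> loop_class X x q"
    using assms by (simp_all add: loop_class_def loop_in_iff_homotopic_refl)
  then have "(\<Union>p'\<in>loop_class X x p. \<Union>q'\<in>loop_class X x q. loop_class X x (join_loops p' q'))
      = (\<Union>p'\<in>loop_class X x p. \<Union>q'\<in>loop_class X x q. loop_class X x (join_loops p q))"
    by (intro SUP_cong refl eq)
  also have "\<dots> = loop_class X x (join_loops p q)"
    using \<open>p \<in> loop_class X x p\<close> \<open>q \<in> loop_class X x q\<close> by blast
  finally show ?thesis
    by (simp add: fundamental_group_def)
qed

lemma induced_map_loop_class:
  assumes f: "continuous_map X Y f" "f x = y" and p: "loop_in X x p"
  shows "induced_map Y y f (loop_class X x p) = loop_class Y y (f \<circ> p)"
    and "loop_in Y y (f \<circ> p)"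
proof -
  have h: "loops_homotopic Y y (f \<circ> p) (f \<circ> p')" if "p' \<in> loop_class X x p" for p'
    using that f(2) unfolding loop_class_def
    by (auto intro!: homotopic_with_compose_continuous_map_left[OF _ f(1)])
  have pp: "p \<in> loop_class X x p"
    using p by (auto simp: loop_class_def loop_in_iff_homotopic_refl)
  show l: "loop_in Y y (f \<circ> p)"
    using h[OF pp] by (simp add: loop_in_iff_homotopic_refl)
  show "induced_map Y y f (loop_class X x p) = loop_class Y y (f \<circ> p)"
  proof -
    have "loop_class Y y (f \<circ> p') = loop_class Y y (f \<circ> p)" if "p' \<in> loop_class X x p" for p'
      by (rule iffD2[OF loop_class_eq_iff[OF l] h[OF that], symmetric])
    then have "induced_map Y y f (loop_class X x p) = (\<Union>p'\<in>loop_class X x p. loop_class Y y (f \<circ> p))"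
      unfolding induced_map_def by (intro SUP_cong refl)
    then show ?thesis
      using pp by blast
  qed
qed

lemma carrier_fundamental_group:
  "c \<in> carrier (fundamental_group X x) \<longleftrightarrow> (\<exists>p. loop_in X x p \<and> c = loop_class X x p)"
  by (auto simp: fundamental_group_def)

lemma fundamental_group_one: "\<one>\<^bsub>fundamental_group X x\<^esub> = loop_class X x (\<lambda>_. x)"
  by (simp add: fundamental_group_def)

lemma loops_homotopic_const_join:
  assumes p: "loop_in X x p"
  shows "loops_homotopic X x (join_loops (\<lambda>_. x) p) p"
proof -
  have "loops_homotopic X x (\<lambda>t. p (max 0 (2 * t - 1))) (\<lambda>t. p t)"
    by (rule loops_homotopic_reparametrise[OF p])
      (use p in \<open>auto intro!: continuous_intros simp: loop_in_def\<close>)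
  then show ?thesis
  proof (rule loops_homotopic_cong)
    fix t :: real assume "t \<in> {0..1}"
    then show "p (max 0 (2 * t - 1)) = join_loops (\<lambda>_. x) p t"
      using p by (cases "t \<le> 1/2") (auto simp: join_loops_def loop_in_def max_absorb1 max_absorb2)
  qed simp
qed

lemma loop_in_reverse:
  assumes "loop_in X x p"
  shows "loop_in X x (\<lambda>t. p (1 - t))"
proof -
  have "continuous_map unit_interval unit_interval (\<lambda>t. 1 - t)"
    by (auto intro!: continuous_intros)
  then have "continuous_map unit_interval X (p \<circ> (\<lambda>t. 1 - t))"
    using assms by (intro continuous_map_compose) (auto simp: loop_in_def pathin_def)
  then show ?thesis
    using assms by (simp add: loop_in_def pathin_def o_def)
qed

text \<open>Going along \<open>p\<close> and back is \<open>p\<close> composed with a tent function, which contracts to a constant.\<close>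

lemma loops_homotopic_join_reverse:
  assumes p: "loop_in X x p"
  shows "loops_homotopic X x (join_loops p (\<lambda>t. p (1 - t))) (\<lambda>_. x)"
    and "loops_homotopic X x (join_loops (\<lambda>t. p (1 - t)) p) (\<lambda>_. x)"
proof -
  have "loops_homotopic X x (\<lambda>t. p (1 - \<bar>2 * t - 1\<bar>)) (\<lambda>t. p 0)"
    by (rule loops_homotopic_reparametrise[OF p])
      (use p in \<open>auto intro!: continuous_intros simp: loop_in_def\<close>)
  then show "loops_homotopic X x (join_loops p (\<lambda>t. p (1 - t))) (\<lambda>_. x)"
    by (rule loops_homotopic_cong) (use p in \<open>auto simp: join_loops_def loop_in_def\<close>)
  have "loops_homotopic X x (\<lambda>t. p \<bar>2 * t - 1\<bar>) (\<lambda>t. p 1)"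
    by (rule loops_homotopic_reparametrise[OF p])
      (use p in \<open>auto intro!: continuous_intros simp: loop_in_def\<close>)
  then show "loops_homotopic X x (join_loops (\<lambda>t. p (1 - t)) p) (\<lambda>_. x)"
    by (rule loops_homotopic_cong) (use p in \<open>auto simp: join_loops_def loop_in_def abs_if intro: arg_cong[of _ _ p]\<close>)
qed

text \<open>The two bracketings differ by a piecewise linear reparametrisation of the unit interval. This
  reparametrisation is concave, hence a minimum of its linear pieces.\<close>

lemma loops_homotopic_join_assoc:
  assumes p: "loop_in X x p" and q: "loop_in X x q" and r: "loop_in X x r"
  shows "loops_homotopic X x (join_loops (join_loops p q) r) (join_loops p (join_loops q r))"
proof -
  let ?l = "join_loops p (join_loops q r)"
  have l: "loop_in X x ?l"
    using assms by (intro loop_in_join)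
  let ?f = "\<lambda>t::real. min (min (2 * t) (t + 1/4)) ((1 + t) / 2)"
  have f: "continuous_on {0..1} ?f"
    by (intro continuous_intros) auto
  have "?f ` {0..1} \<subseteq> {0..1}"
    by (auto simp: min_def)
  with f have "loops_homotopic X x (\<lambda>t. ?l (?f t)) (\<lambda>t. ?l t)"
    by (rule loops_homotopic_reparametrise[OF l]) (use l in \<open>auto simp: loop_in_def\<close>)
  then show ?thesis
  proof (rule loops_homotopic_cong)
    fix t :: real assume "t \<in> {0..1}"
    consider "t \<le> 1/4" | "1/4 < t" "t \<le> 1/2" | "1/2 < t" by linarith
    then show "?l (?f t) = join_loops (join_loops p q) r t"
    proof cases
      case 1
      then have "?f t = 2 * t" by simp
      with 1 show ?thesis by (simp add: join_loops_def)
    next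
      case 2
      then have "?f t = t + 1/4" by simp
      with 2 show ?thesis by (simp add: join_loops_def algebra_simps)
    next
      case 3
      then have "?f t = (1 + t) / 2" by (simp add: min_def)
      with 3 show ?thesis by (simp add: join_loops_def add_divide_distrib)
    qed
  qed simp
qed

lemma group_fundamental_group:
  assumes "x \<in> topspace X"
  shows "group (fundamental_group X x)"
proof (rule groupI)
  fix a b assume "a \<in> carrier (fundamental_group X x)" "b \<in> carrier (fundamental_group X x)"
  then obtain p q where pq: "loop_in X x p" "loop_in X x q"
    and ab: "a = loop_class X x p" "b = loop_class X x q"
    unfolding carrier_fundamental_group by blast
  show "a \<otimes>\<^bsub>fundamental_group X x\<^esub> b \<in> carrier (fundamental_group X x)"
    unfolding ab mult_loop_class[OF pq] carrier_fundamental_group using loop_in_join[OF pq] by blast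
next
  show "\<one>\<^bsub>fundamental_group X x\<^esub> \<in> carrier (fundamental_group X x)"
    unfolding carrier_fundamental_group fundamental_group_one using loop_in_const[OF assms] by blast
next
  fix a b c assume "a \<in> carrier (fundamental_group X x)" "b \<in> carrier (fundamental_group X x)"
    "c \<in> carrier (fundamental_group X x)"
  then obtain p q r where "loop_in X x p" "loop_in X x q" "loop_in X x r"
    "a = loop_class X x p" "b = loop_class X x q" "c = loop_class X x r"
    by (auto simp: carrier_fundamental_group)
  then show "a \<otimes>\<^bsub>fundamental_group X x\<^esub> b \<otimes>\<^bsub>fundamental_group X x\<^esub> c
      = a \<otimes>\<^bsub>fundamental_group X x\<^esub> (b \<otimes>\<^bsub>fundamental_group X x\<^esub> c)"
    by (simp add: mult_loop_class loop_in_join loop_class_eq_iff loops_homotopic_join_assoc)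
next
  fix a assume "a \<in> carrier (fundamental_group X x)"
  then obtain p where p: "loop_in X x p" "a = loop_class X x p"
    by (auto simp: carrier_fundamental_group)
  then show "\<one>\<^bsub>fundamental_group X x\<^esub> \<otimes>\<^bsub>fundamental_group X x\<^esub> a = a"
    using assms by (simp add: fundamental_group_one mult_loop_class loop_in_const loop_in_join
        loop_class_eq_iff loops_homotopic_const_join)
  have r: "loop_in X x (\<lambda>t. p (1 - t))"
    by (rule loop_in_reverse[OF p(1)])
  show "\<exists>b\<in>carrier (fundamental_group X x). b \<otimes>\<^bsub>fundamental_group X x\<^esub> a = \<one>\<^bsub>fundamental_group X x\<^esub>"
  proof
    show "loop_class X x (\<lambda>t. p (1 - t)) \<otimes>\<^bsub>fundamental_group X x\<^esub> a = \<one>\<^bsub>fundamental_group X x\<^esub>"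
      using p r by (simp add: fundamental_group_one mult_loop_class loop_in_join
          loop_class_eq_iff loops_homotopic_join_reverse)
    show "loop_class X x (\<lambda>t. p (1 - t)) \<in> carrier (fundamental_group X x)"
      using r by (auto simp: carrier_fundamental_group)
  qed
qed

lemma inv_loop_class:
  assumes "x \<in> topspace X" and p: "loop_in X x p"
  shows "inv\<^bsub>fundamental_group X x\<^esub> (loop_class X x p) = loop_class X x (\<lambda>t. p (1 - t))"
proof (rule group.inv_equality[OF group_fundamental_group[OF assms(1)]])
  have r: "loop_in X x (\<lambda>t. p (1 - t))"
    by (rule loop_in_reverse[OF p(1)])
  show "loop_class X x (\<lambda>t. p (1 - t)) \<otimes>\<^bsub>fundamental_group X x\<^esub> loop_class X x p
      = \<one>\<^bsub>fundamental_group X x\<^esub>"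
    using p r by (simp add: fundamental_group_one mult_loop_class loop_in_join
        loop_class_eq_iff loops_homotopic_join_reverse)
qed (use p loop_in_reverse[OF p] in \<open>auto simp: carrier_fundamental_group\<close>)

section \<open>Loops in the homotopy fibre\<close>

text \<open>A point of the homotopy fibre is determined by its path of tuples.\<close>

definition fibre_point :: "nat \<Rightarrow> (real \<Rightarrow> nat \<Rightarrow> 'a) \<Rightarrow> (nat \<Rightarrow> 'a) \<times> (real \<Rightarrow> nat \<Rightarrow> 'a)" where
  "fibre_point n l = (\<lambda>i\<in>{1..n}. l 0 i, \<lambda>s\<in>{0..1}. \<lambda>i\<in>{1..n}. l s i)"

lemma fibre_point_cong:
  assumes "\<And>s i. s \<in> {0..1} \<Longrightarrow> i \<in> {1..n} \<Longrightarrow> l s i = l' s i"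
  shows "fibre_point n l = fibre_point n l'"
  using assms by (auto simp: fibre_point_def restrict_def fun_eq_iff)

lemma fibre_point_const:
  assumes "W \<in> extensional {1..n}" "\<And>s i. s \<in> {0..1} \<Longrightarrow> i \<in> {1..n} \<Longrightarrow> l s i = W i"
  shows "fibre_point n l = htpy_fibre_base W"
  using assms by (auto simp: fibre_point_def htpy_fibre_base_def const_loop_def restrict_def
      extensional_def fun_eq_iff)

text \<open>The maps into the homotopy fibre that occur below are given by one family of paths in the
  factors, and the compact-open topology enters only through currying.\<close>

lemma continuous_map_into_htpy_fibre:
  fixes l :: "'z \<Rightarrow> real \<Rightarrow> nat \<Rightarrow> 'a"
  assumes W: "W \<in> extensional {1..n}"
    and l: "\<And>i. i \<in> {1..n} \<Longrightarrow> continuous_map (prod_topology Z unit_interval) M (\<lambda>(z, s). l z s i)"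
    and inj: "\<And>z. z \<in> topspace Z \<Longrightarrow> inj_on (l z 0) {1..n}"
    and fin: "\<And>z i. z \<in> topspace Z \<Longrightarrow> i \<in> {1..n} \<Longrightarrow> l z 1 i = W i"
  shows "continuous_map Z (htpy_fibre n M W) (\<lambda>z. fibre_point n (l z))"
proof -
  have "continuous_map (prod_topology Z unit_interval) (power_space n M) (\<lambda>(z, s). \<lambda>i\<in>{1..n}. l z s i)"
    unfolding power_space_def continuous_map_componentwise
    using l by (auto simp: case_prod_beta')
  from continuous_map_into_compact_open[OF this]
  have 1: "continuous_map Z (compact_open_topology unit_interval (power_space n M))
      (\<lambda>z. \<lambda>s\<in>{0..1}. \<lambda>i\<in>{1..n}. l z s i)"
    by simp
  have l0: "continuous_map Z M (\<lambda>z. l z 0 i)" if "i \<in> {1..n}" for i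
  proof -
    have "continuous_map Z (prod_topology Z unit_interval) (\<lambda>z. (z, 0))"
      by (intro continuous_map_pairedI) auto
    from continuous_map_compose[OF this l[OF that]] show ?thesis
      by (simp add: o_def)
  qed
  have 2: "continuous_map Z (config_space n M) (\<lambda>z. \<lambda>i\<in>{1..n}. l z 0 i)"
    unfolding config_space_def power_space_def continuous_map_in_subtopology
  proof (intro conjI)
    show "continuous_map Z (product_topology (\<lambda>_. M) {1..n}) (\<lambda>z. \<lambda>i\<in>{1..n}. l z 0 i)"
      using l0 by (auto simp: continuous_map_componentwise)
    have "inj_on (\<lambda>i\<in>{1..n}. l z 0 i) {1..n}" if "z \<in> topspace Z" for z
      using inj[OF that] by (simp only: inj_on_restrict_eq)
    then show "(\<lambda>z. \<lambda>i\<in>{1..n}. l z 0 i) \<in> topspace Z \<rightarrow> {x. inj_on x {1..n}}"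
      by blast
  qed
  have "continuous_map Z (prod_topology (config_space n M)
      (compact_open_topology unit_interval (power_space n M))) (\<lambda>z. fibre_point n (l z))"
    unfolding fibre_point_def by (intro continuous_map_pairedI 1 2)
  moreover have "(\<lambda>i\<in>{1..n}. l z 1 i) = W" if "z \<in> topspace Z" for z
    using fin[OF that] W by (auto simp: restrict_def extensional_def fun_eq_iff)
  ultimately show ?thesis
    unfolding htpy_fibre_def continuous_map_in_subtopology
    by (auto simp: fibre_point_def)
qed

definition boundary_map :: "nat \<Rightarrow> (nat \<Rightarrow> 'a) \<Rightarrow> (nat \<Rightarrow> real \<Rightarrow> 'a) \<Rightarrow> (nat \<Rightarrow> 'a) \<times> (real \<Rightarrow> nat \<Rightarrow> 'a)" where
  "boundary_map n W = (\<lambda>\<omega>. (W, \<lambda>s\<in>{0..1}. \<lambda>i\<in>{1..n}. \<omega> i s))"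

lemma topspace_loop_space_product:
  "\<omega> \<in> topspace (loop_space_product n M W) \<longleftrightarrow>
    \<omega> \<in> extensional {1..n} \<and> (\<forall>i\<in>{1..n}. \<omega> i \<in> topspace (loop_space M (W i)))"
  by (auto simp: loop_space_product_def PiE_iff)

lemma boundary_map_eq_fibre_point:
  assumes "W \<in> extensional {1..n}" "\<omega> \<in> topspace (loop_space_product n M W)"
  shows "boundary_map n W \<omega> = fibre_point n (\<lambda>s i. \<omega> i s)"
proof -
  have "W = (\<lambda>i\<in>{1..n}. \<omega> i 0)"
    using assms unfolding topspace_loop_space_product topspace_loop_space
    by (auto simp: restrict_def extensional_def fun_eq_iff)
  then show ?thesis
    unfolding boundary_map_def fibre_point_def by simp
qed

lemma continuous_map_loop_evaluation:
  "continuous_map (prod_topology (loop_space M w) unit_interval) M (\<lambda>(g, s). g s)"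
proof -
  have "continuous_map (subtopology (prod_topology (compact_open_topology unit_interval M) unit_interval)
      ({\<gamma>. \<gamma> 0 = w \<and> \<gamma> 1 = w} \<times> {0..1})) M (\<lambda>(g, s). g s)"
    by (intro continuous_map_from_subtopology continuous_map_evaluation
        locally_compact_unit_interval Hausdorff_unit_interval)
  then show ?thesis
    by (simp add: loop_space_def prod_topology_subtopology(1))
qed

lemma continuous_map_boundary_map:
  assumes W: "W \<in> extensional {1..n}" and inj: "inj_on W {1..n}"
  shows "continuous_map (loop_space_product n M W) (htpy_fibre n M W) (boundary_map n W)"
proof (rule continuous_map_eq[OF continuous_map_into_htpy_fibre[OF W]])
  show "fibre_point n (\<lambda>s i. \<omega> i s) = boundary_map n W \<omega>"
    if "\<omega> \<in> topspace (loop_space_product n M W)" for \<omega>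
    using boundary_map_eq_fibre_point[OF W that] by simp
  show "continuous_map (prod_topology (loop_space_product n M W) unit_interval) M (\<lambda>(\<omega>, s). \<omega> i s)"
    if i: "i \<in> {1..n}" for i
  proof -
    have "continuous_map (prod_topology (loop_space_product n M W) unit_interval)
        (prod_topology (loop_space M (W i)) unit_interval) (\<lambda>p. (fst p i, snd p))"
      unfolding loop_space_product_def
      by (intro continuous_map_pairedI continuous_map_snd
          continuous_map_compose[OF continuous_map_fst, unfolded o_def]
          continuous_map_product_projection i)
    from continuous_map_compose[OF this continuous_map_loop_evaluation] show ?thesis
      by (simp add: o_def case_prod_beta')
  qed
  fix \<omega> assume \<omega>: "\<omega> \<in> topspace (loop_space_product n M W)"
  then have ends: "\<omega> i 0 = W i" "\<omega> i 1 = W i" if "i \<in> {1..n}" for i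
  proof -
    have "\<omega> i \<in> topspace (loop_space M (W i))"
      using \<omega> that unfolding topspace_loop_space_product by (elim conjE bspec)
    then show "\<omega> i 0 = W i" "\<omega> i 1 = W i"
      by (simp_all add: topspace_loop_space)
  qed
  show "inj_on (\<lambda>i. \<omega> i 0) {1..n}"
    using inj inj_on_cong[of "{1..n}" "\<lambda>i. \<omega> i 0" W] ends(1) by blast
  show "\<omega> i 1 = W i" if "i \<in> {1..n}" for i
    by (rule ends(2)[OF that])
qed

lemma continuous_map_into_product_family:
  assumes W: "\<And>i. i \<in> {1..n} \<Longrightarrow> W i \<in> topspace M"
    and g: "\<And>i. i \<in> A \<Longrightarrow> loop_in (loop_space M (W i)) (const_loop (W i)) (g i)"
    and a: "\<And>i. continuous_on S (a i)" "\<And>i. a i ` S \<subseteq> {0..1}"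
  shows "continuous_map (top_of_set S) (loop_space_product n M W)
    (\<lambda>z. \<lambda>i\<in>{1..n}. if i \<in> A then g i (a i z) else const_loop (W i))"
  unfolding loop_space_product_def continuous_map_componentwise
proof (intro conjI ballI)
  fix i assume i: "i \<in> {1..n}"
  have "continuous_map (top_of_set S) (loop_space M (W i)) (g i \<circ> a i)" if "i \<in> A"
    by (rule continuous_map_compose[of _ unit_interval])
      (use a g[OF that] in \<open>auto simp: loop_in_def pathin_def\<close>)
  then show "continuous_map (top_of_set S) (loop_space M (W i))
      (\<lambda>z. (\<lambda>i\<in>{1..n}. if i \<in> A then g i (a i z) else const_loop (W i)) i)"
    using i W by (auto simp: o_def const_loop_in_loop_space)
qed auto

lemma continuous_map_pi2_inclusion:
  assumes W: "\<And>i. i \<in> {1..n} \<Longrightarrow> W i \<in> topspace M" and a: "a \<in> {1..n}"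
  shows "continuous_map (loop_space M (W a)) (loop_space_product n M W)
    (\<lambda>\<gamma>. (const_loops n W)(a := \<gamma>))"
  unfolding loop_space_product_def continuous_map_componentwise
proof (intro conjI ballI)
  show "(\<lambda>\<gamma>. (const_loops n W)(a := \<gamma>)) ` topspace (loop_space M (W a)) \<subseteq> extensional {1..n}"
    using a by (auto simp: const_loops_def extensional_def)
  fix i assume i: "i \<in> {1..n}"
  show "continuous_map (loop_space M (W a)) (loop_space M (W i))
      (\<lambda>\<gamma>. ((const_loops n W)(a := \<gamma>)) i)"
  proof (cases "i = a")
    case False
    then show ?thesis
      using const_loop_in_loop_space[OF W[OF i]] i by (simp add: const_loops_def)
  qed simp
qed

text \<open>Under the inclusions of the factors, addition in the second homotopy group of a product
  amounts to juxtaposition of components: performing two loops in different coordinates one after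
  the other means to follow two sides of a square, and the diagonal of the square performs them
  simultaneously.\<close>

lemma list_mult_pi2_inclusions:
  assumes W: "\<And>i. i \<in> {1..n} \<Longrightarrow> W i \<in> topspace M"
    and "distinct idx" "set idx \<subseteq> {1..n}"
    and "\<And>i. i \<in> set idx \<Longrightarrow> loop_in (loop_space M (W i)) (const_loop (W i)) (g i)"
  shows "list_mult (pi2_power n M W)
      (map (\<lambda>i. pi2_inclusion n M W i (loop_class (loop_space M (W i)) (const_loop (W i)) (g i))) idx)
    = loop_class (loop_space_product n M W) (const_loops n W)
        (\<lambda>t. \<lambda>i\<in>{1..n}. if i \<in> set idx then g i t else const_loop (W i))"
  using assms(2-)
proof (induction idx)
  case Nil
  then show ?case
    by (simp add: list_mult_def pi2_power_def fundamental_group_one const_loops_def restrict_def)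
next
  case (Cons a idx)
  let ?L = "loop_space_product n M W" and ?c = "const_loops n W"
  \<comment> \<open>The square with the new component in the first direction and the remaining ones in the second.\<close>
  define G where "G = (\<lambda>x y. \<lambda>i\<in>{1..n}. if i \<in> insert a (set idx) then g i (if i = a then x else y)
    else const_loop (W i))"
  have g01: "g i 0 = const_loop (W i)" "g i 1 = const_loop (W i)" if "i \<in> insert a (set idx)" for i
    using Cons.prems(3)[of i] that by (auto simp: loop_in_def)
  have G: "continuous_map (top_of_set ({0..1} \<times> {0..1})) ?L (\<lambda>z. G (fst z) (snd z))"
    unfolding G_def
  proof (rule continuous_map_into_product_family[OF W])
    show "continuous_on ({0..1} \<times> {0..1}) (\<lambda>z. if i = a then fst z else snd z)" for i
      by (cases "i = a") (auto intro!: continuous_intros)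
  qed (use Cons.prems(3) in auto)
  have Gc: "G x y = ?c" if "x \<in> {0, 1}" "y \<in> {0, 1}" for x y
    using g01 that by (auto simp: G_def const_loops_def fun_eq_iff restrict_def)
  define T where "T = (\<lambda>t. \<lambda>i\<in>{1..n}. if i \<in> set idx then g i t else const_loop (W i))"
  have a: "a \<in> {1..n}" "a \<notin> set idx" "loop_in (loop_space M (W a)) (const_loop (W a)) (g a)"
    using Cons.prems by auto
  have T: "loop_in ?L ?c T"
    unfolding loop_in_def pathin_def
  proof (intro conjI)
    show "continuous_map unit_interval ?L T"
      unfolding T_def by (rule continuous_map_into_product_family[OF W])
        (use Cons.prems(3) in \<open>auto intro!: continuous_intros\<close>)
    show "T 0 = ?c" "T 1 = ?c"
      using g01 by (auto simp: T_def const_loops_def fun_eq_iff restrict_def)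
  qed
  have incl: "continuous_map (loop_space M (W a)) ?L (\<lambda>\<gamma>. ?c(a := \<gamma>))"
    by (rule continuous_map_pi2_inclusion[OF _ a(1)]) (rule W)
  have ca: "?c(a := const_loop (W a)) = ?c"
    using a(1) by (auto simp: const_loops_def)
  note incl_a = induced_map_loop_class[OF incl ca a(3)]
  have "loops_homotopic ?L ?c (\<lambda>t. G (min 1 (2 * t)) (max 0 (2 * t - 1))) (\<lambda>t. G t t)"
  proof (rule loops_homotopic_through_convex[where f = "\<lambda>t. (min 1 (2 * t), max 0 (2 * t - 1))"
        and g = "\<lambda>t. (t, t)", OF _ G, simplified fst_conv snd_conv])
    show "G (fst ((1 - u) *\<^sub>R (min 1 (2 * 0), max 0 (2 * 0 - 1)) + u *\<^sub>R (0, 0)))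
        (snd ((1 - u) *\<^sub>R (min 1 (2 * 0), max 0 (2 * 0 - 1)) + u *\<^sub>R (0, 0))) = ?c" for u :: real
      by (simp add: Gc)
    show "G (fst ((1 - u) *\<^sub>R (min 1 (2 * 1), max 0 (2 * 1 - 1)) + u *\<^sub>R (1, 1)))
        (snd ((1 - u) *\<^sub>R (min 1 (2 * 1), max 0 (2 * 1 - 1)) + u *\<^sub>R (1, 1))) = ?c" for u :: real
      by (simp add: Gc)
  qed (auto intro!: continuous_intros convex_Times)
  then have hom: "loops_homotopic ?L ?c (join_loops ((\<lambda>\<gamma>. ?c(a := \<gamma>)) \<circ> g a) T)
      (\<lambda>t. \<lambda>i\<in>{1..n}. if i \<in> set (a # idx) then g i t else const_loop (W i))"
  proof (rule loops_homotopic_cong)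
    fix t :: real assume t: "t \<in> {0..1}"
    show "G t t = (\<lambda>i\<in>{1..n}. if i \<in> set (a # idx) then g i t else const_loop (W i))"
      by (auto simp: G_def fun_eq_iff)
    show "G (min 1 (2 * t)) (max 0 (2 * t - 1)) = join_loops ((\<lambda>\<gamma>. ?c(a := \<gamma>)) \<circ> g a) T t"
    proof (cases "t \<le> 1/2")
      case True
      then have "min 1 (2 * t) = 2 * t" "max 0 (2 * t - 1) = 0" by auto
      then show ?thesis
        using True a(1,2) g01
        by (auto simp: join_loops_def G_def T_def const_loops_def fun_eq_iff restrict_def)
    next
      case False
      then have "min 1 (2 * t) = 1" "max 0 (2 * t - 1) = 2 * t - 1" by auto
      then show ?thesis
        using False a(1,2) g01
        by (auto simp: join_loops_def G_def T_def const_loops_def fun_eq_iff restrict_def)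
    qed
  qed
  have "list_mult (pi2_power n M W) (map (\<lambda>i. pi2_inclusion n M W i
      (loop_class (loop_space M (W i)) (const_loop (W i)) (g i))) idx) = loop_class ?L ?c T"
    unfolding T_def by (rule Cons.IH) (use Cons.prems in auto)
  moreover have "pi2_inclusion n M W a (loop_class (loop_space M (W a)) (const_loop (W a)) (g a))
      = loop_class ?L ?c ((\<lambda>\<gamma>. ?c(a := \<gamma>)) \<circ> g a)"
    unfolding pi2_inclusion_def by (rule incl_a(1))
  ultimately have "list_mult (pi2_power n M W) (map (\<lambda>i. pi2_inclusion n M W i
        (loop_class (loop_space M (W i)) (const_loop (W i)) (g i))) (a # idx))
      = loop_class ?L ?c ((\<lambda>\<gamma>. ?c(a := \<gamma>)) \<circ> g a) \<otimes>\<^bsub>pi2_power n M W\<^esub> loop_class ?L ?c T"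
    by (simp only: list_mult_def list.map foldr.simps comp_apply)
  also have "\<dots> = loop_class ?L ?c (join_loops ((\<lambda>\<gamma>. ?c(a := \<gamma>)) \<circ> g a) T)"
    unfolding pi2_power_def by (rule mult_loop_class[OF incl_a(2) T])
  also have "\<dots> = loop_class ?L ?c
      (\<lambda>t. \<lambda>i\<in>{1..n}. if i \<in> set (a # idx) then g i t else const_loop (W i))"
    by (rule iffD2[OF loop_class_eq_iff[OF loop_in_join[OF incl_a(2) T]] hom])
  finally show ?case .
qed

lemma inv_pi2_inclusion:
  assumes W: "\<And>i. i \<in> {1..n} \<Longrightarrow> W i \<in> topspace M" and a: "a \<in> {1..n}"
    and g: "loop_in (loop_space M (W a)) (const_loop (W a)) g"
  shows "inv\<^bsub>pi2_power n M W\<^esub>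
      (pi2_inclusion n M W a (loop_class (loop_space M (W a)) (const_loop (W a)) g))
    = pi2_inclusion n M W a (loop_class (loop_space M (W a)) (const_loop (W a)) (\<lambda>t. g (1 - t)))"
proof -
  have ca: "(const_loops n W)(a := const_loop (W a)) = const_loops n W"
    using a by (auto simp: const_loops_def)
  have "continuous_map (loop_space M (W a)) (loop_space_product n M W) (\<lambda>\<gamma>. (const_loops n W)(a := \<gamma>))"
    by (rule continuous_map_pi2_inclusion[OF _ a]) (rule W)
  note incl = induced_map_loop_class[where f = "\<lambda>\<gamma>. (const_loops n W)(a := \<gamma>)", OF this ca]
  have "const_loops n W \<in> topspace (loop_space_product n M W)"
    using const_loop_in_loop_space[OF W]
    by (simp add: topspace_loop_space_product const_loops_def)
  then show ?thesis
    unfolding pi2_power_def pi2_inclusion_def incl(1)[OF g] incl(1)[OF loop_in_reverse[OF g]]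
    by (subst inv_loop_class) (use incl(2)[OF g] in \<open>auto simp: o_def\<close>)
qed

lemma loop_in_loop_space:
  assumes "continuous_map (prod_topology unit_interval unit_interval) M (\<lambda>(t, s). \<gamma> t s)"
    and "\<And>t. t \<in> {0..1} \<Longrightarrow> \<gamma> t 0 = w \<and> \<gamma> t 1 = w"
    and "\<And>s. s \<in> {0..1} \<Longrightarrow> \<gamma> 0 s = w \<and> \<gamma> 1 s = w"
  shows "loop_in (loop_space M w) (const_loop w) (\<lambda>t. restrict (\<gamma> t) {0..1})"
  using continuous_map_into_loop_space[OF assms(1)] assms(2,3)
  by (auto simp: loop_in_def pathin_def const_loop_def restrict_def fun_eq_iff)

text \<open>The loop class in the fibre that a list of classes of the factors gives rise to: all components are
  traversed simultaneously over the constant configuration.\<close>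

lemma boundary_hom_list_mult:
  assumes W: "W \<in> extensional {1..n}" "inj_on W {1..n}" "\<And>i. i \<in> {1..n} \<Longrightarrow> W i \<in> topspace M"
    and idx: "distinct idx" "set idx = {1..n}"
    and \<gamma>: "\<And>i. i \<in> {1..n} \<Longrightarrow> continuous_map (prod_topology unit_interval unit_interval) M (\<lambda>(t, s). \<gamma> i t s)"
      "\<And>i t. i \<in> {1..n} \<Longrightarrow> t \<in> {0..1} \<Longrightarrow> \<gamma> i t 0 = W i \<and> \<gamma> i t 1 = W i"
      "\<And>i s. i \<in> {1..n} \<Longrightarrow> s \<in> {0..1} \<Longrightarrow> \<gamma> i 0 s = W i \<and> \<gamma> i 1 s = W i"
  shows "boundary_hom n M W
      (list_mult (pi2_power n M W) (map (\<lambda>i. pi2_inclusion n M W i (pi2_class M (W i) (\<gamma> i))) idx))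
    = loop_class (htpy_fibre n M W) (htpy_fibre_base W) (\<lambda>t. fibre_point n (\<lambda>s i. \<gamma> i t s))"
proof -
  let ?L = "loop_space_product n M W" and ?c = "const_loops n W"
  define T where "T = (\<lambda>t. \<lambda>i\<in>{1..n}. if i \<in> set idx then restrict (\<gamma> i t) {0..1} else const_loop (W i))"
  have li: "loop_in (loop_space M (W i)) (const_loop (W i)) (\<lambda>t. restrict (\<gamma> i t) {0..1})"
    if "i \<in> set idx" for i
    using \<gamma> that idx(2) by (intro loop_in_loop_space) auto
  have l: "list_mult (pi2_power n M W) (map (\<lambda>i. pi2_inclusion n M W i (pi2_class M (W i) (\<gamma> i))) idx)
      = loop_class ?L ?c T"
    using list_mult_pi2_inclusions[OF W(3) idx(1) _ li] idx(2) by (simp add: pi2_class_def T_def)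
  have T: "loop_in ?L ?c T"
    unfolding loop_in_def pathin_def
  proof (intro conjI)
    show "continuous_map unit_interval ?L T"
      unfolding T_def by (rule continuous_map_into_product_family[OF W(3) li]) auto
    show "T 0 = ?c" "T 1 = ?c"
      using \<gamma>(3) idx(2) by (auto simp: T_def const_loops_def const_loop_def fun_eq_iff restrict_def)
  qed
  have b: "boundary_map n W ?c = htpy_fibre_base W"
    using W(1) by (auto simp: boundary_map_def htpy_fibre_base_def const_loops_def const_loop_def
        extensional_def restrict_def fun_eq_iff)
  note bT = induced_map_loop_class[OF continuous_map_boundary_map[OF W(1,2)] b T]
  have "boundary_map n W (T t) = fibre_point n (\<lambda>s i. \<gamma> i t s)" if t: "t \<in> {0..1}" for t
  proof -
    have "T t \<in> topspace ?L"
      using T t by (auto simp: loop_in_def pathin_def continuous_map_def)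
    from boundary_map_eq_fibre_point[OF W(1) this] show ?thesis
      using idx(2) by (auto simp: T_def intro!: fibre_point_cong)
  qed
  then have "loops_homotopic (htpy_fibre n M W) (htpy_fibre_base W)
      (boundary_map n W \<circ> T) (\<lambda>t. fibre_point n (\<lambda>s i. \<gamma> i t s))"
    by (intro loops_homotopic_if_equal bT(2)) simp
  then show ?thesis
    unfolding l using bT(1) loop_class_eq_iff[OF bT(2)]
    by (simp add: boundary_hom_def boundary_map_def)
qed

section \<open>Homotopies of squares on the sphere\<close>

lemma continuous_on_compose_two:
  assumes "continuous_on (A \<times> B) (\<lambda>(x, y). F x y)"
    and "continuous_on T a" "continuous_on T b"
    and "\<And>z. z \<in> T \<Longrightarrow> a z \<in> A" "\<And>z. z \<in> T \<Longrightarrow> b z \<in> B"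
  shows "continuous_on T (\<lambda>z. F (a z) (b z))"
  using continuous_on_compose2[OF assms(1), of T "\<lambda>z. (a z, b z)"] assms(2-)
  by (simp add: continuous_on_Pair image_subset_iff)

lemma continuous_on_compose_three:
  assumes "continuous_on (A \<times> B \<times> C) (\<lambda>(x, y, z). F x y z)"
    and "continuous_on T a" "continuous_on T b" "continuous_on T c"
    and "\<And>z. z \<in> T \<Longrightarrow> a z \<in> A" "\<And>z. z \<in> T \<Longrightarrow> b z \<in> B" "\<And>z. z \<in> T \<Longrightarrow> c z \<in> C"
  shows "continuous_on T (\<lambda>z. F (a z) (b z) (c z))"
  using continuous_on_compose2[OF assms(1), of T "\<lambda>z. (a z, b z, c z)"] assms(2-)
  by (simp add: continuous_on_Pair image_subset_iff)

lemma continuous_on_join_family: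
  fixes p q :: "'z::topological_space \<Rightarrow> real \<Rightarrow> 'a::topological_space"
  assumes p: "continuous_on (S \<times> {0..1}) (\<lambda>(z, t). p z t)"
    and q: "continuous_on (S \<times> {0..1}) (\<lambda>(z, t). q z t)"
    and pq: "\<And>z. z \<in> S \<Longrightarrow> p z 1 = q z 0"
  shows "continuous_on (S \<times> {0..1}) (\<lambda>(z, t). join_loops (p z) (q z) t)"
proof -
  have eq: "top_of_set (S \<times> {0..1}) = prod_topology (top_of_set S) unit_interval"
    by (simp add: subtopology_Times)
  show ?thesis
    using continuous_map_join[of "top_of_set S" euclidean p q] p q pq
    by (simp flip: eq)
qed

text \<open>Homotopy relative to the boundary of the square. The boundary values themselves are arbitrary, so
  the notion also covers families of paths whose end points vary with the first coordinate.\<close>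

definition square_homotopic :: "(real \<Rightarrow> real \<Rightarrow> real^3) \<Rightarrow> (real \<Rightarrow> real \<Rightarrow> real^3) \<Rightarrow> bool" where
  "square_homotopic F G \<longleftrightarrow>
     homotopic_with_canon
       (\<lambda>f. \<forall>t\<in>{0..1}. \<forall>s\<in>{0..1}. t \<in> {0, 1} \<or> s \<in> {0, 1} \<longrightarrow> f (t, s) = F t s)
       ({0..1} \<times> {0..1}) (sphere 0 1) (\<lambda>(t, s). F t s) (\<lambda>(t, s). G t s)"

lemma square_homotopicI:
  fixes H :: "real \<Rightarrow> real \<Rightarrow> real \<Rightarrow> real^3"
  assumes cont: "continuous_on ({0..1} \<times> {0..1} \<times> {0..1}) (\<lambda>(u, t, s). H u t s)"
    and sph: "\<And>u t s. u \<in> {0..1} \<Longrightarrow> t \<in> {0..1} \<Longrightarrow> s \<in> {0..1} \<Longrightarrow> norm (H u t s) = 1"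
    and H0: "\<And>t s. t \<in> {0..1} \<Longrightarrow> s \<in> {0..1} \<Longrightarrow> H 0 t s = F t s"
    and H1: "\<And>t s. t \<in> {0..1} \<Longrightarrow> s \<in> {0..1} \<Longrightarrow> H 1 t s = G t s"
    and bd: "\<And>u t s. u \<in> {0..1} \<Longrightarrow> t \<in> {0..1} \<Longrightarrow> s \<in> {0..1} \<Longrightarrow> t \<in> {0, 1} \<or> s \<in> {0, 1}
      \<Longrightarrow> H u t s = F t s"
  shows "square_homotopic F G"
  unfolding square_homotopic_def
proof (subst homotopic_with)
  show "\<exists>h. continuous_map (prod_topology unit_interval (top_of_set ({0..1} \<times> {0..1})))
           (top_of_set (sphere 0 1)) h \<and>
         (\<forall>x\<in>topspace (top_of_set ({0..1} \<times> {0..1})). h (0, x) = (case x of (t, s) \<Rightarrow> F t s)) \<and>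
         (\<forall>x\<in>topspace (top_of_set ({0..1} \<times> {0..1})). h (1, x) = (case x of (t, s) \<Rightarrow> G t s)) \<and>
         (\<forall>u\<in>{0..1}. \<forall>t\<in>{0..1}. \<forall>s\<in>{0..1}. t \<in> {0, 1} \<or> s \<in> {0, 1} \<longrightarrow> h (u, t, s) = F t s)"
  proof (intro exI[of _ "\<lambda>(u, t, s). H u t s"] conjI ballI)
    show "continuous_map (prod_topology unit_interval (top_of_set ({0..1} \<times> {0..1})))
           (top_of_set (sphere 0 1)) (\<lambda>(u, t, s). H u t s)"
      using cont sph by (auto simp flip: subtopology_Times)
  qed (use H0 H1 bd in auto)
qed auto

lemma square_homotopicE:
  assumes "square_homotopic F G"
  obtains H :: "real \<Rightarrow> real \<Rightarrow> real \<Rightarrow> real^3" where "continuous_on ({0..1} \<times> {0..1} \<times> {0..1}) (\<lambda>(u, t, s). H u t s)"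
    and "\<And>u t s. u \<in> {0..1} \<Longrightarrow> t \<in> {0..1} \<Longrightarrow> s \<in> {0..1} \<Longrightarrow> norm (H u t s) = 1"
    and "\<And>t s. H 0 t s = F t s" and "\<And>t s. H 1 t s = G t s"
    and "\<And>u t s. u \<in> {0..1} \<Longrightarrow> t \<in> {0..1} \<Longrightarrow> s \<in> {0..1} \<Longrightarrow> t \<in> {0, 1} \<or> s \<in> {0, 1}
      \<Longrightarrow> H u t s = F t s"
proof -
  obtain h where h: "continuous_map (prod_topology unit_interval (top_of_set ({0..1} \<times> {0..1})))
      (top_of_set (sphere 0 1)) h"
    "\<And>t s. h (0, t, s) = F t s" "\<And>t s. h (1, t, s) = G t s"
    "\<And>u t s. u \<in> {0..1} \<Longrightarrow> t \<in> {0..1} \<Longrightarrow> s \<in> {0..1} \<Longrightarrow> t \<in> {0, 1} \<or> s \<in> {0, 1}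
      \<Longrightarrow> h (u, t, s) = F t s"
    using assms unfolding square_homotopic_def homotopic_with_def by fastforce
  have "continuous_on ({0..1} \<times> {0..1} \<times> {0..1}) h" "h \<in> {0..1} \<times> {0..1} \<times> {0..1} \<rightarrow> sphere 0 1"
    using h(1) by (simp_all flip: subtopology_Times)
  then show ?thesis
    by (intro that[of "\<lambda>u t s. h (u, t, s)"]) (use h(2-) in \<open>auto simp: Pi_iff\<close>)
qed

lemma square_homotopic_boundary:
  assumes "square_homotopic F G" "t \<in> {0..1}" "s \<in> {0..1}" "t \<in> {0, 1} \<or> s \<in> {0, 1}"
  shows "F t s = G t s"
proof -
  have "\<forall>t\<in>{0..1}. \<forall>s\<in>{0..1}. t \<in> {0, 1} \<or> s \<in> {0, 1} \<longrightarrow> G t s = F t s"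
    using homotopic_with_imp_property[OF assms(1)[unfolded square_homotopic_def]] by simp
  from mp[OF bspec[OF bspec[OF this assms(2)] assms(3)] assms(4)] show ?thesis
    by (rule sym)
qed

lemma square_homotopic_sym:
  assumes "square_homotopic F G"
  shows "square_homotopic G F"
proof -
  have "\<forall>t\<in>{0..1}. \<forall>s\<in>{0..1}. t \<in> {0, 1} \<or> s \<in> {0, 1} \<longrightarrow> G t s = F t s"
    using homotopic_with_imp_property[OF assms[unfolded square_homotopic_def]] by simp
  then show ?thesis
    unfolding square_homotopic_def
    by (intro homotopic_with_mono[OF homotopic_with_symD[OF assms[unfolded square_homotopic_def]]]) auto
qed

lemma square_homotopic_trans:
  assumes FG: "square_homotopic F G" and GK: "square_homotopic G K"
  shows "square_homotopic F K"
proof -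
  have "\<forall>t\<in>{0..1}. \<forall>s\<in>{0..1}. t \<in> {0, 1} \<or> s \<in> {0, 1} \<longrightarrow> G t s = F t s"
    using homotopic_with_imp_property[OF FG[unfolded square_homotopic_def]] by simp
  then have "homotopic_with_canon
       (\<lambda>f. \<forall>t\<in>{0..1}. \<forall>s\<in>{0..1}. t \<in> {0, 1} \<or> s \<in> {0, 1} \<longrightarrow> f (t, s) = F t s)
       ({0..1} \<times> {0..1}) (sphere 0 1) (\<lambda>(t, s). G t s) (\<lambda>(t, s). K t s)"
    by (intro homotopic_with_mono[OF GK[unfolded square_homotopic_def]]) auto
  then show ?thesis
    using FG unfolding square_homotopic_def by (rule homotopic_with_trans[rotated])
qed

lemma square_homotopic_imp_square:
  assumes "square_homotopic F G"
  shows "continuous_on ({0..1} \<times> {0..1}) (\<lambda>(t, s). G t s)"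
    and "\<And>t s. t \<in> {0..1} \<Longrightarrow> s \<in> {0..1} \<Longrightarrow> norm (G t s) = 1"
proof -
  have "continuous_map (top_of_set ({0..1} \<times> {0..1})) (top_of_set (sphere 0 1)) (\<lambda>(t, s). G t s)"
    using homotopic_with_imp_continuous_maps[OF assms[unfolded square_homotopic_def]] by simp
  then show "continuous_on ({0..1} \<times> {0..1}) (\<lambda>(t, s). G t s)"
    "\<And>t s. t \<in> {0..1} \<Longrightarrow> s \<in> {0..1} \<Longrightarrow> norm (G t s) = 1"
    by (auto simp: Pi_iff)
qed

lemma square_homotopic_if_equal:
  assumes "continuous_on ({0..1} \<times> {0..1}) (\<lambda>(t, s). F t s)"
    and "\<And>t s. t \<in> {0..1} \<Longrightarrow> s \<in> {0..1} \<Longrightarrow> norm (F t s) = 1"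
    and "\<And>t s. t \<in> {0..1} \<Longrightarrow> s \<in> {0..1} \<Longrightarrow> F t s = G t s"
  shows "square_homotopic F G"
proof (rule square_homotopicI[where H = "\<lambda>u. F"])
  show "continuous_on ({0..1} \<times> {0..1} \<times> {0..1}) (\<lambda>(u::real, t, s). F t s)"
    unfolding case_prod_beta' by (intro continuous_on_compose_two[OF assms(1)] continuous_intros) auto
qed (use assms in auto)

lemma square_homotopic_cong:
  assumes "square_homotopic F G"
    and "\<And>t s. t \<in> {0..1} \<Longrightarrow> s \<in> {0..1} \<Longrightarrow> F t s = F' t s"
    and "\<And>t s. t \<in> {0..1} \<Longrightarrow> s \<in> {0..1} \<Longrightarrow> G t s = G' t s"
  shows "square_homotopic F' G'"
proof -
  have "square_homotopic F F'"
    by (rule square_homotopic_if_equal[OF square_homotopic_imp_square[OF square_homotopic_sym[OF assms(1)]] assms(2)])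
  moreover have "square_homotopic G G'"
    by (rule square_homotopic_if_equal[OF square_homotopic_imp_square[OF assms(1)] assms(3)])
  ultimately show ?thesis
    using assms(1) square_homotopic_sym square_homotopic_trans by blast
qed

lemma square_homotopic_join:
  assumes F: "square_homotopic F F'" and G: "square_homotopic G G'"
    and FG: "\<And>t. t \<in> {0..1} \<Longrightarrow> F t 1 = G t 0"
  shows "square_homotopic (\<lambda>t. join_loops (F t) (G t)) (\<lambda>t. join_loops (F' t) (G' t))"
proof -
  obtain H :: "real \<Rightarrow> real \<Rightarrow> real \<Rightarrow> real^3" where H: "continuous_on ({0..1} \<times> {0..1} \<times> {0..1}) (\<lambda>(u, t, s). H u t s)"
    "\<And>u t s. u \<in> {0..1} \<Longrightarrow> t \<in> {0..1} \<Longrightarrow> s \<in> {0..1} \<Longrightarrow> norm (H u t s) = 1"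
    "\<And>t s. H 0 t s = F t s" "\<And>t s. H 1 t s = F' t s"
    "\<And>u t s. u \<in> {0..1} \<Longrightarrow> t \<in> {0..1} \<Longrightarrow> s \<in> {0..1} \<Longrightarrow> t \<in> {0, 1} \<or> s \<in> {0, 1}
      \<Longrightarrow> H u t s = F t s"
    using square_homotopicE[OF F] by blast
  obtain K :: "real \<Rightarrow> real \<Rightarrow> real \<Rightarrow> real^3" where K: "continuous_on ({0..1} \<times> {0..1} \<times> {0..1}) (\<lambda>(u, t, s). K u t s)"
    "\<And>u t s. u \<in> {0..1} \<Longrightarrow> t \<in> {0..1} \<Longrightarrow> s \<in> {0..1} \<Longrightarrow> norm (K u t s) = 1"
    "\<And>t s. K 0 t s = G t s" "\<And>t s. K 1 t s = G' t s"
    "\<And>u t s. u \<in> {0..1} \<Longrightarrow> t \<in> {0..1} \<Longrightarrow> s \<in> {0..1} \<Longrightarrow> t \<in> {0, 1} \<or> s \<in> {0, 1}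
      \<Longrightarrow> K u t s = G t s"
    using square_homotopicE[OF G] by blast
  let ?J = "\<lambda>z. join_loops (H (fst z) (snd z)) (K (fst z) (snd z))"
  have "continuous_on (({0..1} \<times> {0..1}) \<times> {0..1}) (\<lambda>(z, s). ?J z s)"
  proof (rule continuous_on_join_family)
    show "continuous_on (({0..1} \<times> {0..1}) \<times> {0..1}) (\<lambda>(z, s). H (fst z) (snd z) s)"
      unfolding case_prod_beta'
      by (intro continuous_on_compose_three[OF H(1)] continuous_intros) auto
    show "continuous_on (({0..1} \<times> {0..1}) \<times> {0..1}) (\<lambda>(z, s). K (fst z) (snd z) s)"
      unfolding case_prod_beta'
      by (intro continuous_on_compose_three[OF K(1)] continuous_intros) auto
    show "H (fst z) (snd z) 1 = K (fst z) (snd z) 0" if "z \<in> {0..1} \<times> {0..1}" for z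
      using that FG H(5)[of "fst z" "snd z" 1] K(5)[of "fst z" "snd z" 0] by auto
  qed
  moreover have "continuous_on ({0..1::real} \<times> {0..1::real} \<times> {0..1::real}) (\<lambda>x. (fst x, fst (snd x)))"
    "continuous_on ({0..1::real} \<times> {0..1::real} \<times> {0..1::real}) (\<lambda>x. snd (snd x))"
    by (intro continuous_intros)+
  ultimately have "continuous_on ({0..1} \<times> {0..1} \<times> {0..1}) (\<lambda>x. ?J (fst x, fst (snd x)) (snd (snd x)))"
    by (rule continuous_on_compose_two) auto
  then have c: "continuous_on ({0..1} \<times> {0..1} \<times> {0..1}) (\<lambda>(u, t, s). ?J (u, t) s)"
    by (simp add: case_prod_beta')
  show ?thesis
  proof (rule square_homotopicI[OF c])
    fix u t s :: real assume uts: "u \<in> {0..1}" "t \<in> {0..1}" "s \<in> {0..1}"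
    show "norm (?J (u, t) s) = 1"
      using uts H(2) K(2) by (auto simp: join_loops_def)
    assume "t \<in> {0, 1} \<or> s \<in> {0, 1}"
    then show "?J (u, t) s = join_loops (F t) (G t) s"
      using uts H(5)[of u t] K(5)[of u t] by (auto simp: join_loops_def)
  qed (use H(3,4) K(3,4) in \<open>auto simp: join_loops_def\<close>)
qed

lemma square_homotopic_apply:
  assumes FG: "square_homotopic F G"
    and f: "continuous_on ({0..1} \<times> sphere 0 1) (\<lambda>(t, p). f t p)"
    and fs: "\<And>t p. t \<in> {0..1} \<Longrightarrow> norm p = 1 \<Longrightarrow> norm (f t p) = 1"
  shows "square_homotopic (\<lambda>t s. f t (F t s)) (\<lambda>t s. f t (G t s))"
proof -
  obtain H :: "real \<Rightarrow> real \<Rightarrow> real \<Rightarrow> real^3" where H: "continuous_on ({0..1} \<times> {0..1} \<times> {0..1}) (\<lambda>(u, t, s). H u t s)"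
    "\<And>u t s. u \<in> {0..1} \<Longrightarrow> t \<in> {0..1} \<Longrightarrow> s \<in> {0..1} \<Longrightarrow> norm (H u t s) = 1"
    "\<And>t s. H 0 t s = F t s" "\<And>t s. H 1 t s = G t s"
    "\<And>u t s. u \<in> {0..1} \<Longrightarrow> t \<in> {0..1} \<Longrightarrow> s \<in> {0..1} \<Longrightarrow> t \<in> {0, 1} \<or> s \<in> {0, 1}
      \<Longrightarrow> H u t s = F t s"
    using square_homotopicE[OF FG] by blast
  show ?thesis
  proof (rule square_homotopicI[where H = "\<lambda>u t s. f t (H u t s)"])
    show "continuous_on ({0..1} \<times> {0..1} \<times> {0..1}) (\<lambda>(u, t, s). f t (H u t s))"
      unfolding case_prod_beta'
      by (intro continuous_on_compose_two[OF f] continuous_on_compose_three[OF H(1)] continuous_intros)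
        (use H(2) in auto)
  qed (use H fs in auto)
qed

text \<open>Two maps to the sphere that are nowhere antipodal are joined by the great-circle arcs, that is,
  by normalised straight segments.\<close>

lemma square_homotopic_nonantipodal:
  assumes F: "continuous_on ({0..1} \<times> {0..1}) (\<lambda>(t, s). F t s)"
      "\<And>t s. t \<in> {0..1} \<Longrightarrow> s \<in> {0..1} \<Longrightarrow> norm (F t s) = 1"
    and G: "continuous_on ({0..1} \<times> {0..1}) (\<lambda>(t, s). G t s)"
      "\<And>t s. t \<in> {0..1} \<Longrightarrow> s \<in> {0..1} \<Longrightarrow> norm (G t s) = 1"
    and bd: "\<And>t s. t \<in> {0..1} \<Longrightarrow> s \<in> {0..1} \<Longrightarrow> t \<in> {0, 1} \<or> s \<in> {0, 1} \<Longrightarrow> F t s = G t s"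
    and ne: "\<And>t s. t \<in> {0<..<1} \<Longrightarrow> s \<in> {0<..<1} \<Longrightarrow> F t s \<noteq> - G t s"
  shows "square_homotopic F G"
proof -
  define L where "L = (\<lambda>u t s. (1 - u) *\<^sub>R F t s + u *\<^sub>R G t s)"
  have nz: "L u t s \<noteq> 0" if "u \<in> {0..1}" "t \<in> {0..1}" "s \<in> {0..1}" for u t s
  proof (cases "t \<in> {0, 1} \<or> s \<in> {0, 1}")
    case True
    then have "L u t s = F t s"
      using bd[OF that(2,3)] by (simp add: L_def flip: scaleR_add_left)
    then show ?thesis using F(2)[OF that(2,3)] by force
  next
    case False
    show ?thesis
    proof
      assume "L u t s = 0"
      then have eq: "(1 - u) *\<^sub>R F t s = - (u *\<^sub>R G t s)"
        by (simp add: L_def eq_neg_iff_add_eq_0)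
      then have "norm ((1 - u) *\<^sub>R F t s) = norm (u *\<^sub>R G t s)" by simp
      then have "1 - u = u" using F(2)[OF that(2,3)] G(2)[OF that(2,3)] that(1) by simp
      then have "u = 1/2" by simp
      with eq have "(1/2) *\<^sub>R F t s = (1/2) *\<^sub>R (- G t s)" by simp
      then have "F t s = - G t s" by (simp only: scaleR_cancel_left) simp
      then show False using ne[of t s] False that by auto
    qed
  qed
  show ?thesis
  proof (rule square_homotopicI[where H = "\<lambda>u t s. L u t s /\<^sub>R norm (L u t s)"])
    have F': "continuous_on ({0..1::real} \<times> {0..1} \<times> {0..1}) (\<lambda>x. F (fst (snd x)) (snd (snd x)))"
      by (intro continuous_on_compose_two[OF F(1)] continuous_intros) auto
    have G': "continuous_on ({0..1::real} \<times> {0..1} \<times> {0..1}) (\<lambda>x. G (fst (snd x)) (snd (snd x)))"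
      by (intro continuous_on_compose_two[OF G(1)] continuous_intros) auto
    have L': "continuous_on ({0..1::real} \<times> {0..1} \<times> {0..1}) (\<lambda>x. L (fst x) (fst (snd x)) (snd (snd x)))"
      unfolding L_def by (intro continuous_intros F' G')
    show "continuous_on ({0..1} \<times> {0..1} \<times> {0..1}) (\<lambda>(u, t, s). L u t s /\<^sub>R norm (L u t s))"
      unfolding case_prod_beta' by (intro continuous_intros L') (use nz in auto)
    show "norm (L u t s /\<^sub>R norm (L u t s)) = 1" if "u \<in> {0..1}" "t \<in> {0..1}" "s \<in> {0..1}" for u t s
      using nz[OF that] by simp
    show "L 0 t s /\<^sub>R norm (L 0 t s) = F t s" if "t \<in> {0..1}" "s \<in> {0..1}" for t s
      using F(2)[OF that] by (simp add: L_def)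
    show "L 1 t s /\<^sub>R norm (L 1 t s) = G t s" if "t \<in> {0..1}" "s \<in> {0..1}" for t s
      using G(2)[OF that] by (simp add: L_def)
    show "L u t s /\<^sub>R norm (L u t s) = F t s"
      if "u \<in> {0..1}" "t \<in> {0..1}" "s \<in> {0..1}" "t \<in> {0, 1} \<or> s \<in> {0, 1}" for u t s
      using bd[OF that(2-4)] F(2)[OF that(2,3)] by (simp add: L_def flip: scaleR_add_left)
  qed
qed

text \<open>Paths that run along a common curve from the same start to the same end are homotopic. The
  curve has to be constant at the two ends of the family, for otherwise moving the parameters would
  change the boundary values there.\<close>

lemma square_homotopic_reparametrise:
  fixes \<Phi> :: "real \<Rightarrow> real \<Rightarrow> real^3"
  assumes \<Phi>: "continuous_on ({0..1} \<times> {a..b}) (\<lambda>(t, x). \<Phi> t x)"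
      "\<And>t x. t \<in> {0..1} \<Longrightarrow> x \<in> {a..b} \<Longrightarrow> norm (\<Phi> t x) = 1"
      "\<And>t x. t \<in> {0, 1} \<Longrightarrow> x \<in> {a..b} \<Longrightarrow> \<Phi> t x = w"
    and f: "continuous_on {0..1} f" "\<And>s. s \<in> {0..1} \<Longrightarrow> f s \<in> {a..b}"
    and g: "continuous_on {0..1} g" "\<And>s. s \<in> {0..1} \<Longrightarrow> g s \<in> {a..b}"
    and ends: "f 0 = g 0" "f 1 = g 1"
  shows "square_homotopic (\<lambda>t s. \<Phi> t (f s)) (\<lambda>t s. \<Phi> t (g s))"
proof -
  have seg: "(1 - u) * f s + u * g s \<in> {a..b}" if "u \<in> {0..1}" "s \<in> {0..1}" for u s
    using convexD_alt[of "{a..b}" "f s" "g s" u] f(2)[OF that(2)] g(2)[OF that(2)] that(1) by simp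
  show ?thesis
  proof (rule square_homotopicI[where H = "\<lambda>u t s. \<Phi> t ((1 - u) * f s + u * g s)"])
    show "continuous_on ({0..1} \<times> {0..1} \<times> {0..1}) (\<lambda>(u, t, s). \<Phi> t ((1 - u) * f s + u * g s))"
      unfolding case_prod_beta'
      by (intro continuous_on_compose_two[OF \<Phi>(1)] continuous_intros
          continuous_on_compose2[OF f(1)] continuous_on_compose2[OF g(1)]) (use seg in auto)
    show "norm (\<Phi> t ((1 - u) * f s + u * g s)) = 1" if "u \<in> {0..1}" "t \<in> {0..1}" "s \<in> {0..1}" for u t s
      by (rule \<Phi>(2)[OF that(2) seg[OF that(1,3)]])
    show "\<Phi> t ((1 - u) * f s + u * g s) = \<Phi> t (f s)"
      if "u \<in> {0..1}" "t \<in> {0..1}" "s \<in> {0..1}" "t \<in> {0, 1} \<or> s \<in> {0, 1}" for u t s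
    proof (cases "t \<in> {0, 1}")
      case True
      then show ?thesis using \<Phi>(3)[OF True] seg[OF that(1,3)] f(2)[OF that(3)] by simp
    next
      case False
      with that ends have "g s = f s" by auto
      then have "(1 - u) * f s + u * g s = f s" by (simp add: algebra_simps)
      then show ?thesis by simp
    qed
  qed auto
qed

section \<open>Unwinding a double rotation\<close>

text \<open>The rotation about the \<open>z\<close>-axis is given by the cosine and the sine of its angle, since the
  angle of the midpoints of the circles is known only through their coordinates.\<close>

definition rotZ :: "real \<Rightarrow> real \<Rightarrow> real^3 \<Rightarrow> real^3" where
  "rotZ a b p = vector [a * p$1 - b * p$2, b * p$1 + a * p$2, p$3]"

text \<open>The sense of rotation is the one that raises latitudes on the prime meridian.\<close>

definition rotY :: "real \<Rightarrow> real^3 \<Rightarrow> real^3" where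
  "rotY \<beta> p = vector [cos \<beta> * p$1 - sin \<beta> * p$3, p$2, sin \<beta> * p$1 + cos \<beta> * p$3]"

lemma vector_3_eq_sum: "(vector [a, b, c] :: real^3) = a *\<^sub>R axis 1 1 + b *\<^sub>R axis 2 1 + c *\<^sub>R axis 3 1"
  by (simp add: vec_eq_iff forall_3 axis_def)

lemma continuous_on_vector_3 [continuous_intros]:
  fixes a b c :: "'z::topological_space \<Rightarrow> real"
  assumes "continuous_on T a" "continuous_on T b" "continuous_on T c"
  shows "continuous_on T (\<lambda>z. vector [a z, b z, c z] :: real^3)"
  unfolding vector_3_eq_sum by (intro continuous_intros assms)

lemma continuous_on_rotZ [continuous_intros]:
  assumes "continuous_on T a" "continuous_on T b" "continuous_on T f"
  shows "continuous_on T (\<lambda>z. rotZ (a z) (b z) (f z))"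
  unfolding rotZ_def by (intro continuous_intros assms)

lemma continuous_on_rotY [continuous_intros]:
  fixes a :: "'z::t2_space \<Rightarrow> real"
  assumes "continuous_on T a" "continuous_on T f"
  shows "continuous_on T (\<lambda>z. rotY (a z) (f z))"
  unfolding rotY_def by (intro continuous_intros assms)

lemma vec3_eq_iff: "(p :: real^3) = q \<longleftrightarrow> p$1 = q$1 \<and> p$2 = q$2 \<and> p$3 = q$3"
  by (simp add: vec_eq_iff forall_3)

lemma norm_vec3: "norm (p :: real^3) = sqrt ((p$1)\<^sup>2 + (p$2)\<^sup>2 + (p$3)\<^sup>2)"
  by (simp add: norm_eq_sqrt_inner inner_vec_def sum_3 power2_eq_square)

lemma rotZ_nth [simp]:
  "rotZ a b p $ 1 = a * p$1 - b * p$2" "rotZ a b p $ 2 = b * p$1 + a * p$2" "rotZ a b p $ 3 = p$3"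
  by (simp_all add: rotZ_def)

lemma rotY_nth [simp]:
  "rotY \<beta> p $ 1 = cos \<beta> * p$1 - sin \<beta> * p$3" "rotY \<beta> p $ 2 = p$2"
  "rotY \<beta> p $ 3 = sin \<beta> * p$1 + cos \<beta> * p$3"
  by (simp_all add: rotY_def)

lemma linear_rotZ: "linear (rotZ a b)"
  by (rule linearI) (simp_all add: vec3_eq_iff algebra_simps)

lemma linear_rotY: "linear (rotY \<beta>)"
  by (rule linearI) (simp_all add: vec3_eq_iff algebra_simps)

lemma rotZ_1_0 [simp]: "rotZ 1 0 p = p"
  by (simp add: vec3_eq_iff)

lemma rotY_0 [simp]: "rotY 0 p = p"
  by (simp add: vec3_eq_iff)

lemma rotY_rotY: "rotY \<beta> (rotY \<gamma> p) = rotY (\<beta> + \<gamma>) p"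
  by (simp add: vec3_eq_iff sin_add cos_add algebra_simps)

lemma norm_rotZ:
  assumes "a\<^sup>2 + b\<^sup>2 = 1"
  shows "norm (rotZ a b p) = norm p"
proof -
  have "(a * p$1 - b * p$2)\<^sup>2 + (b * p$1 + a * p$2)\<^sup>2 = (a\<^sup>2 + b\<^sup>2) * ((p$1)\<^sup>2 + (p$2)\<^sup>2)"
    by algebra
  then show ?thesis
    using assms by (simp add: norm_vec3)
qed

lemma norm_rotY [simp]: "norm (rotY \<beta> p) = norm p"
proof -
  have "(cos \<beta> * p$1 - sin \<beta> * p$3)\<^sup>2 + (p$2)\<^sup>2 + (sin \<beta> * p$1 + cos \<beta> * p$3)\<^sup>2
      = ((cos \<beta>)\<^sup>2 + (sin \<beta>)\<^sup>2) * ((p$1)\<^sup>2 + (p$3)\<^sup>2) + (p$2)\<^sup>2"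
    by algebra
  then show ?thesis
    by (simp add: norm_vec3 algebra_simps)
qed

lemma inj_if_norm_preserving:
  assumes "linear L" "\<And>p. norm (L p) = norm p"
  shows "inj L"
  using linear_injective_0[OF assms(1)] assms(2) by (metis norm_eq_zero)

lemma join_loops_0 [simp]: "join_loops p q 0 = p 0"
  and join_loops_1 [simp]: "join_loops p q 1 = q 1"
  by (simp_all add: join_loops_def)

lemma continuous_map_sphere_family:
  assumes q: "continuous_map S2 M q"
    and F: "continuous_on (Z \<times> {0..1}) (\<lambda>(z, r). F z r)"
      "\<And>z r. z \<in> Z \<Longrightarrow> r \<in> {0..1} \<Longrightarrow> norm (F z r) = 1"
  shows "continuous_map (prod_topology (top_of_set Z) unit_interval) M (\<lambda>(z, r). q (F z r))"
proof -
  have "continuous_map (top_of_set (Z \<times> {0..1})) S2 (\<lambda>(z, r). F z r)"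
    using F by (auto simp: S2_def)
  from continuous_map_compose[OF this q] show ?thesis
    by (simp add: o_def case_prod_beta' subtopology_Times)
qed

text \<open>The functions are the cosine and the sine of the angle of a loop of rotations about the
  \<open>z\<close>-axis.\<close>

locale rotation_loop =
  fixes c s :: "real \<Rightarrow> real"
  assumes continuous_c: "continuous_on {0..1} c" and continuous_s: "continuous_on {0..1} s"
    and unit_circle: "\<And>t. t \<in> {0..1} \<Longrightarrow> (c t)\<^sup>2 + (s t)\<^sup>2 = 1"
    and start: "c 0 = 1" "s 0 = 0" and finish: "c 1 = 1" "s 1 = 0"
begin

definition A :: "real \<Rightarrow> real^3 \<Rightarrow> real^3" where
  "A t = rotZ (c t) (s t)"

text \<open>At \<open>u = 0\<close> this is \<open>A t \<circ> A t'\<close>. For \<open>t = t'\<close> and \<open>u = 1\<close> it is the identity, because a half turn about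
  the \<open>y\<close>-axis conjugates a rotation about the \<open>z\<close>-axis to its inverse. The two times are kept
  apart in order to pass from the composite loop to the pointwise product.\<close>

definition twist :: "real \<Rightarrow> real \<Rightarrow> real \<Rightarrow> real^3 \<Rightarrow> real^3" where
  "twist u t t' p = A t (rotY (- (pi * u)) (A t' (rotY (pi * u) p)))"

text \<open>The track of \<open>p\<close> under the twist, from parameter \<open>u\<close> back to \<open>0\<close>, continued to \<open>p\<close> by two
  copies of \<open>h\<close>. At \<open>u = 0\<close> the first piece is constant.\<close>

definition unwinding ::
  "(real \<Rightarrow> real \<Rightarrow> real^3) \<Rightarrow> real^3 \<Rightarrow> real \<Rightarrow> real \<Rightarrow> real \<Rightarrow> real \<Rightarrow> real^3" where
  "unwinding h p u t t' =
     join_loops (join_loops (\<lambda>x. twist (u * (1 - x)) t t' p) (\<lambda>x. A t (h t' x))) (h t)"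

lemma A_0 [simp]: "A 0 p = p" and A_1 [simp]: "A 1 p = p"
  by (simp_all add: A_def start finish)

lemma norm_A: "t \<in> {0..1} \<Longrightarrow> norm (A t p) = norm p"
  unfolding A_def by (rule norm_rotZ[OF unit_circle])

lemma continuous_on_A:
  fixes a :: "'z::t2_space \<Rightarrow> real"
  assumes "continuous_on T a" "continuous_on T f" "\<And>z. z \<in> T \<Longrightarrow> a z \<in> {0..1}"
  shows "continuous_on T (\<lambda>z. A (a z) (f z))"
  unfolding A_def
  by (intro continuous_intros continuous_on_compose2[OF continuous_c] continuous_on_compose2[OF continuous_s] assms)
    (use assms(3) in auto)

lemma continuous_on_twist:
  fixes u :: "'z::t2_space \<Rightarrow> real"
  assumes "continuous_on T u" "continuous_on T a" "continuous_on T b"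
    "\<And>z. z \<in> T \<Longrightarrow> a z \<in> {0..1}" "\<And>z. z \<in> T \<Longrightarrow> b z \<in> {0..1}"
  shows "continuous_on T (\<lambda>z. twist (u z) (a z) (b z) p)"
  unfolding twist_def by (intro continuous_on_A continuous_intros assms)

lemma linear_twist: "linear (twist u t t')"
proof -
  have "linear (rotZ (c t) (s t) \<circ> (rotY (- (pi * u)) \<circ> (rotZ (c t') (s t') \<circ> rotY (pi * u))))"
    by (intro linear_compose linear_rotZ linear_rotY)
  moreover have "rotZ (c t) (s t) \<circ> (rotY (- (pi * u)) \<circ> (rotZ (c t') (s t') \<circ> rotY (pi * u))) = twist u t t'"
    by (auto simp: twist_def A_def)
  ultimately show ?thesis by simp
qed

lemma norm_twist: "t \<in> {0..1} \<Longrightarrow> t' \<in> {0..1} \<Longrightarrow> norm (twist u t t' p) = norm p"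
  by (simp add: twist_def norm_A)

lemma inj_twist: "t \<in> {0..1} \<Longrightarrow> t' \<in> {0..1} \<Longrightarrow> inj (twist u t t')"
  by (rule inj_if_norm_preserving[OF linear_twist norm_twist])

lemma twist_ends [simp]: "twist u 0 0 p = p" "twist u 1 1 p = p"
  by (simp_all add: twist_def rotY_rotY)

lemma continuous_on_unwinding:
  assumes h: "continuous_on ({0..1} \<times> {0..1}) (\<lambda>(t, r). h t r)"
    and h0: "\<And>t. t \<in> {0..1} \<Longrightarrow> h t 0 = A t p" and h1: "\<And>t. t \<in> {0..1} \<Longrightarrow> h t 1 = p"
  shows "continuous_on (({0..1} \<times> {0..1} \<times> {0..1}) \<times> {0..1})
    (\<lambda>(z, r). unwinding h p (fst z) (fst (snd z)) (snd (snd z)) r)"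
  unfolding unwinding_def
proof (intro continuous_on_join_family)
  show "continuous_on (({0..1} \<times> {0..1} \<times> {0..1}) \<times> {0..1})
      (\<lambda>(z, x). twist (fst z * (1 - x)) (fst (snd z)) (snd (snd z)) p)"
    unfolding case_prod_beta' by (intro continuous_on_twist continuous_intros) auto
  show "continuous_on (({0..1::real} \<times> {0..1} \<times> {0..1}) \<times> {0..1})
      (\<lambda>(z, x). A (fst (snd z)) (h (snd (snd z)) x))"
    unfolding case_prod_beta'
    by (intro continuous_on_A continuous_on_compose_two[OF h] continuous_intros) auto
  show "continuous_on (({0..1::real} \<times> {0..1} \<times> {0..1::real}) \<times> {0..1}) (\<lambda>(z, x). h (fst (snd z)) x)"
    unfolding case_prod_beta'
    by (intro continuous_on_compose_two[OF h] continuous_intros) auto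
qed (use h0 h1 in \<open>auto simp: twist_def\<close>)

lemma norm_unwinding:
  assumes "\<And>t r. t \<in> {0..1} \<Longrightarrow> r \<in> {0..1} \<Longrightarrow> norm (h t r) = 1" "norm p = 1"
    and "t \<in> {0..1}" "t' \<in> {0..1}" "r \<in> {0..1}"
  shows "norm (unwinding h p u t t' r) = 1"
  using assms by (auto simp: unwinding_def join_loops_def norm_twist norm_A)

text \<open>The unwinding is a map on a cube with coordinates \<open>(u, t, t')\<close>. The path along the edges
  \<open>(0, t, 0)\<close> and then \<open>(0, 1, t)\<close> represents the square of the class, since one of the two
  rotations is trivial on each edge. The diagonal \<open>(1, t, t)\<close> has the same end points, and over it
  the configuration is constant. Since the cube is convex, the two paths are homotopic.\<close>

theorem square_of_rotation_class:
  fixes v :: "nat \<Rightarrow> real^3" and h g :: "nat \<Rightarrow> real \<Rightarrow> real \<Rightarrow> real^3"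
  assumes q: "continuous_map S2 M q"
    and v: "\<And>i. i \<in> {1..n} \<Longrightarrow> norm (v i) = 1"
    and inj: "\<And>L. linear L \<Longrightarrow> inj L \<Longrightarrow> inj_on (\<lambda>i. q (L (v i))) {1..n}"
    and h: "\<And>i. i \<in> {1..n} \<Longrightarrow> continuous_on ({0..1} \<times> {0..1}) (\<lambda>(t, r). h i t r)"
      "\<And>i t r. i \<in> {1..n} \<Longrightarrow> t \<in> {0..1} \<Longrightarrow> r \<in> {0..1} \<Longrightarrow> norm (h i t r) = 1"
    and h0: "\<And>i t. i \<in> {1..n} \<Longrightarrow> t \<in> {0..1} \<Longrightarrow> h i t 0 = A t (v i)"
    and h1: "\<And>i t. i \<in> {1..n} \<Longrightarrow> t \<in> {0..1} \<Longrightarrow> h i t 1 = v i"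
    and hc: "\<And>i t r. i \<in> {1..n} \<Longrightarrow> t \<in> {0, 1} \<Longrightarrow> r \<in> {0..1} \<Longrightarrow> h i t r = v i"
    and g: "\<And>i. i \<in> {1..n} \<Longrightarrow> square_homotopic (\<lambda>t. unwinding (h i) (v i) 1 t t) (g i)"
    and W: "W = (\<lambda>i\<in>{1..n}. q (v i))"
  defines "\<tau> \<equiv> \<lambda>t. fibre_point n (\<lambda>r i. q (h i t r))"
  shows "loop_class (htpy_fibre n M W) (htpy_fibre_base W) \<tau>
      [^]\<^bsub>fundamental_group (htpy_fibre n M W) (htpy_fibre_base W)\<^esub> (2::nat)
    = loop_class (htpy_fibre n M W) (htpy_fibre_base W) (\<lambda>t. fibre_point n (\<lambda>r i. q (g i t r)))"
proof -
  let ?X = "htpy_fibre n M W" and ?b = "htpy_fibre_base W"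
  have We: "W \<in> extensional {1..n}"
    by (simp add: W)
  have base: "fibre_point n (\<lambda>r i. q (F i r)) = ?b"
    if "\<And>i r. i \<in> {1..n} \<Longrightarrow> r \<in> {0..1} \<Longrightarrow> F i r = v i" for F :: "nat \<Rightarrow> real \<Rightarrow> real^3"
    by (rule fibre_point_const[OF We]) (use that in \<open>simp add: W\<close>)
  have reparam: "loops_homotopic ?X ?b \<tau> (\<lambda>t. fibre_point n (\<lambda>r i. q (h i t (\<rho> r))))"
    if \<rho>: "continuous_on {0..1} \<rho>" "\<rho> ` {0..1} \<subseteq> {0..1}" "\<rho> 0 = 0" "\<rho> 1 = 1" for \<rho>
  proof -
    let ?\<Phi> = "\<lambda>z r i. h i (fst z) ((1 - snd z) * r + snd z * \<rho> r)"
    have seg: "(1 - u) * r + u * \<rho> r \<in> {0..1}" if "u \<in> {0..1}" "r \<in> {0..1}" for u r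
      using convexD_alt[of "{0..1}" r "\<rho> r" u] \<rho>(2) that by (auto simp: image_subset_iff)
    have "continuous_map (top_of_set ({0..1} \<times> {0..1})) ?X (\<lambda>z. fibre_point n (\<lambda>r i. q (?\<Phi> z r i)))"
    proof (rule continuous_map_into_htpy_fibre[OF We])
      fix i assume i: "i \<in> {1..n}"
      show "continuous_map (prod_topology (top_of_set ({0..1} \<times> {0..1})) unit_interval) M
          (\<lambda>(z, r). q (?\<Phi> z r i))"
      proof (rule continuous_map_sphere_family[OF q])
        show "continuous_on (({0..1} \<times> {0..1}) \<times> {0..1}) (\<lambda>(z, r). ?\<Phi> z r i)"
          unfolding case_prod_beta'
          by (intro continuous_on_compose_two[OF h(1)[OF i]] continuous_intros
              continuous_on_compose2[OF \<rho>(1)]) (use seg in auto)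
      qed (use h(2)[OF i] seg in auto)
    next
      fix z :: "real \<times> real" assume z: "z \<in> topspace (top_of_set ({0..1} \<times> {0..1}))"
      have inj_t: "inj_on (\<lambda>i. q (twist 0 (fst z) 0 (v i))) {1..n}"
        using z by (intro inj linear_twist inj_twist) auto
      have eq_t: "twist 0 (fst z) 0 (v i) = ?\<Phi> z 0 i" if "i \<in> {1..n}" for i
        using z h0[OF that, of "fst z"] \<rho>(3) by (auto simp: twist_def)
      show "inj_on (\<lambda>i. q (?\<Phi> z 0 i)) {1..n}"
        by (rule iffD1[OF inj_on_cong inj_t]) (rule arg_cong[of _ _ q, OF eq_t])
      show "q (?\<Phi> z 1 i) = W i" if "i \<in> {1..n}" for i
        using that z h1[OF that, of "fst z"] \<rho>(4) by (auto simp: W)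
    qed
    then have "loops_homotopic ?X ?b (\<lambda>t. fibre_point n (\<lambda>r i. q (?\<Phi> (t, 0) r i)))
        (\<lambda>t. fibre_point n (\<lambda>r i. q (?\<Phi> (t, 1) r i)))"
      by (rule loops_homotopic_through_convex[where f = "\<lambda>t. (t, 0)" and g = "\<lambda>t. (t, 1)", rotated])
        (use seg in \<open>auto intro!: continuous_intros convex_Times base hc\<close>)
    then show ?thesis
      by (simp add: \<tau>_def)
  qed
  define \<Psi> where "\<Psi> = (\<lambda>z. fibre_point n (\<lambda>r i.
    q (unwinding (h i) (v i) (fst z) (fst (snd z)) (snd (snd z)) r)))"
  have \<Psi>: "continuous_map (top_of_set ({0..1} \<times> {0..1} \<times> {0..1})) ?X \<Psi>"
    unfolding \<Psi>_def
  proof (rule continuous_map_into_htpy_fibre[OF We])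
    fix i assume i: "i \<in> {1..n}"
    show "continuous_map (prod_topology (top_of_set ({0..1} \<times> {0..1} \<times> {0..1})) unit_interval) M
        (\<lambda>(z, r). q (unwinding (h i) (v i) (fst z) (fst (snd z)) (snd (snd z)) r))"
      by (rule continuous_map_sphere_family[OF q continuous_on_unwinding[OF h(1)[OF i] h0[OF i] h1[OF i]]])
        (auto intro!: norm_unwinding h(2)[OF i] v[OF i])
  next
    fix z :: "real \<times> real \<times> real" assume z: "z \<in> topspace (top_of_set ({0..1} \<times> {0..1} \<times> {0..1}))"
    have "inj_on (\<lambda>i. q (twist (fst z) (fst (snd z)) (snd (snd z)) (v i))) {1..n}"
      using z by (intro inj linear_twist inj_twist) auto
    then show "inj_on (\<lambda>i. q (unwinding (h i) (v i) (fst z) (fst (snd z)) (snd (snd z)) 0)) {1..n}"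
      by (simp add: unwinding_def)
    show "q (unwinding (h i) (v i) (fst z) (fst (snd z)) (snd (snd z)) 1) = W i" if "i \<in> {1..n}" for i
      using z h1[OF that, of "fst (snd z)"] that by (auto simp: unwinding_def W)
  qed
  \<comment> \<open>Both rotations are trivial at the ends of the path parameter.\<close>
  have \<Psi>_base: "\<Psi> (u, t, t) = ?b" if "t \<in> {0, 1}" for u t
    unfolding \<Psi>_def by (rule base) (use that hc in \<open>auto simp: unwinding_def join_loops_def\<close>)
  have edge: "loops_homotopic ?X ?b (\<lambda>t. \<Psi> (0, min 1 (2 * t), max 0 (2 * t - 1))) (\<lambda>t. \<Psi> (1, t, t))"
    by (rule loops_homotopic_through_convex[where f = "\<lambda>t. (0, min 1 (2 * t), max 0 (2 * t - 1))"
          and g = "\<lambda>t. (1, t, t)", OF _ \<Psi>])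
      (auto intro!: continuous_intros convex_Times \<Psi>_base)
  \<comment> \<open>On either edge the constant pieces of the unwinding only delay the path \<open>h\<close>.\<close>
  let ?\<rho> = "\<lambda>r::real. max 0 (2 * r - 1)" and ?\<rho>' = "\<lambda>r::real. min 1 (max 0 (4 * r - 1))"
  have first: "loops_homotopic ?X ?b \<tau> (\<lambda>t. \<Psi> (0, t, 0))"
  proof (rule loops_homotopic_cong[OF reparam[of ?\<rho>]])
    fix t :: real assume t: "t \<in> {0..1}"
    have "h i t (?\<rho> r) = unwinding (h i) (v i) 0 t 0 r" if "r \<in> {0..1}" "i \<in> {1..n}" for r i
      using t that h0[OF that(2) t] hc[OF that(2)]
      by (cases "r \<le> 1/2") (auto simp: unwinding_def join_loops_def twist_def)
    then show "fibre_point n (\<lambda>r i. q (h i t (?\<rho> r))) = \<Psi> (0, t, 0)"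
      unfolding \<Psi>_def by (intro fibre_point_cong) simp
  qed (auto intro!: continuous_intros)
  have second: "loops_homotopic ?X ?b \<tau> (\<lambda>t. \<Psi> (0, 1, t))"
  proof (rule loops_homotopic_cong[OF reparam[of ?\<rho>']])
    fix t :: real assume t: "t \<in> {0..1}"
    have "h i t (?\<rho>' r) = unwinding (h i) (v i) 0 1 t r" if "r \<in> {0..1}" "i \<in> {1..n}" for r i
    proof -
      consider "r \<le> 1/4" | "1/4 < r" "r \<le> 1/2" | "1/2 < r" by linarith
      then show ?thesis
        using t that h0[OF that(2) t] h1[OF that(2) t] hc[OF that(2)]
        by cases (auto simp: unwinding_def join_loops_def twist_def)
    qed
    then show "fibre_point n (\<lambda>r i. q (h i t (?\<rho>' r))) = \<Psi> (0, 1, t)"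
      unfolding \<Psi>_def by (intro fibre_point_cong) simp
  qed (auto intro!: continuous_intros)
  note homotopic_with_trans [trans]
  have "loops_homotopic ?X ?b (join_loops \<tau> \<tau>) (join_loops (\<lambda>t. \<Psi> (0, t, 0)) (\<lambda>t. \<Psi> (0, 1, t)))"
    by (rule loops_homotopic_join[OF first second])
  also have "loops_homotopic ?X ?b \<dots> (\<lambda>t. \<Psi> (1, t, t))"
  proof (rule loops_homotopic_cong[OF edge])
    fix t :: real assume "t \<in> {0..1}"
    then show "\<Psi> (0, min 1 (2 * t), max 0 (2 * t - 1))
        = join_loops (\<lambda>t. \<Psi> (0, t, 0)) (\<lambda>t. \<Psi> (0, 1, t)) t"
      by (cases "t \<le> 1/2") (simp_all add: join_loops_def max_absorb1 max_absorb2 min_absorb1)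
  qed simp
  also have "loops_homotopic ?X ?b \<dots> (\<lambda>t. fibre_point n (\<lambda>r i. q (g i t r)))"
  proof -
    have "\<forall>i\<in>{1..n}. \<exists>H :: real \<Rightarrow> real \<Rightarrow> real \<Rightarrow> real^3. continuous_on ({0..1} \<times> {0..1} \<times> {0..1}) (\<lambda>(u, t, r). H u t r) \<and>
        (\<forall>u\<in>{0..1}. \<forall>t\<in>{0..1}. \<forall>r\<in>{0..1}. norm (H u t r) = 1 \<and>
          (t \<in> {0, 1} \<or> r \<in> {0, 1} \<longrightarrow> H u t r = unwinding (h i) (v i) 1 t t r)) \<and>
        (\<forall>t r. H 0 t r = unwinding (h i) (v i) 1 t t r) \<and> (\<forall>t r. H 1 t r = g i t r)"
    proof
      fix i assume "i \<in> {1..n}"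
      from square_homotopicE[OF g[OF this]] obtain H :: "real \<Rightarrow> real \<Rightarrow> real \<Rightarrow> real^3"
        where "continuous_on ({0..1} \<times> {0..1} \<times> {0..1}) (\<lambda>(u, t, s). H u t s)"
        "\<And>u t s. u \<in> {0..1} \<Longrightarrow> t \<in> {0..1} \<Longrightarrow> s \<in> {0..1} \<Longrightarrow> norm (H u t s) = 1"
        "\<And>t s. H 0 t s = unwinding (h i) (v i) 1 t t s" "\<And>t s. H 1 t s = g i t s"
        "\<And>u t s. u \<in> {0..1} \<Longrightarrow> t \<in> {0..1} \<Longrightarrow> s \<in> {0..1} \<Longrightarrow> t \<in> {0, 1} \<or> s \<in> {0, 1}
          \<Longrightarrow> H u t s = unwinding (h i) (v i) 1 t t s"
        by blast
      then show "\<exists>H :: real \<Rightarrow> real \<Rightarrow> real \<Rightarrow> real^3. continuous_on ({0..1} \<times> {0..1} \<times> {0..1}) (\<lambda>(u, t, r). H u t r) \<and>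
        (\<forall>u\<in>{0..1}. \<forall>t\<in>{0..1}. \<forall>r\<in>{0..1}. norm (H u t r) = 1 \<and>
          (t \<in> {0, 1} \<or> r \<in> {0, 1} \<longrightarrow> H u t r = unwinding (h i) (v i) 1 t t r)) \<and>
        (\<forall>t r. H 0 t r = unwinding (h i) (v i) 1 t t r) \<and> (\<forall>t r. H 1 t r = g i t r)"
        by (intro exI[of _ H]) simp
    qed
    from bchoice[OF this] obtain H :: "nat \<Rightarrow> real \<Rightarrow> real \<Rightarrow> real \<Rightarrow> real^3" where P:
      "\<forall>i\<in>{1..n}. continuous_on ({0..1} \<times> {0..1} \<times> {0..1}) (\<lambda>(u, t, r). H i u t r) \<and>
        (\<forall>u\<in>{0..1}. \<forall>t\<in>{0..1}. \<forall>r\<in>{0..1}. norm (H i u t r) = 1 \<and>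
          (t \<in> {0, 1} \<or> r \<in> {0, 1} \<longrightarrow> H i u t r = unwinding (h i) (v i) 1 t t r)) \<and>
        (\<forall>t r. H i 0 t r = unwinding (h i) (v i) 1 t t r) \<and> (\<forall>t r. H i 1 t r = g i t r)"
      by (elim exE)
    have H: "continuous_on ({0..1} \<times> {0..1} \<times> {0..1}) (\<lambda>(u, t, r). H i u t r)"
      "\<And>u t r. u \<in> {0..1} \<Longrightarrow> t \<in> {0..1} \<Longrightarrow> r \<in> {0..1} \<Longrightarrow> norm (H i u t r) = 1"
      "\<And>u t r. u \<in> {0..1} \<Longrightarrow> t \<in> {0..1} \<Longrightarrow> r \<in> {0..1} \<Longrightarrow> t \<in> {0, 1} \<or> r \<in> {0, 1} \<Longrightarrow>
        H i u t r = unwinding (h i) (v i) 1 t t r"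
      "\<And>t r. H i 0 t r = unwinding (h i) (v i) 1 t t r" "\<And>t r. H i 1 t r = g i t r"
      if "i \<in> {1..n}" for i
      using bspec[OF P that] by blast+
    let ?\<Phi> = "\<lambda>z. fibre_point n (\<lambda>r i. q (H i (fst z) (snd z) r))"
    have "continuous_map (top_of_set ({0..1} \<times> {0..1})) ?X ?\<Phi>"
    proof (rule continuous_map_into_htpy_fibre[OF We])
      fix i assume i: "i \<in> {1..n}"
      show "continuous_map (prod_topology (top_of_set ({0..1} \<times> {0..1})) unit_interval) M
          (\<lambda>(z, r). q (H i (fst z) (snd z) r))"
      proof (rule continuous_map_sphere_family[OF q])
        show "continuous_on (({0..1} \<times> {0..1}) \<times> {0..1}) (\<lambda>(z, r). H i (fst z) (snd z) r)"
          unfolding case_prod_beta'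
          by (intro continuous_on_compose_three[OF H(1)[OF i]] continuous_intros) auto
      qed (use H(2)[OF i] in auto)
    next
      fix z :: "real \<times> real" assume z: "z \<in> topspace (top_of_set ({0..1} \<times> {0..1}))"
      have inj_t: "inj_on (\<lambda>i. q (twist 1 (snd z) (snd z) (v i))) {1..n}"
        using z by (intro inj linear_twist inj_twist) auto
      have eq_t: "twist 1 (snd z) (snd z) (v i) = H i (fst z) (snd z) 0" if "i \<in> {1..n}" for i
        using z H(3)[OF that, of "fst z" "snd z" 0] by (auto simp: unwinding_def)
      show "inj_on (\<lambda>i. q (H i (fst z) (snd z) 0)) {1..n}"
        by (rule iffD1[OF inj_on_cong inj_t]) (rule arg_cong[of _ _ q, OF eq_t])
      show "q (H i (fst z) (snd z) 1) = W i" if "i \<in> {1..n}" for i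
        using that z H(3)[OF that, of "fst z" "snd z" 1] h1[OF that, of "snd z"]
        by (auto simp: W unwinding_def)
    qed
    moreover have "?\<Phi> (u, t) = ?b" if "u \<in> {0..1}" "t \<in> {0, 1}" for u t
    proof -
      have "H i u t r = v i" if i: "i \<in> {1..n}" and r: "r \<in> {0..1}" for i r
      proof -
        have "H i u t r = unwinding (h i) (v i) 1 t t r"
          using H(3)[OF i \<open>u \<in> {0..1}\<close> _ r] \<open>t \<in> {0, 1}\<close> by auto
        also have "\<dots> = v i"
          using hc[OF i] \<open>t \<in> {0, 1}\<close> r by (auto simp: unwinding_def join_loops_def)
        finally show ?thesis .
      qed
      then show ?thesis
        using base by simp
    qed
    ultimately have "loops_homotopic ?X ?b (\<lambda>t. ?\<Phi> (0, t)) (\<lambda>t. ?\<Phi> (1, t))"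
      by (intro loops_homotopic_through_convex[where f = "\<lambda>t. (0, t)" and g = "\<lambda>t. (1, t)"])
        (auto intro!: continuous_intros convex_Times)
    then show ?thesis
      by (rule loops_homotopic_cong) (auto simp: \<Psi>_def H(4,5) intro!: fibre_point_cong)
  qed
  finally have sq: "loops_homotopic ?X ?b (join_loops \<tau> \<tau>) (\<lambda>t. fibre_point n (\<lambda>r i. q (g i t r)))" .
  have \<tau>: "loop_in ?X ?b \<tau>"
    by (rule homotopic_imp_loop_in(1)[OF first])
  have "?b \<in> topspace ?X"
    using \<tau> path_start_in_topspace[of ?X \<tau>] by (simp add: loop_in_def)
  then interpret group "fundamental_group ?X ?b"
    by (rule group_fundamental_group)
  have "loop_class ?X ?b \<tau> \<in> carrier (fundamental_group ?X ?b)"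
    using \<tau> by (auto simp: carrier_fundamental_group)
  then show ?thesis
    using \<tau> sq by (simp add: numeral_2_eq_2 mult_loop_class loop_class_eq_iff loop_in_join)
qed

end

section \<open>The unwound loop at a point of the prime meridian\<close>

definition meridian :: "real \<Rightarrow> real^3" where
  "meridian \<phi> = vector [cos \<phi>, 0, sin \<phi>]"

lemma meridian_nth [simp]: "meridian \<phi> $ 1 = cos \<phi>" "meridian \<phi> $ 2 = 0" "meridian \<phi> $ 3 = sin \<phi>"
  by (simp_all add: meridian_def)

lemma norm_meridian [simp]: "norm (meridian \<phi>) = 1"
  by (simp add: norm_vec3)

lemma rotY_meridian: "rotY \<beta> (meridian \<phi>) = meridian (\<beta> + \<phi>)"
  by (simp add: vec3_eq_iff cos_add sin_add)

context rotation_loop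
begin

text \<open>The path of the point at latitude \<open>\<phi>\<close> under the rotation \<open>A t\<close> about a moving axis. At
  \<open>\<beta> = pi/2 - \<phi>\<close> the axis passes through the point itself.\<close>

definition conj_path :: "real \<Rightarrow> real \<Rightarrow> real \<Rightarrow> real^3" where
  "conj_path \<phi> t \<beta> = rotY (- \<beta>) (A t (rotY \<beta> (meridian \<phi>)))"

text \<open>The arc of the conjugated path that is homotopic to the half loops.\<close>

definition cap :: "real \<Rightarrow> real \<Rightarrow> real \<Rightarrow> real^3" where
  "cap \<phi> t r = conj_path \<phi> t (r * (pi/2 - \<phi>))"

text \<open>The complementary arc, brought back to the base point by the rotation \<open>A t\<close>, followed by the
  cap.\<close>

definition sweep :: "real \<Rightarrow> real \<Rightarrow> real \<Rightarrow> real^3" where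
  "sweep \<phi> t = join_loops (\<lambda>x. A t (conj_path \<phi> t (pi - x * (pi/2 + \<phi>)))) (cap \<phi> t)"

lemma conj_path_nth:
  "conj_path \<phi> t \<beta> $ 1 = cos \<beta> * (c t * cos (\<beta> + \<phi>)) + sin \<beta> * sin (\<beta> + \<phi>)"
  "conj_path \<phi> t \<beta> $ 2 = s t * cos (\<beta> + \<phi>)"
  "conj_path \<phi> t \<beta> $ 3 = cos \<beta> * sin (\<beta> + \<phi>) - sin \<beta> * (c t * cos (\<beta> + \<phi>))"
  by (simp_all add: conj_path_def A_def rotY_meridian)

lemma conj_path_const: "t \<in> {0, 1} \<Longrightarrow> conj_path \<phi> t \<beta> = meridian \<phi>"
  by (auto simp: conj_path_def rotY_rotY)

lemma conj_path_0: "conj_path \<phi> t 0 = A t (meridian \<phi>)"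
  by (simp add: conj_path_def)

lemma conj_path_return: "conj_path \<phi> t (pi/2 - \<phi>) = meridian \<phi>"
  by (simp add: vec3_eq_iff conj_path_nth cos_diff sin_diff)

lemma A_conj_path_pi:
  assumes "t \<in> {0..1}"
  shows "A t (conj_path \<phi> t pi) = meridian \<phi>"
proof -
  have "c t * (c t * cos \<phi>) + s t * (s t * cos \<phi>) = ((c t)\<^sup>2 + (s t)\<^sup>2) * cos \<phi>"
    by algebra
  then show ?thesis
    using unit_circle[OF assms]
    by (simp add: vec3_eq_iff A_def conj_path_nth cos_add sin_add algebra_simps)
qed

lemma norm_conj_path: "t \<in> {0..1} \<Longrightarrow> norm (conj_path \<phi> t \<beta>) = 1"
  by (simp add: conj_path_def norm_A)

lemma continuous_on_meridian [continuous_intros]: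
  fixes f :: "'z::t2_space \<Rightarrow> real"
  shows "continuous_on T f \<Longrightarrow> continuous_on T (\<lambda>z. meridian (f z))"
  unfolding meridian_def by (intro continuous_intros)

lemma continuous_on_conj_path:
  fixes f :: "'z::t2_space \<Rightarrow> real"
  assumes "continuous_on T f" "continuous_on T a" "continuous_on T b" "\<And>z. z \<in> T \<Longrightarrow> a z \<in> {0..1}"
  shows "continuous_on T (\<lambda>z. conj_path (f z) (a z) (b z))"
  unfolding conj_path_def by (intro continuous_on_A continuous_intros assms)

lemma cap_ends: "cap \<phi> t 0 = A t (meridian \<phi>)" "cap \<phi> t 1 = meridian \<phi>"
  by (simp_all add: cap_def conj_path_0 conj_path_return)

lemma continuous_on_cap: "continuous_on ({0..1} \<times> {0..1}) (\<lambda>(t, r). cap \<phi> t r)"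
  unfolding cap_def case_prod_beta' by (intro continuous_on_conj_path continuous_intros) auto

text \<open>After \<open>h\<close> has been replaced by the cap, the first two pieces of the unwinding run along one curve
  \<open>\<beta> \<mapsto> A t (conj_path \<phi> t \<beta>)\<close>: down from \<open>pi\<close> to \<open>0\<close> and up again to \<open>pi/2 - \<phi>\<close>. Cutting this
  short, from \<open>pi\<close> directly to \<open>pi/2 - \<phi>\<close>, leaves the sweep.\<close>

lemma unwinding_homotopic_sweep:
  assumes \<phi>: "0 \<le> \<phi>" "\<phi> \<le> pi/2" and h: "square_homotopic h (cap \<phi>)"
  shows "square_homotopic (\<lambda>t. unwinding h (meridian \<phi>) 1 t t) (sweep \<phi>)"
proof -
  let ?F = "\<lambda>t x. A t (conj_path \<phi> t (pi * (1 - x)))"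
  have hb: "h t 0 = A t (meridian \<phi>)" "h t 1 = meridian \<phi>" if "t \<in> {0..1}" for t
    using square_homotopic_boundary[OF h that] cap_ends by auto
  have F: "square_homotopic ?F ?F"
    by (rule square_homotopic_if_equal)
      (auto simp: case_prod_beta' norm_A norm_conj_path
        intro!: continuous_on_A continuous_on_conj_path continuous_intros)
  have Ah: "square_homotopic (\<lambda>t x. A t (h t x)) (\<lambda>t x. A t (cap \<phi> t x))"
    by (rule square_homotopic_apply[OF h])
      (auto simp: case_prod_beta' norm_A intro!: continuous_on_A continuous_intros)
  have "square_homotopic (\<lambda>t. join_loops (join_loops (?F t) (\<lambda>x. A t (h t x))) (h t))
      (\<lambda>t. join_loops (join_loops (?F t) (\<lambda>x. A t (cap \<phi> t x))) (cap \<phi> t))"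
    by (intro square_homotopic_join F Ah h) (simp_all add: hb conj_path_0)
  moreover have "square_homotopic (\<lambda>t. join_loops (?F t) (\<lambda>x. A t (cap \<phi> t x)))
      (\<lambda>t x. A t (conj_path \<phi> t (pi - x * (pi/2 + \<phi>))))"
  proof -
    have "square_homotopic
        (\<lambda>t x. A t (conj_path \<phi> t (join_loops (\<lambda>x. pi * (1 - x)) (\<lambda>x. x * (pi/2 - \<phi>)) x)))
        (\<lambda>t x. A t (conj_path \<phi> t (pi - x * (pi/2 + \<phi>))))"
    proof (rule square_homotopic_reparametrise[where a = 0 and b = pi])
      show "continuous_on ({0..1} \<times> {0..pi}) (\<lambda>(t, x). A t (conj_path \<phi> t x))"
        unfolding case_prod_beta' by (intro continuous_on_A continuous_on_conj_path continuous_intros) auto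
      show "continuous_on {0..1} (join_loops (\<lambda>x. pi * (1 - x)) (\<lambda>x. x * (pi/2 - \<phi>)))"
        by (intro continuous_on_join_loops continuous_intros) simp
      show "join_loops (\<lambda>x. pi * (1 - x)) (\<lambda>x. x * (pi/2 - \<phi>)) x \<in> {0..pi}" if "x \<in> {0..1}" for x
      proof (cases "x \<le> 1/2")
        case True
        then show ?thesis using that by (simp add: join_loops_def mult_left_le)
      next
        case False
        have "(2 * x - 1) * (pi/2 - \<phi>) \<le> 1 * pi"
          using that \<phi> by (intro mult_mono) auto
        then show ?thesis using False \<phi> by (simp add: join_loops_def)
      qed
      show "pi - x * (pi/2 + \<phi>) \<in> {0..pi}" if "x \<in> {0..1}" for x
      proof -
        have "x * (pi/2 + \<phi>) \<le> 1 * pi"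
          using that \<phi> by (intro mult_mono) auto
        then show ?thesis using that \<phi> by simp
      qed
    qed (auto simp: norm_A norm_conj_path conj_path_const intro!: continuous_intros)
    then show ?thesis
      by (rule square_homotopic_cong) (auto simp: join_loops_def cap_def)
  qed
  then have "square_homotopic (\<lambda>t. join_loops (join_loops (?F t) (\<lambda>x. A t (cap \<phi> t x))) (cap \<phi> t))
      (sweep \<phi>)"
    unfolding sweep_def
    by (rule square_homotopic_join)
      (auto simp: cap_ends norm_conj_path conj_path_0 conj_path_return cap_def[abs_def] case_prod_beta'
        intro!: square_homotopic_if_equal continuous_on_conj_path continuous_intros)
  ultimately have "square_homotopic (\<lambda>t. join_loops (join_loops (?F t) (\<lambda>x. A t (h t x))) (h t)) (sweep \<phi>)"
    by (rule square_homotopic_trans)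
  then show ?thesis
    by (simp add: unwinding_def twist_def conj_path_def)
qed

lemma sweep_boundary:
  assumes "t \<in> {0..1}" "x \<in> {0..1}" "t \<in> {0, 1} \<or> x \<in> {0, 1}"
  shows "sweep \<phi> t x = meridian \<phi>"
proof (cases "t \<in> {0, 1}")
  case True
  then show ?thesis
    by (auto simp: sweep_def join_loops_def cap_def conj_path_const)
next
  case False
  then show ?thesis
    using assms by (auto simp: sweep_def cap_ends A_conj_path_pi)
qed

lemma norm_sweep: "t \<in> {0..1} \<Longrightarrow> norm (sweep \<phi> t x) = 1"
  by (simp add: sweep_def join_loops_def norm_A norm_conj_path cap_def)

lemma continuous_on_sweep_family:
  assumes "continuous_on T f" "continuous_on T a" "\<And>z. z \<in> T \<Longrightarrow> a z \<in> {0..1}"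
  shows "continuous_on (T \<times> {0..1}) (\<lambda>(z::'z::t2_space, x). sweep (f z) (a z) x)"
  unfolding sweep_def
proof (rule continuous_on_join_family)
  have f: "continuous_on (T \<times> {0..1::real}) (\<lambda>p. f (fst p))" and a: "continuous_on (T \<times> {0..1::real}) (\<lambda>p. a (fst p))"
    by (intro continuous_on_compose2[OF assms(1)] continuous_on_compose2[OF assms(2)] continuous_intros; auto)+
  show "continuous_on (T \<times> {0..1}) (\<lambda>(z, x). A (a z) (conj_path (f z) (a z) (pi - x * (pi/2 + f z))))"
    unfolding case_prod_beta'
    by (intro continuous_on_A continuous_on_conj_path continuous_intros f a) (use assms(3) in auto)
  show "continuous_on (T \<times> {0..1}) (\<lambda>(z, x). cap (f z) (a z) x)"
    unfolding case_prod_beta' cap_def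
    by (intro continuous_on_conj_path continuous_intros f a) (use assms(3) in auto)
  show "A (a z) (conj_path (f z) (a z) (pi - 1 * (pi/2 + f z))) = cap (f z) (a z) 0" if "z \<in> T" for z
    using conj_path_return[of "f z" "a z"] by (simp add: cap_ends)
qed

text \<open>The latitude is moved to \<open>0\<close>; rotating back at each stage keeps the base point in place.\<close>

lemma sweep_homotopic_equator:
  "square_homotopic (\<lambda>t x. rotY (- \<phi>) (sweep \<phi> t x)) (sweep 0)"
proof (rule square_homotopicI)
  have m: "continuous_on (({0..1::real} \<times> {0..1::real}) \<times> {0..1})
      (\<lambda>(z, x). sweep ((1 - fst z) * \<phi>) (snd z) x)"
    by (rule continuous_on_sweep_family) (auto intro!: continuous_intros)
  have "continuous_on ({0..1::real} \<times> {0..1::real} \<times> {0..1::real})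
      (\<lambda>p. sweep ((1 - fst (fst p, fst (snd p))) * \<phi>) (snd (fst p, fst (snd p))) (snd (snd p)))"
    by (rule continuous_on_compose_two[OF m]) (auto intro!: continuous_intros)
  then show "continuous_on ({0..1} \<times> {0..1} \<times> {0..1})
      (\<lambda>(u, t, x). rotY (- ((1 - u) * \<phi>)) (sweep ((1 - u) * \<phi>) t x))"
    unfolding case_prod_beta' by (intro continuous_intros) simp
qed (auto simp: norm_sweep sweep_boundary rotY_meridian)

end

section \<open>The latitude shift\<close>

definition latitude :: "nat \<Rightarrow> real" where
  "latitude j = pi/2 * (real j / (real j + 1))"

lemma latitude_bounds: "0 \<le> latitude j" "latitude j < pi/2"
proof -
  have "0 \<le> real j / (real j + 1)" "real j / (real j + 1) < 1"
    by (simp_all add: field_simps)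
  then show "0 \<le> latitude j" "latitude j < pi/2"
    using mult_strict_left_mono[of "real j / (real j + 1)" 1 "pi/2"] by (simp_all add: latitude_def)
qed

lemma x_pt_eq_meridian: "x_pt j = meridian (latitude j)"
  by (simp add: x_pt_def spherical_def meridian_def latitude_def)

lemma z0_eq_meridian: "z0 = meridian (pi/2)"
  by (simp add: z0_def meridian_def)

lemma spherical_nth [simp]:
  "spherical \<theta> \<phi> $ 1 = cos \<phi> * cos \<theta>" "spherical \<theta> \<phi> $ 2 = cos \<phi> * sin \<theta>" "spherical \<theta> \<phi> $ 3 = sin \<phi>"
  by (simp_all add: spherical_def)

lemma norm_spherical [simp]: "norm (spherical \<theta> \<phi>) = 1"
proof -
  have "(cos \<phi> * cos \<theta>)\<^sup>2 + (cos \<phi> * sin \<theta>)\<^sup>2 + (sin \<phi>)\<^sup>2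
      = (cos \<phi>)\<^sup>2 * ((sin \<theta>)\<^sup>2 + (cos \<theta>)\<^sup>2) + (sin \<phi>)\<^sup>2"
    by algebra
  then show ?thesis
    by (simp add: norm_vec3)
qed

lemma sphere_spherical:
  assumes "norm p = 1"
  obtains \<theta> \<phi> where "\<theta> \<in> {0..<2*pi}" "\<phi> \<in> {-pi/2..pi/2}" "p = spherical \<theta> \<phi>"
proof -
  have n: "(p$1)\<^sup>2 + (p$2)\<^sup>2 + (p$3)\<^sup>2 = 1"
    using assms by (simp add: norm_vec3)
  then have "(p$3)\<^sup>2 \<le> 1"
    using zero_le_power2[of "p$1"] zero_le_power2[of "p$2"] by linarith
  then have p3: "-1 \<le> p$3" "p$3 \<le> 1"
    by (simp_all add: abs_square_le_1 abs_le_iff)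
  define \<phi> where "\<phi> = arcsin (p$3)"
  have \<phi>: "\<phi> \<in> {-pi/2..pi/2}" "sin \<phi> = p$3"
    using p3 arcsin_bounded[of "p$3"] by (auto simp: \<phi>_def)
  have c0: "cos \<phi> \<ge> 0"
    using \<phi>(1) by (intro cos_ge_zero) auto
  have c2: "(cos \<phi>)\<^sup>2 = (p$1)\<^sup>2 + (p$2)\<^sup>2"
    using n \<phi>(2) sin_cos_squared_add[of \<phi>] by simp
  show ?thesis
  proof (cases "cos \<phi> = 0")
    case True
    then have "p$1 = 0" "p$2 = 0"
      using c2 by (simp_all add: sum_power2_eq_zero_iff)
    then show ?thesis
      using True \<phi> by (intro that[of 0 \<phi>]) (auto simp: vec3_eq_iff)
  next
    case False
    have "(p$1 / cos \<phi>)\<^sup>2 + (p$2 / cos \<phi>)\<^sup>2 = ((p$1)\<^sup>2 + (p$2)\<^sup>2) / (cos \<phi>)\<^sup>2"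
      by (simp add: power_divide add_divide_distrib)
    then have "(p$1 / cos \<phi>)\<^sup>2 + (p$2 / cos \<phi>)\<^sup>2 = 1"
      unfolding c2[symmetric] using False by simp
    then obtain \<theta> where "0 \<le> \<theta>" "\<theta> < 2*pi" "p$1 / cos \<phi> = cos \<theta>" "p$2 / cos \<phi> = sin \<theta>"
      by (rule sincos_total_2pi)
    then show ?thesis
      using False \<phi> by (intro that[of \<theta> \<phi>]) (auto simp: vec3_eq_iff field_simps)
  qed
qed

lemma shift_latitude_0: "shift_latitude j 0 = latitude j"
  by (simp add: shift_latitude_def latitude_def)

lemma shift_latitude_bounds:
  assumes "\<phi> \<in> {-pi/2..pi/2}"
  shows "\<phi> \<le> shift_latitude j \<phi>" "shift_latitude j \<phi> \<le> \<phi> + latitude j" "shift_latitude j \<phi> \<le> pi/2"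
    and "\<phi> < pi/2 \<Longrightarrow> shift_latitude j \<phi> < pi/2"
proof -
  define k where "k = real j / (real j + 1)"
  have k: "0 \<le> k" "k < 1"
    by (simp_all add: k_def field_simps)
  define d where "d = (if \<phi> \<ge> 0 then pi/2 - \<phi> else pi/2 + \<phi>)"
  have d: "0 \<le> d" "d \<le> pi/2" "d \<le> pi/2 - \<phi>"
    using assms by (auto simp: d_def)
  have s: "shift_latitude j \<phi> = \<phi> + d * k"
    by (simp add: shift_latitude_def d_def k_def)
  have dk: "0 \<le> d * k" "d * k \<le> d"
    using d k by (simp_all add: mult_left_le)
  have dk': "d * k \<le> pi/2 * k"
    using d k by (intro mult_right_mono)
  show "\<phi> \<le> shift_latitude j \<phi>" "shift_latitude j \<phi> \<le> \<phi> + latitude j" "shift_latitude j \<phi> \<le> pi/2"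
    using dk dk' d unfolding s latitude_def k_def[symmetric] by linarith+
  assume \<phi>: "\<phi> < pi/2"
  show "shift_latitude j \<phi> < pi/2"
  proof (cases "d = 0")
    case True
    then show ?thesis using \<phi> by (simp add: s)
  next
    case False
    then have "d * k < d * 1" using d(1) k by (intro mult_strict_left_mono) auto
    then show ?thesis using d(3) unfolding s by linarith
  qed
qed

lemma norm_J_map:
  assumes "norm p = 1"
  shows "norm (J_map j p) = 1"
proof -
  obtain \<theta> \<phi> where "\<theta> \<in> {0..<2*pi}" "\<phi> \<in> {-pi/2..pi/2}" "p = spherical \<theta> \<phi>"
    using sphere_spherical[OF assms] .
  then show ?thesis by (simp add: J_map_spherical)
qed

text \<open>Spherical coordinates present the sphere as a quotient of a rectangle, and the shift is
  continuous in these coordinates; this takes care of the poles.\<close>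

lemma continuous_on_J_map: "continuous_on (sphere 0 1) (J_map j)"
proof -
  let ?D = "{0..2*pi} \<times> {-pi/2..pi/2}"
  let ?f = "\<lambda>(\<theta>, \<phi>). spherical \<theta> \<phi>"
  have cs: "continuous_on T (\<lambda>z. spherical (a z) (b z))" if "continuous_on T a" "continuous_on T b"
    for T :: "(real \<times> real) set" and a b
    unfolding spherical_def by (intro continuous_intros that)
  have f: "continuous_map (top_of_set ?D) (top_of_set (sphere 0 1)) ?f"
    unfolding case_prod_beta' by (auto intro!: cs continuous_intros)
  have surj: "?f ` ?D = sphere 0 1"
  proof
    show "sphere 0 1 \<subseteq> ?f ` ?D"
    proof
      fix p :: "real^3" assume "p \<in> sphere 0 1"
      then obtain \<theta> \<phi> where "\<theta> \<in> {0..<2*pi}" "\<phi> \<in> {-pi/2..pi/2}" "p = spherical \<theta> \<phi>"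
        using sphere_spherical[of p] by auto
      then show "p \<in> ?f ` ?D" by (intro image_eqI[of _ _ "(\<theta>, \<phi>)"]) auto
    qed
  qed auto
  have quot: "quotient_map (top_of_set ?D) (top_of_set (sphere 0 1)) ?f"
  proof (rule continuous_imp_quotient_map[OF f])
    show "compact_space (top_of_set ?D)"
      by (simp add: compact_space_subtopology compact_Times)
    show "Hausdorff_space (top_of_set (sphere (0::real^3) 1))"
      by (simp add: Hausdorff_space_subtopology)
  qed (use surj in simp)
  have shift: "shift_latitude j \<phi> = \<phi> + (pi/2 - \<bar>\<phi>\<bar>) * (real j / (real j + 1))" for \<phi>
    by (simp add: shift_latitude_def)
  have eq: "J_map j (spherical \<theta> \<phi>) = spherical \<theta> (shift_latitude j \<phi>)"
    if "(\<theta>, \<phi>) \<in> ?D" for \<theta> \<phi>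
  proof (cases "\<theta> = 2*pi")
    case True
    have "spherical (2*pi) a = spherical 0 a" for a
      by (simp add: vec3_eq_iff)
    then show ?thesis
      using J_map_spherical[of 0 \<phi> j] that True by simp
  qed (use that in \<open>simp add: J_map_spherical\<close>)
  have "continuous_on ?D (\<lambda>z. spherical (fst z) (shift_latitude j (snd z)))"
    unfolding shift by (intro cs continuous_intros)
  then have "continuous_on ?D (J_map j \<circ> ?f)"
    by (rule continuous_on_eq) (auto simp: eq)
  then have "continuous_map (top_of_set ?D) euclidean (J_map j \<circ> ?f)"
    by simp
  from continuous_compose_quotient_map[OF quot this] show ?thesis
    by simp
qed

lemma J_map_signs:
  assumes "norm p = 1"
  shows "p$2 < 0 \<Longrightarrow> J_map j p $ 2 < 0" "p$2 > 0 \<Longrightarrow> J_map j p $ 2 > 0"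
    and "p$3 > 0 \<Longrightarrow> J_map j p $ 3 > 0"
    and "p$3 = 0 \<Longrightarrow> J_map j p = rotZ (p$1) (p$2) (meridian (latitude j))"
proof -
  obtain \<theta> \<phi> where tp: "\<theta> \<in> {0..<2*pi}" "\<phi> \<in> {-pi/2..pi/2}" and p: "p = spherical \<theta> \<phi>"
    using sphere_spherical[OF assms] .
  have J: "J_map j p = spherical \<theta> (shift_latitude j \<phi>)"
    unfolding p by (rule J_map_spherical[OF tp])
  then have J2: "J_map j p $ 2 = cos (shift_latitude j \<phi>) * sin \<theta>" and p2: "p$2 = cos \<phi> * sin \<theta>"
    by (simp_all add: p)
  note b = shift_latitude_bounds[OF tp(2), of j]
  have pos: "cos \<phi> > 0 \<and> cos (shift_latitude j \<phi>) > 0" if "cos \<phi> \<noteq> 0"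
  proof -
    have "\<phi> \<noteq> pi/2" "\<phi> \<noteq> - (pi/2)"
      using that cos_pi_half by (metis, metis cos_minus)
    then have "- (pi/2) < \<phi>" "\<phi> < pi/2"
      using tp(2) by auto
    then show ?thesis
      using b by (intro conjI cos_gt_zero_pi) auto
  qed
  show "J_map j p $ 2 < 0" if "p$2 < 0"
    using pos that unfolding J2 p2 by (cases "cos \<phi> = 0") (auto simp: mult_less_0_iff)
  show "J_map j p $ 2 > 0" if "p$2 > 0"
    using pos that unfolding J2 p2 by (cases "cos \<phi> = 0") (auto simp: zero_less_mult_iff)
  show "J_map j p $ 3 > 0" if "p$3 > 0"
  proof -
    have "\<phi> > 0"
    proof (rule ccontr)
      assume "\<not> \<phi> > 0"
      then have "sin (- \<phi>) \<ge> 0" using tp(2) by (intro sin_ge_zero) auto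
      then show False using that p by simp
    qed
    then have "0 < shift_latitude j \<phi>" "shift_latitude j \<phi> < pi"
      using b pi_gt_zero by linarith+
    then show ?thesis
      unfolding J by (simp add: sin_gt_zero)
  qed
  show "J_map j p = rotZ (p$1) (p$2) (meridian (latitude j))" if "p$3 = 0"
  proof -
    have "\<phi> = 0"
      using that p tp(2) sin_eq_0_pi[of \<phi>] pi_gt_zero by auto
    then show ?thesis
      unfolding J by (simp add: p vec3_eq_iff shift_latitude_0)
  qed
qed

text \<open>On the great circle \<open>y = 0\<close> the shift moves points by less than a half turn when compared
  with the rotation that has the same effect on the base point.\<close>

lemma J_map_nonantipodal_rotation:
  assumes "norm p = 1" "p$2 = 0"
  shows "J_map j p \<noteq> - rotY (latitude j) p"
proof
  assume eq: "J_map j p = - rotY (latitude j) p"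
  obtain \<theta> \<phi> where tp: "\<theta> \<in> {0..<2*pi}" "\<phi> \<in> {-pi/2..pi/2}" and p: "p = spherical \<theta> \<phi>"
    using sphere_spherical[OF assms(1)] .
  define \<phi>' where "\<phi>' = shift_latitude j \<phi>"
  have J: "J_map j p = spherical \<theta> \<phi>'"
    unfolding p \<phi>'_def by (rule J_map_spherical[OF tp])
  note b = shift_latitude_bounds[OF tp(2), of j, folded \<phi>'_def]
  note l = latitude_bounds[of j]
  have no: "meridian a \<noteq> - meridian b" if "\<bar>a - b\<bar> < pi" for a b
  proof
    assume m: "meridian a = - meridian b"
    then have "cos a = - cos b" "sin a = - sin b"
      by (simp_all add: vec3_eq_iff)
    then have "cos a * cos b + sin a * sin b = - ((cos b)\<^sup>2 + (sin b)\<^sup>2)"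
      by algebra
    with cos_diff[of a b] have "cos (a - b) = - ((cos b)\<^sup>2 + (sin b)\<^sup>2)"
      by simp
    then have "cos \<bar>a - b\<bar> = cos pi" by simp
    moreover have "cos pi < cos \<bar>a - b\<bar>"
      using that by (intro cos_monotone_0_pi) auto
    ultimately show False by simp
  qed
  have "cos \<phi> = 0 \<or> sin \<theta> = 0"
    using assms(2) p by simp
  then consider "cos \<phi> = 0" | "\<theta> = 0" | "\<theta> = pi"
  proof
    assume "sin \<theta> = 0"
    then have "\<theta> = 0 \<or> \<theta> = pi"
      using tp(1) sin_eq_0_pi[of "\<theta> - pi"] by (cases "0 < \<theta>") (auto simp: sin_diff)
    then show ?thesis using that by blast
  qed (use that in blast)
  then show False
  proof cases
    case 1
    then have "\<phi> = pi/2 \<or> \<phi> = - (pi/2)"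
      using tp(2) cos_gt_zero_pi[of \<phi>] by fastforce
    then have "0 \<le> \<phi> \<and> pi/2 - \<phi> = 0 \<or> \<not> 0 \<le> \<phi> \<and> pi/2 + \<phi> = 0"
      using pi_gt_zero by linarith
    then have "\<phi>' = \<phi>"
      by (auto simp: \<phi>'_def shift_latitude_def)
    then have "sin \<phi> = - (cos (latitude j) * sin \<phi>)"
      using arg_cong[OF eq, of "\<lambda>v. v $ 3"] 1 unfolding J by (simp add: p)
    moreover have "sin \<phi> \<noteq> 0"
      using 1 sin_zero_abs_cos_one by fastforce
    moreover have "cos (latitude j) > 0"
      using l by (intro cos_gt_zero_pi) auto
    ultimately show False
      by (metis add.inverse_inverse less_irrefl mult_minus_left mult_cancel_right2 neg_less_0_iff_less zero_less_one less_trans)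
  next
    case 2
    have "meridian \<phi>' = J_map j p"
      unfolding J 2 by (simp add: vec3_eq_iff)
    moreover have "rotY (latitude j) p = meridian (latitude j + \<phi>)"
      unfolding p 2 by (simp add: vec3_eq_iff cos_add sin_add)
    ultimately show False
      using eq no[of \<phi>' "latitude j + \<phi>"] b l by (simp add: abs_less_iff)
  next
    case 3
    have "meridian (pi - \<phi>') = J_map j p"
      unfolding J 3 by (simp add: vec3_eq_iff)
    moreover have "rotY (latitude j) p = meridian (pi - \<phi> + latitude j)"
      unfolding p 3 by (simp add: vec3_eq_iff cos_add sin_add cos_diff sin_diff algebra_simps)
    ultimately show False
      using eq no[of "pi - \<phi>'" "pi - \<phi> + latitude j"] b l by (simp add: abs_less_iff)
  qed
qed

section \<open>The circle family\<close>

lemma x_pt_0_nth: "x_pt 0 $ 1 = 1" "x_pt 0 $ 2 = 0" "x_pt 0 $ 3 = 0"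
  by (simp_all add: x_pt_def)

lemma meridian_0: "meridian 0 = x_pt 0"
  by (simp add: x_pt_eq_meridian latitude_def)

text \<open>The facts extracted here from the definition of a circle family are those on which the comparison
  rests: end points, signs and the two symmetries.\<close>

locale circles =
  fixes \<omega> :: "real \<Rightarrow> real \<Rightarrow> real^3"
  assumes circle_family: "circle_family \<omega>"
begin

lemma continuous_on_circles: "continuous_on ({0..1} \<times> {0..1}) (\<lambda>(t, r). \<omega> t r)"
  using circle_family by (simp add: circle_family_def)

lemma circle_image: "t \<in> {0..1} \<Longrightarrow> path_image (\<omega> t) = sphere 0 1 \<inter> plane_at t"
  using circle_family unfolding circle_family_def by blast

lemma circle_mem: "t \<in> {0..1} \<Longrightarrow> r \<in> {0..1} \<Longrightarrow> \<omega> t r \<in> sphere 0 1 \<inter> plane_at t"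
  unfolding circle_image[symmetric] path_image_def by (rule imageI)

lemma norm_circle: "t \<in> {0..1} \<Longrightarrow> r \<in> {0..1} \<Longrightarrow> norm (\<omega> t r) = 1"
  using circle_mem by fastforce

lemma circle_ends: "t \<in> {0..1} \<Longrightarrow> \<omega> t 0 = x_pt 0" "t \<in> {0..1} \<Longrightarrow> \<omega> t 1 = x_pt 0"
  using circle_family unfolding circle_family_def pathstart_def pathfinish_def by blast+

lemma circle_y:
  "t \<in> {0<..<1/2} \<Longrightarrow> r \<in> {0<..<1} \<Longrightarrow> \<omega> t r $ 2 < 0"
  "t \<in> {1/2<..<1} \<Longrightarrow> r \<in> {0<..<1} \<Longrightarrow> \<omega> t r $ 2 > 0"
  using circle_family unfolding circle_family_def by blast+

lemma circle_z:
  "t \<in> {0<..<1} \<Longrightarrow> r \<in> {0<..<1/2} \<Longrightarrow> \<omega> t r $ 3 < 0"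
  "t \<in> {0<..<1} \<Longrightarrow> r \<in> {1/2<..<1} \<Longrightarrow> \<omega> t r $ 3 > 0"
  using circle_family unfolding circle_family_def by blast+

lemma circle_reverse:
  "t \<in> {0..1} \<Longrightarrow> r \<in> {0..1} \<Longrightarrow> \<omega> t r $ 3 = - (\<omega> t (1 - r) $ 3)"
  using circle_family unfolding circle_family_def by blast

lemma circle_mirror:
  "t \<in> {0..1} \<Longrightarrow> r \<in> {0..1} \<Longrightarrow> \<omega> t r $ 2 = - (\<omega> (1 - t) r $ 2)"
  "t \<in> {0..1} \<Longrightarrow> r \<in> {0..1} \<Longrightarrow> \<omega> t r $ 1 = \<omega> (1 - t) r $ 1"
  "t \<in> {0..1} \<Longrightarrow> r \<in> {0..1} \<Longrightarrow> \<omega> t r $ 3 = \<omega> (1 - t) r $ 3"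
  using circle_family unfolding circle_family_def by blast+

lemma circle_half_y: "r \<in> {0..1} \<Longrightarrow> \<omega> (1/2) r $ 2 = 0"
  using circle_mirror(1)[of "1/2" r] by simp

lemma circle_half_z: "t \<in> {0..1} \<Longrightarrow> \<omega> t (1/2) $ 3 = 0"
  using circle_reverse[of t "1/2"] by simp

text \<open>The tangent plane meets the sphere in the base point only.\<close>

lemma circle_const:
  assumes "t \<in> {0, 1}" "r \<in> {0..1}"
  shows "\<omega> t r = x_pt 0"
proof -
  have 0: "\<omega> 0 r = x_pt 0"
  proof -
    have "norm (\<omega> 0 r) = 1" and m: "\<omega> 0 r \<in> plane_at 0"
      using circle_mem[of 0 r] assms(2) by auto
    have "\<omega> 0 r $ 1 = 1"
      using m by (auto simp: plane_at_def rotate_D_def inner_vec_def sum_3 x_pt_0_nth)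
    moreover have "(\<omega> 0 r $ 1)\<^sup>2 + (\<omega> 0 r $ 2)\<^sup>2 + (\<omega> 0 r $ 3)\<^sup>2 = 1"
      using \<open>norm (\<omega> 0 r) = 1\<close> by (simp add: norm_vec3)
    ultimately have "(\<omega> 0 r $ 2)\<^sup>2 + (\<omega> 0 r $ 3)\<^sup>2 = 0"
      by simp
    then have "\<omega> 0 r $ 2 = 0" "\<omega> 0 r $ 3 = 0"
      by (simp_all add: sum_power2_eq_zero_iff)
    with \<open>\<omega> 0 r $ 1 = 1\<close> show ?thesis
      by (simp add: vec3_eq_iff x_pt_0_nth)
  qed
  show ?thesis
  proof (cases "t = 0")
    case False
    then have "t = 1" using assms by simp
    then show ?thesis
      using circle_mirror[of 1 r] assms(2) 0 by (simp add: vec3_eq_iff x_pt_0_nth)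
  qed (simp add: 0)
qed

sublocale rotation_loop "\<lambda>t. \<omega> t (1/2) $ 1" "\<lambda>t. \<omega> t (1/2) $ 2"
proof
  have "continuous_on {0..1} (\<lambda>t. \<omega> t (1/2))"
    by (intro continuous_on_compose_two[OF continuous_on_circles] continuous_intros) auto
  then show "continuous_on {0..1} (\<lambda>t. \<omega> t (1/2) $ 1)" "continuous_on {0..1} (\<lambda>t. \<omega> t (1/2) $ 2)"
    by (intro continuous_intros; simp)+
  show "(\<omega> t (1/2) $ 1)\<^sup>2 + (\<omega> t (1/2) $ 2)\<^sup>2 = 1" if "t \<in> {0..1}" for t
    using norm_circle[OF that, of "1/2"] circle_half_z[OF that] by (simp add: norm_vec3)
qed (simp_all add: circle_const x_pt_0_nth)

lemma A_equator:
  assumes "t \<in> {0..1}"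
  shows "A t (meridian 0) = \<omega> t (1/2)"
  using circle_half_z[OF assms] by (simp add: A_def vec3_eq_iff)

lemma y_pos_if_interior:
  assumes "t \<in> {0<..<1}" "t \<noteq> 1/2" "r \<in> {0<..<1}"
  shows "\<omega> t (1/2) $ 2 * \<omega> t r $ 2 > 0"
proof (cases "t < 1/2")
  case True
  then show ?thesis
    using circle_y(1)[of t r] circle_y(1)[of t "1/2"] assms by (simp add: mult_neg_neg)
next
  case False
  then show ?thesis
    using circle_y(2)[of t r] circle_y(2)[of t "1/2"] assms by simp
qed

lemma cos_le_1: "t \<in> {0..1} \<Longrightarrow> \<omega> t (1/2) $ 1 \<le> 1"
  using component_le_norm_cart[of "\<omega> t (1/2)" 1] norm_circle[of t "1/2"] by auto

text \<open>At latitude \<open>0\<close> the sweep lies in the lower hemisphere for the first half of its parameter and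
  in the upper one for the second half, and on the same side of the plane \<open>y = 0\<close> as the midpoint of
  the circle. For the
  first half the latter is due to the factorisation of the second coordinate into \<open>s t\<close> and the
  nonnegative \<open>(1 + cos \<beta>) (1 + cos \<beta> (c t - 1))\<close>, where \<open>c t\<close> and \<open>s t\<close> are the first two coordinates of
  the midpoint.\<close>

lemma sweep_equator_signs:
  assumes t: "t \<in> {0..1}" and x: "x \<in> {0..1}"
  shows "\<omega> t (1/2) $ 2 * sweep 0 t x $ 2 \<ge> 0"
    and "x \<le> 1/2 \<Longrightarrow> sweep 0 t x $ 3 \<le> 0" and "x > 1/2 \<Longrightarrow> sweep 0 t x $ 3 \<ge> 0"
proof -
  define a where "a = \<omega> t (1/2) $ 1"
  define b where "b = \<omega> t (1/2) $ 2"
  have a: "a \<le> 1"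
    unfolding a_def by (rule cos_le_1[OF t])
  have first: "b * sweep 0 t x $ 2 \<ge> 0 \<and> sweep 0 t x $ 3 \<le> 0" if "x \<le> 1/2"
  proof -
    define \<beta> where "\<beta> = pi - 2 * x * (pi/2)"
    have \<beta>: "pi/2 \<le> \<beta>" "\<beta> \<le> pi"
      using that x by (auto simp: \<beta>_def)
    have C: "cos \<beta> \<le> 0" "-1 \<le> cos \<beta>" and S: "sin \<beta> \<ge> 0"
      using \<beta> cos_monotone_0_pi_le[of "pi/2" \<beta>] by (auto intro: sin_ge_zero)
    have eq: "sweep 0 t x = A t (conj_path 0 t \<beta>)"
      using that by (simp add: sweep_def join_loops_def \<beta>_def)
    have s2: "(sin \<beta>)\<^sup>2 = 1 - (cos \<beta>)\<^sup>2" by (simp add: sin_squared_eq)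
    have "sweep 0 t x $ 2 = b * (cos \<beta> * (a * cos \<beta>) + (sin \<beta>)\<^sup>2) + a * (b * cos \<beta>)"
      by (simp add: eq A_def conj_path_nth a_def b_def power2_eq_square)
    also have "\<dots> = b * ((1 + cos \<beta>) * (1 + cos \<beta> * (a - 1)))"
      unfolding s2 by algebra
    finally have y: "b * sweep 0 t x $ 2 = (b * b) * ((1 + cos \<beta>) * (1 + cos \<beta> * (a - 1)))"
      by simp
    have "cos \<beta> * (a - 1) \<ge> 0"
      using C a by (simp add: mult_nonpos_nonpos)
    moreover have "0 \<le> 1 + cos \<beta>"
      using C(2) by linarith
    ultimately have "(1 + cos \<beta>) * (1 + cos \<beta> * (a - 1)) \<ge> 0"
      by simp
    then have "(b * b) * ((1 + cos \<beta>) * (1 + cos \<beta> * (a - 1))) \<ge> 0"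
      by (rule mult_nonneg_nonneg[OF zero_le_square])
    then have "b * sweep 0 t x $ 2 \<ge> 0"
      by (simp only: y)
    moreover have "sweep 0 t x $ 3 = cos \<beta> * (sin \<beta> * (1 - a))"
      by (simp add: eq A_def conj_path_nth a_def algebra_simps)
    then have "sweep 0 t x $ 3 \<le> 0"
      using C S a by (simp add: mult_nonpos_nonneg)
    ultimately show ?thesis by simp
  qed
  have second: "b * sweep 0 t x $ 2 \<ge> 0 \<and> sweep 0 t x $ 3 \<ge> 0" if "x > 1/2"
  proof -
    define \<beta> where "\<beta> = (2 * x - 1) * (pi/2)"
    have "(2 * x - 1) * (pi/2) \<le> 1 * (pi/2)"
      using x by (intro mult_right_mono) auto
    then have \<beta>: "0 \<le> \<beta>" "\<beta> \<le> pi/2"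
      using that by (auto simp: \<beta>_def)
    have C: "cos \<beta> \<ge> 0" and S: "sin \<beta> \<ge> 0"
      using \<beta> by (auto intro: cos_ge_zero sin_ge_zero)
    have eq: "sweep 0 t x = conj_path 0 t \<beta>"
      using that by (simp add: sweep_def join_loops_def cap_def \<beta>_def)
    have "sweep 0 t x $ 2 = b * cos \<beta>" "sweep 0 t x $ 3 = cos \<beta> * (sin \<beta> * (1 - a))"
      by (simp_all add: eq conj_path_nth a_def b_def algebra_simps)
    moreover have "b * (b * cos \<beta>) \<ge> 0"
      using mult_nonneg_nonneg[OF zero_le_square C, of b] by (simp only: mult.assoc)
    ultimately show ?thesis
      using C S a by simp
  qed
  show "\<omega> t (1/2) $ 2 * sweep 0 t x $ 2 \<ge> 0"
    using first second unfolding b_def by (cases "x \<le> 1/2") auto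
  show "x \<le> 1/2 \<Longrightarrow> sweep 0 t x $ 3 \<le> 0" "x > 1/2 \<Longrightarrow> sweep 0 t x $ 3 \<ge> 0"
    using first second by auto
qed

lemma continuous_on_sweep: "continuous_on ({0..1} \<times> {0..1}) (\<lambda>(t, x). sweep \<phi> t x)"
  by (rule continuous_on_sweep_family[where f = "\<lambda>_. \<phi>" and a = "\<lambda>t. t"]) (auto intro!: continuous_intros)

text \<open>At an interior point other than the centre of the square, the circle has a nonzero second or third coordinate
  to which the corresponding coordinate of the sweep is not opposite in sign. At the centre the two
  points coincide.\<close>

lemma sweep_equator_homotopic_circles: "square_homotopic (sweep 0) \<omega>"
proof (rule square_homotopic_nonantipodal[OF continuous_on_sweep _ continuous_on_circles norm_circle])
  show "sweep 0 t x = \<omega> t x" if "t \<in> {0..1}" "x \<in> {0..1}" "t \<in> {0, 1} \<or> x \<in> {0, 1}" for t x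
    using sweep_boundary[OF that, of 0] that circle_ends circle_const by (auto simp: meridian_0)
  show "sweep 0 t x \<noteq> - \<omega> t x" if t: "t \<in> {0<..<1}" and x: "x \<in> {0<..<1}" for t x
  proof
    assume eq: "sweep 0 t x = - \<omega> t x"
    have t': "t \<in> {0..1}" and x': "x \<in> {0..1}" using t x by auto
    note signs = sweep_equator_signs[OF t' x']
    show False
    proof (cases "t = 1/2")
      case False
      then show False
        using y_pos_if_interior[OF t False x] signs(1) eq by simp
    next
      case True
      show False
      proof (cases x "1/2 :: real" rule: linorder_cases)
        case less
        then show False using circle_z(1)[OF t, of x] x signs(2) eq by simp
      next
        case greater
        then show False using circle_z(2)[OF t, of x] x signs(3) eq by simp
      next
        case equal
        have "sweep 0 t x = \<omega> t x"
          using A_equator[OF t'] conj_path_return[of 0 t] by (simp add: equal sweep_def join_loops_def)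
        then have "\<omega> t x = 0" using eq by (simp add: vec_eq_iff)
        then show False using norm_circle[OF t' x'] by simp
      qed
    qed
  qed
qed (auto simp: norm_sweep)

lemma sweep_homotopic_rotated_circles: "square_homotopic (sweep \<phi>) (\<lambda>t r. rotY \<phi> (\<omega> t r))"
proof -
  have "square_homotopic (\<lambda>t x. rotY (- \<phi>) (sweep \<phi> t x)) \<omega>"
    by (rule square_homotopic_trans[OF sweep_homotopic_equator sweep_equator_homotopic_circles])
  then have "square_homotopic (\<lambda>t x. rotY \<phi> (rotY (- \<phi>) (sweep \<phi> t x))) (\<lambda>t r. rotY \<phi> (\<omega> t r))"
    by (rule square_homotopic_apply[where f = "\<lambda>_. rotY \<phi>"])
      (auto simp: case_prod_beta' intro!: continuous_intros)
  then show ?thesis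
    by (simp add: rotY_rotY)
qed

lemma continuous_on_loop_x: "continuous_on ({0..1} \<times> {0..1}) (\<lambda>(t, r). loop_x \<omega> j t r)"
proof -
  have "continuous_on ({0..1} \<times> {0..1}) (\<lambda>p. J_map j ((\<lambda>(t, r). \<omega> t r) p))"
    by (rule continuous_on_compose2[OF continuous_on_J_map continuous_on_circles])
      (auto simp: norm_circle)
  then show ?thesis
    by (simp add: loop_x_def case_prod_beta')
qed

lemma norm_loop_x: "t \<in> {0..1} \<Longrightarrow> r \<in> {0..1} \<Longrightarrow> norm (loop_x \<omega> j t r) = 1"
  by (simp add: loop_x_def norm_J_map norm_circle)

lemma J_map_base: "J_map j (x_pt 0) = meridian (latitude j)"
  using J_map_signs(4)[of "x_pt 0" j] norm_meridian[of 0]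
  by (simp add: x_pt_0_nth meridian_0)

lemma loop_x_boundary:
  assumes "t \<in> {0..1}" "r \<in> {0..1}" "t \<in> {0, 1} \<or> r \<in> {0, 1}"
  shows "loop_x \<omega> j t r = meridian (latitude j)"
  using assms circle_ends circle_const by (auto simp: loop_x_def J_map_base)

lemma loop_x_middle:
  assumes "t \<in> {0..1}"
  shows "loop_x \<omega> j t (1/2) = A t (meridian (latitude j))"
  using J_map_signs(4)[OF norm_circle[OF assms] circle_half_z[OF assms]]
  by (simp add: loop_x_def A_def)

text \<open>Both maps preserve the sign of \<open>y\<close>, so an antipodal pair can only occur on the great circle \<open>t = 1/2\<close>.\<close>

lemma rotated_circles_homotopic_loop_x:
  "square_homotopic (\<lambda>t r. rotY (latitude j) (\<omega> t r)) (loop_x \<omega> j)"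
proof (rule square_homotopic_nonantipodal[OF _ _ continuous_on_loop_x norm_loop_x])
  show "continuous_on ({0..1} \<times> {0..1}) (\<lambda>(t, r). rotY (latitude j) (\<omega> t r))"
    using continuous_on_circles unfolding case_prod_beta' by (intro continuous_intros)
  show "rotY (latitude j) (\<omega> t r) = loop_x \<omega> j t r"
    if "t \<in> {0..1}" "r \<in> {0..1}" "t \<in> {0, 1} \<or> r \<in> {0, 1}" for t r
    using that circle_ends circle_const loop_x_boundary[OF that, of j]
    by (auto simp: rotY_meridian simp flip: meridian_0)
  show "rotY (latitude j) (\<omega> t r) \<noteq> - loop_x \<omega> j t r" if t: "t \<in> {0<..<1}" and r: "r \<in> {0<..<1}" for t r
  proof
    assume eq: "rotY (latitude j) (\<omega> t r) = - loop_x \<omega> j t r"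
    have n: "norm (\<omega> t r) = 1" using t r by (intro norm_circle) auto
    consider "t < 1/2" | "t > 1/2" | "t = 1/2" by linarith
    then show False
    proof cases
      case 1
      then have "\<omega> t r $ 2 < 0" using circle_y(1)[of t r] t r by simp
      with J_map_signs(1)[OF n this, of j] show False
        using arg_cong[OF eq, of "\<lambda>p. p $ 2"] by (simp add: loop_x_def)
    next
      case 2
      then have "\<omega> t r $ 2 > 0" using circle_y(2)[of t r] t r by simp
      with J_map_signs(2)[OF n this, of j] show False
        using arg_cong[OF eq, of "\<lambda>p. p $ 2"] by (simp add: loop_x_def)
    next
      case 3
      have "\<omega> t r $ 2 = 0" unfolding 3 by (rule circle_half_y) (use r in simp)
      from J_map_nonantipodal_rotation[OF n this, of j] eq show False
        by (simp add: loop_x_def)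
    qed
  qed
qed (simp_all add: norm_circle)

text \<open>Off the great circle \<open>t = 1/2\<close> the two paths are on the same side of the plane \<open>y = 0\<close>; on it,
  both are in the upper hemisphere.\<close>

lemma half_loop_homotopic_cap: "square_homotopic (half_loop \<omega> j) (cap (latitude j))"
proof (rule square_homotopic_nonantipodal[OF _ _ continuous_on_cap])
  note l = latitude_bounds[of j]
  show "continuous_on ({0..1} \<times> {0..1}) (\<lambda>(t, r). half_loop \<omega> j t r)"
    unfolding half_loop_def case_prod_beta'
    by (intro continuous_on_compose_two[OF continuous_on_loop_x] continuous_intros) auto
  show "norm (half_loop \<omega> j t r) = 1" if "t \<in> {0..1}" "r \<in> {0..1}" for t r
    using that by (simp add: half_loop_def norm_loop_x)
  show "norm (cap (latitude j) t r) = 1" if "t \<in> {0..1}" for t r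
    using that by (simp add: cap_def norm_conj_path)
  show "half_loop \<omega> j t r = cap (latitude j) t r"
    if tr: "t \<in> {0..1}" "r \<in> {0..1}" and b: "t \<in> {0, 1} \<or> r \<in> {0, 1}" for t r
  proof (cases "t \<in> {0, 1}")
    case True
    then show ?thesis
      using loop_x_boundary[of t "(1 + r)/2" j] tr by (simp add: half_loop_def cap_def conj_path_const)
  next
    case False
    then have "r = 0 \<or> r = 1" using b by blast
    then show ?thesis
      using loop_x_boundary[of t 1 j] loop_x_middle[of t j] tr
      by (auto simp: half_loop_def cap_ends)
  qed
  show "half_loop \<omega> j t r \<noteq> - cap (latitude j) t r" if t: "t \<in> {0<..<1}" and r: "r \<in> {0<..<1}" for t r
  proof
    assume eq: "half_loop \<omega> j t r = - cap (latitude j) t r"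
    define p where "p = \<omega> t ((1 + r)/2)"
    have n: "norm p = 1" unfolding p_def using t r by (intro norm_circle) auto
    have hp: "half_loop \<omega> j t r = J_map j p" by (simp add: half_loop_def loop_x_def p_def)
    define \<beta> where "\<beta> = r * (pi/2 - latitude j)"
    have "\<beta> \<le> pi/2 - latitude j" "0 \<le> \<beta>"
      unfolding \<beta>_def using r l by (simp_all add: mult_left_le_one_le)
    then have \<beta>: "0 \<le> \<beta>" "\<beta> + latitude j \<le> pi/2"
      by simp_all
    have C: "cos (\<beta> + latitude j) \<ge> 0"
      using \<beta> l by (intro cos_ge_zero) auto
    show False
    proof (cases "t = 1/2")
      case False
      have "\<omega> t (1/2) $ 2 * p $ 2 > 0"
        unfolding p_def using t r False by (intro y_pos_if_interior) auto
      then have "\<omega> t (1/2) $ 2 * J_map j p $ 2 > 0"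
        using J_map_signs(1,2)[OF n, of j] by (auto simp: zero_less_mult_iff)
      moreover have "\<omega> t (1/2) $ 2 * cap (latitude j) t r $ 2 = (\<omega> t (1/2) $ 2)\<^sup>2 * cos (\<beta> + latitude j)"
        by (simp add: cap_def conj_path_nth \<beta>_def power2_eq_square)
      then have "\<omega> t (1/2) $ 2 * cap (latitude j) t r $ 2 \<ge> 0"
        using C by simp
      ultimately show False
        using eq hp by simp
    next
      case True
      have "p $ 3 > 0"
        unfolding p_def using t r by (intro circle_z(2)) auto
      then have "J_map j p $ 3 > 0"
        by (rule J_map_signs(3)[OF n])
      moreover have "cap (latitude j) t r $ 3
          = cos \<beta> * sin (\<beta> + latitude j) - sin \<beta> * (\<omega> t (1/2) $ 1 * cos (\<beta> + latitude j))"
        unfolding cap_def \<beta>_def by (rule conj_path_nth)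
      then have "cap (latitude j) t r $ 3
          = sin (latitude j) + sin \<beta> * ((1 - \<omega> t (1/2) $ 1) * cos (\<beta> + latitude j))"
        using sin_diff[of "\<beta> + latitude j" \<beta>] by (simp add: algebra_simps)
      moreover have "sin \<beta> \<ge> 0" "sin (latitude j) \<ge> 0"
        using \<beta> l by (auto intro!: sin_ge_zero)
      moreover have "\<omega> t (1/2) $ 1 \<le> 1"
        using t by (intro cos_le_1) auto
      then have "0 \<le> sin \<beta> * ((1 - \<omega> t (1/2) $ 1) * cos (\<beta> + latitude j))"
        using C \<open>sin \<beta> \<ge> 0\<close> by simp
      ultimately show False
        using eq hp by simp
    qed
  qed
qed

lemma unwinding_homotopic_loop_x:
  "square_homotopic (\<lambda>t. unwinding (half_loop \<omega> j) (x_pt j) 1 t t) (loop_x \<omega> j)"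
  unfolding x_pt_eq_meridian
  using latitude_bounds[of j]
  by (intro square_homotopic_trans[OF unwinding_homotopic_sweep[OF _ _ half_loop_homotopic_cap]]
      square_homotopic_trans[OF sweep_homotopic_rotated_circles rotated_circles_homotopic_loop_x]) auto

lemma A_z0: "A t z0 = z0"
  by (simp add: A_def z0_eq_meridian vec3_eq_iff)

text \<open>The pole is the case of latitude \<open>pi/2\<close>, where the cap is constant. The map \<open>R\<close> is the rotation
  about the \<open>y\<close>-axis through \<open>pi/2\<close> composed with the half turn about the \<open>x\<close>-axis, and the homotopy
  lets the angle of the latter grow from \<open>0\<close> to \<open>pi\<close>.\<close>

lemma unwinding_homotopic_loop_z:
  "square_homotopic (\<lambda>t. unwinding (\<lambda>_ _. z0) z0 1 t t) (loop_z \<omega>)"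
proof -
  have cap: "square_homotopic (\<lambda>_ _. z0) (cap (pi/2))"
    by (rule square_homotopic_if_equal) (simp_all add: cap_def conj_path_0 A_z0 flip: z0_eq_meridian,
        simp add: z0_eq_meridian)
  \<comment> \<open>the rotation through \<open>pi * u\<close> about the \<open>x\<close>-axis, followed by the one about the \<open>y\<close>-axis\<close>
  define H where "H = (\<lambda>u t r. rotY (pi/2) (vector [\<omega> t r $ 1, cos (pi * u) * \<omega> t r $ 2 - sin (pi * u) * \<omega> t r $ 3,
    sin (pi * u) * \<omega> t r $ 2 + cos (pi * u) * \<omega> t r $ 3]))"
  have "square_homotopic (\<lambda>t r. rotY (pi/2) (\<omega> t r)) (loop_z \<omega>)"
  proof (rule square_homotopicI[where H = H])
    have "continuous_on ({0..1::real} \<times> {0..1} \<times> {0..1}) (\<lambda>x. \<omega> (fst (snd x)) (snd (snd x)))"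
      by (intro continuous_on_compose_two[OF continuous_on_circles] continuous_intros) auto
    then show "continuous_on ({0..1} \<times> {0..1} \<times> {0..1}) (\<lambda>(u, t, r). H u t r)"
      unfolding H_def case_prod_beta' by (intro continuous_intros)
    show "norm (H u t r) = 1" if "t \<in> {0..1}" "r \<in> {0..1}" for u t r
    proof -
      let ?p = "\<omega> t r" and ?C = "cos (pi * u)" and ?S = "sin (pi * u)"
      have "(?p$1)\<^sup>2 + (?C * ?p$2 - ?S * ?p$3)\<^sup>2 + (?S * ?p$2 + ?C * ?p$3)\<^sup>2
          = (?p$1)\<^sup>2 + (?S\<^sup>2 + ?C\<^sup>2) * ((?p$2)\<^sup>2 + (?p$3)\<^sup>2)"
        by algebra
      then show ?thesis
        using norm_circle[OF that] unfolding H_def norm_rotY by (simp add: norm_vec3)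
    qed
    show "H u t r = rotY (pi/2) (\<omega> t r)"
      if "t \<in> {0..1}" "r \<in> {0..1}" "t \<in> {0, 1} \<or> r \<in> {0, 1}" for u t r
    proof -
      have "\<omega> t r = x_pt 0"
        using that circle_ends circle_const by auto
      then show ?thesis
        by (simp add: H_def vec3_eq_iff x_pt_0_nth)
    qed
  qed (simp_all add: H_def loop_z_def R_map_def vec3_eq_iff)
  then have "square_homotopic (\<lambda>t. unwinding (\<lambda>_ _. z0) (meridian (pi/2)) 1 t t) (loop_z \<omega>)"
    by (intro square_homotopic_trans[OF unwinding_homotopic_sweep[OF _ _ cap]]
        square_homotopic_trans[OF sweep_homotopic_rotated_circles]) auto
  then show ?thesis
    by (simp add: z0_eq_meridian)
qed

lemma unwinding_minus: "unwinding (\<lambda>t r. - h t r) (- p) u t t' x = - unwinding h p u t t' x"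
  using linear_neg[OF linear_twist] linear_neg[OF linear_rotZ]
  by (simp add: unwinding_def join_loops_def A_def)

text \<open>Everything commutes with the antipodal map. The time reversal on the right undoes the one in the
  definition of the loops at \<open>- z0\<close>.\<close>

lemma unwinding_homotopic_loop_minus_z:
  "square_homotopic (\<lambda>t. unwinding (\<lambda>_ _. - z0) (- z0) 1 t t) (\<lambda>t r. loop_minus_z \<omega> (1 - t) r)"
proof -
  have "square_homotopic (\<lambda>t x. - unwinding (\<lambda>_ _. z0) z0 1 t t x) (\<lambda>t x. - loop_z \<omega> t x)"
    by (rule square_homotopic_apply[OF unwinding_homotopic_loop_z, where f = "\<lambda>_ p. - p"])
      (auto simp: case_prod_beta' intro!: continuous_intros)
  then show ?thesis
    by (rule square_homotopic_cong)
      (simp_all add: unwinding_minus[of "\<lambda>_ _. z0" z0] loop_minus_z_def)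
qed

end

section \<open>The sphere and the projective plane\<close>

lemma continuous_map_RP2_proj: "continuous_map S2 RP2 RP2_proj"
  unfolding RP2_def by (rule quotient_imp_continuous_map[OF quotient_map_quotient_topology])

lemma RP2_proj_eq_iff: "RP2_proj p = RP2_proj q \<longleftrightarrow> p = q \<or> p = - q"
  by (auto simp: RP2_proj_def doubleton_eq_iff)

lemma RP2_proj_linear_eq:
  assumes "linear L" "inj L"
  shows "RP2_proj (L p) = RP2_proj (L q) \<longleftrightarrow> RP2_proj p = RP2_proj q"
  using assms inj_eq[OF assms(2)] linear_neg[OF assms(1), of q] unfolding RP2_proj_eq_iff
  by metis

lemma meridian_eq_iff:
  assumes "\<phi> \<in> {-pi/2..pi/2}" "\<psi> \<in> {-pi/2..pi/2}"
  shows "meridian \<phi> = meridian \<psi> \<longleftrightarrow> \<phi> = \<psi>"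
  using sin_inj_pi[of \<phi> \<psi>] assms by (auto simp: vec3_eq_iff)

lemma latitude_eq_iff: "latitude i = latitude j \<longleftrightarrow> i = j"
proof -
  have "real i / (real i + 1) = real j / (real j + 1) \<longleftrightarrow> i = j"
    by (auto simp: field_simps)
  then show ?thesis unfolding latitude_def by (simp only: mult_cancel_left) simp
qed

lemma x_pt_eq_iff: "x_pt i = x_pt j \<longleftrightarrow> i = j"
  using latitude_bounds[of i] latitude_bounds[of j]
  by (simp add: x_pt_eq_meridian meridian_eq_iff latitude_eq_iff)

lemma x_pt_nth_pos: "x_pt i $ 1 > 0"
  using latitude_bounds[of i] by (simp add: x_pt_eq_meridian cos_gt_zero_pi)

lemma z0_nth: "z0 $ 1 = 0" "z0 $ 2 = 0" "z0 $ 3 = 1"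
  by (simp_all add: z0_def)

lemma x_pt_noteq_minus: "x_pt i \<noteq> - x_pt j"
  using x_pt_nth_pos[of i] x_pt_nth_pos[of j] by (metis less_asym neg_0_less_iff_less vector_uminus_component)

lemma x_pt_noteq_z0:
  "x_pt i \<noteq> z0" "x_pt i \<noteq> - z0" "z0 \<noteq> x_pt i" "- z0 \<noteq> x_pt i" "z0 \<noteq> - x_pt i"
  using x_pt_nth_pos[of i] z0_nth(1) by (metis less_irrefl neg_0_equal_iff_equal vector_uminus_component)+

lemma z0_noteq_minus: "z0 \<noteq> - z0" "- z0 \<noteq> z0"
  using z0_nth(3) by (auto simp: vec3_eq_iff)

lemma norm_x_pt: "norm (x_pt i) = 1" and norm_z0: "norm z0 = 1"
  by (simp_all add: x_pt_eq_meridian z0_eq_meridian)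

context circles
begin

lemma continuous_on_loop_z: "continuous_on ({0..1} \<times> {0..1}) (\<lambda>(t, r). loop_z \<omega> t r)"
  and norm_loop_z: "t \<in> {0..1} \<Longrightarrow> r \<in> {0..1} \<Longrightarrow> norm (loop_z \<omega> t r) = 1"
  using square_homotopic_imp_square[OF unwinding_homotopic_loop_z] by simp_all

lemma loop_z_boundary:
  assumes "t \<in> {0..1}" "r \<in> {0..1}" "t \<in> {0, 1} \<or> r \<in> {0, 1}"
  shows "loop_z \<omega> t r = z0"
proof -
  have "\<omega> t r = x_pt 0"
    using assms circle_ends circle_const by auto
  then show ?thesis
    by (simp add: loop_z_def R_map_def vec3_eq_iff x_pt_0_nth z0_nth)
qed

text \<open>The common part for both surfaces, with \<open>q\<close> the covering map (or the identity).\<close>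

theorem square_of_twist_class:
  fixes v :: "nat \<Rightarrow> real^3" and h g :: "nat \<Rightarrow> real \<Rightarrow> real \<Rightarrow> real^3"
  assumes q: "continuous_map S2 M q"
    and inj: "\<And>L. linear L \<Longrightarrow> inj L \<Longrightarrow> inj_on (\<lambda>i. q (L (v i))) {1..n}"
    and W: "W = (\<lambda>i\<in>{1..n}. q (v i))"
    and cases: "\<And>i. i \<in> {1..n} \<Longrightarrow>
      (\<exists>j. v i = x_pt j \<and> h i = half_loop \<omega> j \<and> g i = loop_x \<omega> j) \<or>
      v i = z0 \<and> h i = (\<lambda>_ _. z0) \<and> g i = loop_z \<omega> \<or>
      v i = - z0 \<and> h i = (\<lambda>_ _. - z0) \<and> g i = (\<lambda>t. loop_minus_z \<omega> (1 - t))"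
    and idx: "distinct idx" "set idx = {1..n}"
  shows "loop_class (htpy_fibre n M W) (htpy_fibre_base W) (\<lambda>t. fibre_point n (\<lambda>r i. q (h i t r)))
      [^]\<^bsub>pi1_htpy_fibre n M W\<^esub> (2::nat)
    = boundary_hom n M W (list_mult (pi2_power n M W)
        (map (\<lambda>i. pi2_inclusion n M W i (pi2_class M (W i) (\<lambda>t s. q (g i t s)))) idx))"
proof -
  have half: "continuous_on ({0..1} \<times> {0..1}) (\<lambda>(t, r). half_loop \<omega> j t r)"
    "t \<in> {0..1} \<Longrightarrow> r \<in> {0..1} \<Longrightarrow> norm (half_loop \<omega> j t r) = 1"
    "t \<in> {0..1} \<Longrightarrow> half_loop \<omega> j t 0 = A t (x_pt j)"
    "t \<in> {0..1} \<Longrightarrow> half_loop \<omega> j t 1 = x_pt j"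
    "t \<in> {0, 1} \<Longrightarrow> r \<in> {0..1} \<Longrightarrow> half_loop \<omega> j t r = x_pt j" for j t r
    using square_homotopic_imp_square[OF square_homotopic_sym[OF half_loop_homotopic_cap[of j]]]
      loop_x_middle[of t j] loop_x_boundary[of t 1 j] loop_x_boundary[of t "(1 + r)/2" j]
    by (auto simp: x_pt_eq_meridian half_loop_def)
  have n: "norm (v i) = 1" if "i \<in> {1..n}" for i
    using cases[OF that] by (auto simp: norm_x_pt norm_z0)
  have Am: "A t (- z0) = - z0" for t
    using A_z0 linear_neg[OF linear_rotZ] by (simp add: A_def)
  have sq: "square_homotopic (\<lambda>t. unwinding (h i) (v i) 1 t t) (g i)" if "i \<in> {1..n}" for i
    using cases[OF that] unwinding_homotopic_loop_x unwinding_homotopic_loop_z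
      unwinding_homotopic_loop_minus_z by auto
  have "loop_class (htpy_fibre n M W) (htpy_fibre_base W) (\<lambda>t. fibre_point n (\<lambda>r i. q (h i t r)))
      [^]\<^bsub>fundamental_group (htpy_fibre n M W) (htpy_fibre_base W)\<^esub> (2::nat)
    = loop_class (htpy_fibre n M W) (htpy_fibre_base W) (\<lambda>t. fibre_point n (\<lambda>r i. q (g i t r)))"
  proof (rule square_of_rotation_class[OF q n inj _ _ _ _ _ sq W])
    show "continuous_on ({0..1} \<times> {0..1}) (\<lambda>(t, r). h i t r)" if "i \<in> {1..n}" for i
      using cases[OF that] half by (auto simp: case_prod_beta')
    show "norm (h i t r) = 1" if "i \<in> {1..n}" "t \<in> {0..1}" "r \<in> {0..1}" for i t r
      using cases[OF that(1)] half(2)[OF that(2,3)] by (auto simp: norm_z0)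
    show "h i t 0 = A t (v i)" if "i \<in> {1..n}" "t \<in> {0..1}" for i t
      using cases[OF that(1)] half(3)[OF that(2)] by (auto simp: A_z0 Am)
    show "h i t 1 = v i" if "i \<in> {1..n}" "t \<in> {0..1}" for i t
      using cases[OF that(1)] half(4)[OF that(2)] by auto
    show "h i t r = v i" if "i \<in> {1..n}" "t \<in> {0, 1}" "r \<in> {0..1}" for i t r
      using cases[OF that(1)] half(5)[OF that(2,3)] by auto
  qed
  also have "\<dots> = boundary_hom n M W (list_mult (pi2_power n M W)
        (map (\<lambda>i. pi2_inclusion n M W i (pi2_class M (W i) (\<lambda>t s. q (g i t s)))) idx))"
  proof (rule boundary_hom_list_mult[OF _ _ _ idx, symmetric])
    show "W \<in> extensional {1..n}"
      by (simp add: W)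
    show "inj_on W {1..n}"
      using inj[of "\<lambda>x. x"] linear_id by (simp add: W inj_on_restrict_eq id_def inj_def)
    show "W i \<in> topspace M" if "i \<in> {1..n}" for i
      using that n[OF that] q by (auto simp: W S2_def continuous_map_def Pi_iff)
    have bd: "g i t s = v i" if "i \<in> {1..n}" "t \<in> {0..1}" "s \<in> {0..1}" "t \<in> {0, 1} \<or> s \<in> {0, 1}" for i t s
      using cases[OF that(1)] loop_x_boundary[OF that(2-4)] loop_z_boundary[OF that(2-4)]
      by (auto simp: x_pt_eq_meridian loop_minus_z_def)
    show "continuous_map (prod_topology unit_interval unit_interval) M (\<lambda>(t, s). q (g i t s))"
      if "i \<in> {1..n}" for i
      by (rule continuous_map_sphere_family[OF q square_homotopic_imp_square[OF sq[OF that]]])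
    show "q (g i t 0) = W i \<and> q (g i t 1) = W i" if "i \<in> {1..n}" "t \<in> {0..1}" for i t
      using bd[OF that, of 0] bd[OF that, of 1] that by (simp add: W)
    show "q (g i 0 s) = W i \<and> q (g i 1 s) = W i" if "i \<in> {1..n}" "s \<in> {0..1}" for i s
      using bd[OF that(1) _ that(2), of 0] bd[OF that(1) _ that(2), of 1] that by (simp add: W)
  qed
  finally show ?thesis
    unfolding pi1_htpy_fibre_def .
qed

text \<open>Reversing the time of a loop inverts its class; this accounts for the inverse in the last entry.\<close>

theorem square_of_twist_class_S2:
  assumes n: "n \<ge> 3"
  shows "tau_S2 n \<omega> [^]\<^bsub>pi1_htpy_fibre n S2 (base_S2 n)\<^esub> (2::nat) =
    boundary_hom n S2 (base_S2 n)
      (list_mult (pi2_power n S2 (base_S2 n))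
        (map (\<lambda>j. lambda_S2 n (j + 1) (loop_x \<omega> j)) [0..<n - 2] @
         [lambda_S2 n (n - 1) (loop_z \<omega>),
          inv\<^bsub>pi2_power n S2 (base_S2 n)\<^esub> (lambda_S2 n n (loop_minus_z \<omega>))]))"
proof -
  let ?W = "base_S2 n"
  define v where "v = (\<lambda>i. if i \<le> n - 2 then x_pt (i - 1) else if i = n - 1 then z0 else - z0)"
  define h where "h = (\<lambda>i. if i \<le> n - 2 then half_loop \<omega> (i - 1) else if i = n - 1 then (\<lambda>_ _. z0) else (\<lambda>_ _. - z0))"
  define g where "g = (\<lambda>i. if i \<le> n - 2 then loop_x \<omega> (i - 1) else if i = n - 1 then loop_z \<omega>
    else (\<lambda>t. loop_minus_z \<omega> (1 - t)))"
  define idx where "idx = map Suc [0..<n - 2] @ [n - 1, n]"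
  have W: "?W = (\<lambda>i\<in>{1..n}. id (v i))"
    by (simp add: base_S2_def v_def)
  have v_inj: "inj_on v {1..n}"
    by (auto simp: inj_on_def v_def x_pt_eq_iff x_pt_noteq_z0 z0_noteq_minus split: if_splits)
  have idx: "distinct idx" "set idx = {1..n}"
    using n by (auto simp: idx_def distinct_map image_Suc_lessThan atLeast0LessThan)
  have tau: "tau_S2 n \<omega> = loop_class (htpy_fibre n S2 ?W) (htpy_fibre_base ?W)
      (\<lambda>t. fibre_point n (\<lambda>r i. id (h i t r)))"
    unfolding tau_S2_def fibre_point_def
    by (intro arg_cong[of _ _ "loop_class _ _"] ext)
      (auto simp: h_def half_loop_def fun_eq_iff restrict_def)
  have "tau_S2 n \<omega> [^]\<^bsub>pi1_htpy_fibre n S2 ?W\<^esub> (2::nat) =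
      boundary_hom n S2 ?W (list_mult (pi2_power n S2 ?W)
        (map (\<lambda>i. pi2_inclusion n S2 ?W i (pi2_class S2 (?W i) (\<lambda>t s. id (g i t s)))) idx))"
    unfolding tau
  proof (rule square_of_twist_class[where q = id and v = v and h = h and g = g, OF _ _ W _ idx])
    show "inj_on (\<lambda>i. id (L (v i))) {1..n}" if "inj L" for L :: "real^3 \<Rightarrow> real^3"
      using comp_inj_on[OF v_inj inj_on_subset[OF that subset_UNIV]] by (simp add: o_def)
    show "(\<exists>j. v i = x_pt j \<and> h i = half_loop \<omega> j \<and> g i = loop_x \<omega> j) \<or>
        v i = z0 \<and> h i = (\<lambda>_ _. z0) \<and> g i = loop_z \<omega> \<or>
        v i = - z0 \<and> h i = (\<lambda>_ _. - z0) \<and> g i = (\<lambda>t. loop_minus_z \<omega> (1 - t))" for i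
    proof (cases "i \<le> n - 2")
      case True
      then show ?thesis
        by (intro disjI1 exI[of _ "i - 1"]) (simp add: v_def h_def g_def)
    next
      case False
      show ?thesis
      proof (cases "i = n - 1")
        case True
        with False show ?thesis
          by (intro disjI2[OF disjI1] conjI) (simp_all add: v_def h_def g_def)
      next
        case 2: False
        with False show ?thesis
          by (intro disjI2[OF disjI2] conjI) (simp_all add: v_def h_def g_def)
      qed
    qed
  qed simp
  also have "map (\<lambda>i. pi2_inclusion n S2 ?W i (pi2_class S2 (?W i) (\<lambda>t s. id (g i t s)))) idx
      = map (\<lambda>j. lambda_S2 n (j + 1) (loop_x \<omega> j)) [0..<n - 2] @
         [lambda_S2 n (n - 1) (loop_z \<omega>),
          inv\<^bsub>pi2_power n S2 ?W\<^esub> (lambda_S2 n n (loop_minus_z \<omega>))]"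
  proof -
    have "inv\<^bsub>pi2_power n S2 ?W\<^esub> (lambda_S2 n n (loop_minus_z \<omega>))
        = pi2_inclusion n S2 ?W n (pi2_class S2 (?W n) (\<lambda>t. loop_minus_z \<omega> (1 - t)))"
      unfolding lambda_S2_def pi2_class_def
    proof (rule inv_pi2_inclusion)
      show "?W i \<in> topspace S2" if "i \<in> {1..n}" for i
        using that by (auto simp: base_S2_def S2_def norm_x_pt norm_z0)
      have Wn: "?W n = - z0"
      proof -
        have "n \<noteq> n - 1" "\<not> n \<le> n - 2" "1 \<le> n"
          using n by auto
        then show ?thesis by (simp add: base_S2_def)
      qed
      show "loop_in (loop_space S2 (?W n)) (const_loop (?W n)) (\<lambda>t. restrict (loop_minus_z \<omega> t) {0..1})"
        unfolding Wn
      proof (rule loop_in_loop_space)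
        have "continuous_on ({0..1} \<times> {0..1}) (\<lambda>p. - loop_z \<omega> (1 - fst p) (snd p))"
          by (intro continuous_intros continuous_on_compose_two[OF continuous_on_loop_z]) auto
        then show "continuous_map (prod_topology unit_interval unit_interval) S2 (\<lambda>(t, r). loop_minus_z \<omega> t r)"
          using norm_loop_z by (auto simp: S2_def loop_minus_z_def case_prod_beta' simp flip: subtopology_Times)
      qed (use loop_z_boundary in \<open>auto simp: loop_minus_z_def\<close>)
    qed (use n in auto)
    moreover have "n - 1 \<noteq> n" "\<not> n - 1 \<le> n - 2" "\<not> n \<le> n - 2" "n \<noteq> n - 1"
      using n by auto
    ultimately show ?thesis
      by (simp add: idx_def lambda_S2_def g_def)
  qed
  finally show ?thesis .
qed

theorem square_of_twist_class_RP2: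
  assumes n: "n \<ge> 2"
  shows "tau_RP2 n \<omega> [^]\<^bsub>pi1_htpy_fibre n RP2 (base_RP2 n)\<^esub> (2::nat) =
    boundary_hom n RP2 (base_RP2 n)
      (list_mult (pi2_power n RP2 (base_RP2 n))
        (map (\<lambda>j. lambda_RP2 n (j + 1) (loop_x \<omega> j)) [0..<n - 1] @ [lambda_RP2 n n (loop_z \<omega>)]))"
proof -
  let ?W = "base_RP2 n"
  define v where "v = (\<lambda>i. if i \<le> n - 1 then x_pt (i - 1) else z0)"
  define h where "h = (\<lambda>i. if i \<le> n - 1 then half_loop \<omega> (i - 1) else (\<lambda>_ _. z0))"
  define g where "g = (\<lambda>i. if i \<le> n - 1 then loop_x \<omega> (i - 1) else loop_z \<omega>)"
  define idx where "idx = map Suc [0..<n - 1] @ [n]"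
  have W: "?W = (\<lambda>i\<in>{1..n}. RP2_proj (v i))"
    by (auto simp: base_RP2_def v_def fun_eq_iff restrict_def)
  have v_inj: "inj_on (\<lambda>i. RP2_proj (v i)) {1..n}"
    by (auto simp: inj_on_def v_def RP2_proj_eq_iff x_pt_eq_iff x_pt_noteq_minus x_pt_noteq_z0
        split: if_splits)
  have idx: "distinct idx" "set idx = {1..n}"
    using n by (auto simp: idx_def distinct_map image_Suc_lessThan atLeast0LessThan)
  have tau: "tau_RP2 n \<omega> = loop_class (htpy_fibre n RP2 ?W) (htpy_fibre_base ?W)
      (\<lambda>t. fibre_point n (\<lambda>r i. RP2_proj (h i t r)))"
    unfolding tau_RP2_def fibre_point_def
    by (intro arg_cong[of _ _ "loop_class _ _"] ext)
      (auto simp: h_def half_loop_def fun_eq_iff restrict_def)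
  have "tau_RP2 n \<omega> [^]\<^bsub>pi1_htpy_fibre n RP2 ?W\<^esub> (2::nat) =
      boundary_hom n RP2 ?W (list_mult (pi2_power n RP2 ?W)
        (map (\<lambda>i. pi2_inclusion n RP2 ?W i (pi2_class RP2 (?W i) (\<lambda>t s. RP2_proj (g i t s)))) idx))"
    unfolding tau
  proof (rule square_of_twist_class[where q = RP2_proj and v = v and h = h and g = g, OF continuous_map_RP2_proj _ W _ idx])
    show "inj_on (\<lambda>i. RP2_proj (L (v i))) {1..n}" if "linear L" "inj L" for L :: "real^3 \<Rightarrow> real^3"
      by (rule inj_onI) (unfold RP2_proj_linear_eq[OF that], rule inj_onD[OF v_inj])
    show "(\<exists>j. v i = x_pt j \<and> h i = half_loop \<omega> j \<and> g i = loop_x \<omega> j) \<or>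
        v i = z0 \<and> h i = (\<lambda>_ _. z0) \<and> g i = loop_z \<omega> \<or>
        v i = - z0 \<and> h i = (\<lambda>_ _. - z0) \<and> g i = (\<lambda>t. loop_minus_z \<omega> (1 - t))" for i
    proof (cases "i \<le> n - 1")
      case True
      then show ?thesis
        by (intro disjI1 exI[of _ "i - 1"]) (simp add: v_def h_def g_def)
    next
      case False
      then show ?thesis
        by (intro disjI2[OF disjI1]) (simp add: v_def h_def g_def)
    qed
  qed
  also have "map (\<lambda>i. pi2_inclusion n RP2 ?W i (pi2_class RP2 (?W i) (\<lambda>t s. RP2_proj (g i t s)))) idx
      = map (\<lambda>j. lambda_RP2 n (j + 1) (loop_x \<omega> j)) [0..<n - 1] @ [lambda_RP2 n n (loop_z \<omega>)]"
  proof -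
    have "\<not> n \<le> n - 1"
      using n by auto
    then show ?thesis
      by (simp add: idx_def lambda_RP2_def g_def)
  qed
  finally show ?thesis .
qed

end

theorem theorem3:
  fixes \<omega> :: "real \<Rightarrow> real \<Rightarrow> real^3" and n :: nat
  assumes "circle_family \<omega>"
  shows
    "(n \<ge> 3 \<longrightarrow>
        (let \<Pi>\<^sub>2 = pi2_power n S2 (base_S2 n) in
          tau_S2 n \<omega> [^]\<^bsub>pi1_htpy_fibre n S2 (base_S2 n)\<^esub> (2::nat) =
          boundary_hom n S2 (base_S2 n)
            (list_mult \<Pi>\<^sub>2
              (map (\<lambda>j. lambda_S2 n (j + 1) (loop_x \<omega> j)) [0..<n - 2] @
               [lambda_S2 n (n - 1) (loop_z \<omega>),
                inv\<^bsub>\<Pi>\<^sub>2\<^esub> (lambda_S2 n n (loop_minus_z \<omega>))])))) \<and>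
     (n \<ge> 2 \<longrightarrow>
        (let \<Pi>\<^sub>2 = pi2_power n RP2 (base_RP2 n) in
          tau_RP2 n \<omega> [^]\<^bsub>pi1_htpy_fibre n RP2 (base_RP2 n)\<^esub> (2::nat) =
          boundary_hom n RP2 (base_RP2 n)
            (list_mult \<Pi>\<^sub>2
              (map (\<lambda>j. lambda_RP2 n (j + 1) (loop_x \<omega> j)) [0..<n - 1] @
               [lambda_RP2 n n (loop_z \<omega>)]))))"
proof -
  interpret circles \<omega>
    by unfold_locales (rule assms)
  show ?thesis
    unfolding Let_def using square_of_twist_class_S2 square_of_twist_class_RP2 by blast
qed

end
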